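(* Let $L$ be a one-dimensional mixed-type Kimura operator on $[0,1]$ both of whose endpoints are transverse, let $\mathcal Q_t=e^{tL}$, and let $\mu$ be its invariant probability measure supported on the whole interval. Then $\mu$ satisfies a Poincaré inequality. Moreover, there is a constant $C_{LP}>0$, namely the constant in a $(W)$-Lyapunov-Poincaré inequality satisfied by $\mu$ (for some $W$), such that for every $f\in L^2(\mu)$ and $t\ge 0$, $$\Big\|\mathcal Q_tf-\int f\,d\mu\Big\|_{L^2(\mu)}\le e^{-\frac{t}{2C_{LP}}}\Big\|f-\int f\,d\mu\Big\|_{L^2(\mu)},$$ and for any probability measure $v=h\mu$ with $h\in L^2(\mu)$, $$\|\mathcal Q_t^*v-\mu\|_{\mathrm{TV}}\le e^{-\frac{t}{2C_{LP}}}\|h-1\|_{L^2(\mu)}.$$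
   Context: A one-dimensional mixed-type Kimura operator is $$L=\tilde a(x)\frac{d^2}{dx^2}+\tilde b(x)\frac{d}{dx},\quad \tilde a=a(x)x^{m(0)}(1-x)^{m(1)},\quad \tilde b=b(x)x^{m(0)-1}(1-x)^{m(1)-1},$$ on $[0,1]$, with $a,b\in C^\infty([0,1])$, $a>0$, $m(0),m(1)\in\{1,2\}$. The endpoint $i$ is of Kimura type if $m(i)=1$ and of quadratic type if $m(i)=2$. A Kimura endpoint $0$ (resp. $1$) is transverse if $b(0)>0$ (resp. $b(1)<0$). A quadratic endpoint $0$ (resp. $1$) is transverse if $b(0)/a(0)>1$ (resp. $b(1)/a(1)<-1$). $\mathcal Q_t=e^{tL}$ is the solution semigroup of the Cauchy problem $\partial_tu=Lu$, $u(\cdot,0)=f$ (extended to $L^2(\mu)$), and $\mathcal Q_t^*$ is its dual action on measures. In the coordinate $z$ with $\frac{dz}{dx}=\frac{1}{\sqrt{2\tilde a(x)}}$, ranging over an interval $X$, the operator becomes $L=\frac12\partial_{zz}-\nabla U(z)\,\partial_z$ for some function $U$. When both endpoints are transverse, $Z=\int_X e^{-2U(z)}dz<\infty$, and the invariant measure is the probability measure $$\mu(dz)=\frac{e^{-2U(z)}}{Z}\,dz .$$ Equivalently, in the variable $x$ it has density proportional to $\frac{1}{\tilde a(x)}\exp\big(\int_{1/2}^x\frac{\tilde b}{\tilde a}\big)$. $L$ is self-adjoint on $L^2(\mu)$. Below, $\nabla=\partial_z$. Poincaré inequality: there is a constant $C>0$ such that $\int f^2d\mu\le C\int|\nabla f|^2d\mu$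 for all nice (sufficiently regular, with all terms defined) $f$ with $\int f\,d\mu=0$. $(W)$-Lyapunov-Poincaré inequality: $\mu$ satisfies it, with $W\in D(L)$, $W\ge 1$ and constant $C_{LP}$, if for all nice $f$ with $\int f\,d\mu=0$, $$\int f^2W\,d\mu\le C_{LP}\int\big(W|\nabla f|^2-W\,L(f^2)\big)\,d\mu .$$ $\|\cdot\|_{\mathrm{TV}}$ is normalized so that $\|g\mu-\mu\|_{\mathrm{TV}}=\|g-1\|_{L^1(\mu)}$. *)

theory Defs
  imports "HOL-Probability.Probability"
begin

section \<open>Kimura operators of mixed type on the unit interval\<close>

text \<open>Derivatives relative to \<open>S\<close>: one-sided at the endpoints when \<open>S = {0..1}\<close>, so that
  \<open>Ck k {0..1}\<close> is the space of functions that are $k$ times continuously differentiable up to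
  the boundary. Only the values of \<open>f\<close> on \<open>S\<close> matter.\<close>

definition Ck :: "nat \<Rightarrow> real set \<Rightarrow> (real \<Rightarrow> real) \<Rightarrow> bool" where
  "Ck k S f \<longleftrightarrow> (\<exists>D :: nat \<Rightarrow> real \<Rightarrow> real.
      (\<forall>x\<in>S. D 0 x = f x) \<and>
      (\<forall>n<k. \<forall>x\<in>S. (D n has_real_derivative D (Suc n) x) (at x within S)) \<and>
      continuous_on S (D k))"

definition Cinf :: "real set \<Rightarrow> (real \<Rightarrow> real) \<Rightarrow> bool" where
  "Cinf S f \<longleftrightarrow> (\<forall>k. Ck k S f)"

definition dx :: "(real \<Rightarrow> real) \<Rightarrow> real \<Rightarrow> real" where
  "dx f x = vector_derivative f (at x within {0..1})"

definition a_tilde :: "(real \<Rightarrow> real) \<Rightarrow> nat \<Rightarrow> nat \<Rightarrow> real \<Rightarrow> real" where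
  "a_tilde a m0 m1 x = a x * x ^ m0 * (1 - x) ^ m1"

definition b_tilde :: "(real \<Rightarrow> real) \<Rightarrow> nat \<Rightarrow> nat \<Rightarrow> real \<Rightarrow> real" where
  "b_tilde b m0 m1 x = b x * x ^ (m0 - 1) * (1 - x) ^ (m1 - 1)"

definition mixed_kimura :: "(real \<Rightarrow> real) \<Rightarrow> (real \<Rightarrow> real) \<Rightarrow> nat \<Rightarrow> nat \<Rightarrow> bool" where
  "mixed_kimura a b m0 m1 \<longleftrightarrow>
     Cinf {0..1} a \<and> Cinf {0..1} b \<and> (\<forall>x\<in>{0..1}. a x > 0) \<and> m0 \<in> {1, 2} \<and> m1 \<in> {1, 2}"

definition kimura_op ::
    "(real \<Rightarrow> real) \<Rightarrow> (real \<Rightarrow> real) \<Rightarrow> nat \<Rightarrow> nat \<Rightarrow> (real \<Rightarrow> real) \<Rightarrow> real \<Rightarrow> real" where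
  "kimura_op a b m0 m1 f x = a_tilde a m0 m1 x * dx (dx f) x + b_tilde b m0 m1 x * dx f x"

definition transverse0 :: "(real \<Rightarrow> real) \<Rightarrow> (real \<Rightarrow> real) \<Rightarrow> nat \<Rightarrow> bool" where
  "transverse0 a b m0 \<longleftrightarrow> (if m0 = 1 then b 0 > 0 else b 0 / a 0 > 1)"

definition transverse1 :: "(real \<Rightarrow> real) \<Rightarrow> (real \<Rightarrow> real) \<Rightarrow> nat \<Rightarrow> bool" where
  "transverse1 a b m1 \<longleftrightarrow> (if m1 = 1 then b 1 < 0 else b 1 / a 1 < -1)"

text \<open>The derivative in the coordinate $z$ with $dz/dx = (2 \tilde a)^{-1/2}$, expressed in $x$.\<close>

definition grad_z :: "(real \<Rightarrow> real) \<Rightarrow> nat \<Rightarrow> nat \<Rightarrow> (real \<Rightarrow> real) \<Rightarrow> real \<Rightarrow> real" where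
  "grad_z a m0 m1 f x = sqrt (2 * a_tilde a m0 m1 x) * dx f x"


section \<open>The invariant measure\<close>

text \<open>In the coordinate $z$ one has $L = \frac12 \partial_{zz} - U' \partial_z$ with
  $e^{-2U} \propto \tilde a^{-1/2} \exp \int_{1/2}^x \tilde b / \tilde a$, hence
  $e^{-2U} dz \propto \tilde a^{-1} \exp (\int_{1/2}^x \tilde b / \tilde a)\, dx$.
  The interval integral is signed, so the formula is also the intended one for $x < 1/2$. The
  weight has no meaning at the two endpoints, which are a null set.\<close>

definition kimura_weight ::
    "(real \<Rightarrow> real) \<Rightarrow> (real \<Rightarrow> real) \<Rightarrow> nat \<Rightarrow> nat \<Rightarrow> real \<Rightarrow> real" where
  "kimura_weight a b m0 m1 x =
     1 / a_tilde a m0 m1 x *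
     exp (LBINT y=ereal (1/2)..ereal x. b_tilde b m0 m1 y / a_tilde a m0 m1 y)"

definition kimura_measure ::
    "(real \<Rightarrow> real) \<Rightarrow> (real \<Rightarrow> real) \<Rightarrow> nat \<Rightarrow> nat \<Rightarrow> real measure" where
  "kimura_measure a b m0 m1 =
     (let Z = (LINT x|restrict_space lborel {0..1}. kimura_weight a b m0 m1 x)
      in density (restrict_space lborel {0..1}) (\<lambda>x. ennreal (kimura_weight a b m0 m1 x / Z)))"


section \<open>The semigroup\<close>

text \<open>Elements of $L^2$ are represented by functions, and identities between them hold almost
  everywhere.\<close>

definition L2 :: "'a measure \<Rightarrow> ('a \<Rightarrow> real) set" where
  "L2 M = {f \<in> borel_measurable M. integrable M (\<lambda>x. (f x)\<^sup>2)}"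

definition l2norm :: "'a measure \<Rightarrow> ('a \<Rightarrow> real) \<Rightarrow> real" where
  "l2norm M f = sqrt (LINT x|M. (f x)\<^sup>2)"

definition bounded_linear_L2 :: "'a measure \<Rightarrow> (('a \<Rightarrow> real) \<Rightarrow> 'a \<Rightarrow> real) \<Rightarrow> bool" where
  "bounded_linear_L2 M T \<longleftrightarrow>
     (\<forall>f\<in>L2 M. T f \<in> L2 M) \<and>
     (\<forall>f\<in>L2 M. \<forall>g\<in>L2 M. \<forall>c d.
        AE x in M. T (\<lambda>y. c * f y + d * g y) x = c * T f x + d * T g x) \<and>
     (\<exists>K. \<forall>f\<in>L2 M. l2norm M (T f) \<le> K * l2norm M f)"

text \<open>Classical solutions $u(t,x)$ of $\partial_t u = L u$, $u(0,\cdot) = f$ that are regular up to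
  the boundary in $x$ and up to $t = 0$ in time. No boundary condition is imposed besides this
  regularity.\<close>

definition cauchy_solution ::
    "(real \<Rightarrow> real) \<Rightarrow> (real \<Rightarrow> real) \<Rightarrow> nat \<Rightarrow> nat \<Rightarrow> (real \<Rightarrow> real) \<Rightarrow> (real \<Rightarrow> real \<Rightarrow> real) \<Rightarrow> bool" where
  "cauchy_solution a b m0 m1 f u \<longleftrightarrow>
     (\<forall>x\<in>{0..1}. u 0 x = f x) \<and>
     (\<forall>t\<ge>0. Ck 2 {0..1} (u t)) \<and>
     continuous_on ({0..} \<times> {0..1}) (\<lambda>(t, x). kimura_op a b m0 m1 (u t) x) \<and>
     (\<forall>t\<ge>0. \<forall>x\<in>{0..1}.
        ((\<lambda>s. u s x) has_real_derivative kimura_op a b m0 m1 (u t) x) (at t within {0..}))"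

text \<open>\<open>Q t\<close> is $e^{tL}$ on $L^2(\mu)$: the bounded linear extension of the solution operator of the
  Cauchy problem with data in $C^\infty([0,1])$. Since these data are dense in $L^2(\mu)$, this
  determines \<open>Q t\<close> for $t \ge 0$ up to null sets; contractivity, positivity, symmetry and the
  semigroup law are consequences and not part of the definition.\<close>

definition solution_semigroup ::
    "(real \<Rightarrow> real) \<Rightarrow> (real \<Rightarrow> real) \<Rightarrow> nat \<Rightarrow> nat \<Rightarrow> (real \<Rightarrow> (real \<Rightarrow> real) \<Rightarrow> real \<Rightarrow> real) \<Rightarrow> bool" where
  "solution_semigroup a b m0 m1 Q \<longleftrightarrow>
     (\<forall>t\<ge>0. bounded_linear_L2 (kimura_measure a b m0 m1) (Q t)) \<and>
     (\<forall>f. Cinf {0..1} f \<longrightarrow>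
        (\<exists>u. cauchy_solution a b m0 m1 f u \<and>
             (\<forall>t\<ge>0. AE x in kimura_measure a b m0 m1. Q t f x = u t x)))"

text \<open>The domain $D(L)$ of the generator of \<open>Q\<close> on $L^2$.\<close>

definition generator_domain ::
    "'a measure \<Rightarrow> (real \<Rightarrow> ('a \<Rightarrow> real) \<Rightarrow> 'a \<Rightarrow> real) \<Rightarrow> ('a \<Rightarrow> real) set" where
  "generator_domain M Q =
     {f \<in> L2 M. \<exists>g\<in>L2 M.
        ((\<lambda>t. l2norm M (\<lambda>x. (Q t f x - f x) / t - g x)) \<longlongrightarrow> 0) (at_right 0)}"

text \<open>The dual action $(Q_t^* v)(A) = \int Q_t 1_A \, dv$. As \<open>Q t\<close> is only determined up to null
  sets of $\mu$, this is meaningful for $v$ absolutely continuous with respect to $\mu$ with a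
  density in $L^2(\mu)$.\<close>

definition dual_action ::
    "(('a \<Rightarrow> real) \<Rightarrow> 'a \<Rightarrow> real) \<Rightarrow> 'a measure \<Rightarrow> 'a measure" where
  "dual_action T v =
     measure_of (space v) (sets v) (\<lambda>A. ennreal (LINT x|v. T (indicator A) x))"

text \<open>The total mass of $|M - N|$, by the Hahn decomposition; thus the distance of $g\mu$ and $\mu$
  is $\|g - 1\|_{L^1(\mu)}$, twice the supremum of $|M(A) - N(A)|$ for probability measures.\<close>

definition tv_dist :: "'a measure \<Rightarrow> 'a measure \<Rightarrow> real" where
  "tv_dist M N =
     (SUP A\<in>sets N. \<bar>measure M A - measure N A\<bar> +
                     \<bar>measure M (space N - A) - measure N (space N - A)\<bar>)"


section \<open>Functional inequalities\<close>

definition poincare_inequality ::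
    "(real \<Rightarrow> real) \<Rightarrow> (real \<Rightarrow> real) \<Rightarrow> nat \<Rightarrow> nat \<Rightarrow> bool" where
  "poincare_inequality a b m0 m1 \<longleftrightarrow>
     (let \<mu> = kimura_measure a b m0 m1 in
      \<exists>C>0. \<forall>f. Ck 1 {0<..<1} f \<longrightarrow> f \<in> L2 \<mu> \<longrightarrow>
        integrable \<mu> (\<lambda>x. (grad_z a m0 m1 f x)\<^sup>2) \<longrightarrow> (LINT x|\<mu>. f x) = 0 \<longrightarrow>
        (LINT x|\<mu>. (f x)\<^sup>2) \<le> C * (LINT x|\<mu>. (grad_z a m0 m1 f x)\<^sup>2))"

text \<open>The test functions are all elements of $D(L)$ that are twice continuously differentiable in
  the interior and for which the three terms are integrable. Membership in $D(L)$ encodes the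
  boundary behaviour; interior regularity alone would not do, e.g. at a Kimura endpoint with
  $0 < b(0)/a(0) < 1$, where functions behaving like $1 + x^{1 - b(0)/a(0)}$ produce a boundary term
  in $\int L(f^2) d\mu$.\<close>

definition lyapunov_poincare ::
    "(real \<Rightarrow> real) \<Rightarrow> (real \<Rightarrow> real) \<Rightarrow> nat \<Rightarrow> nat \<Rightarrow> (real \<Rightarrow> (real \<Rightarrow> real) \<Rightarrow> real \<Rightarrow> real)
       \<Rightarrow> (real \<Rightarrow> real) \<Rightarrow> real \<Rightarrow> bool" where
  "lyapunov_poincare a b m0 m1 Q W C \<longleftrightarrow>
     (let \<mu> = kimura_measure a b m0 m1; L = kimura_op a b m0 m1 in
      W \<in> generator_domain \<mu> Q \<and> (\<forall>x\<in>{0..1}. W x \<ge> 1) \<and>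
      (\<forall>f\<in>generator_domain \<mu> Q. Ck 2 {0<..<1} f \<longrightarrow>
         integrable \<mu> (\<lambda>x. (f x)\<^sup>2 * W x) \<longrightarrow>
         integrable \<mu> (\<lambda>x. W x * (grad_z a m0 m1 f x)\<^sup>2) \<longrightarrow>
         integrable \<mu> (\<lambda>x. W x * L (\<lambda>y. (f y)\<^sup>2) x) \<longrightarrow>
         (LINT x|\<mu>. f x) = 0 \<longrightarrow>
         (LINT x|\<mu>. (f x)\<^sup>2 * W x)
           \<le> C * (LINT x|\<mu>. W x * (grad_z a m0 m1 f x)\<^sup>2 - W x * L (\<lambda>y. (f y)\<^sup>2) x)))"

end

theory Submission
  imports Defs
begin

text \<open>
  Write \<open>A\<close>, \<open>B\<close> for the coefficients of \<open>L\<close>, \<open>w\<close> for the unnormalised weight of \<open>\<mu>\<close> and \<open>p = A w\<close>.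
  Since \<open>p' = B w\<close>, the operator has the Sturm-Liouville form \<open>L f = (p f')' / w\<close>, and everything
  depends on the behaviour of \<open>p\<close> and \<open>w\<close> at the endpoints. With \<open>\<beta> = b 0 / a 0\<close>, near \<open>0\<close> the function
  \<open>p\<close> behaves like \<open>x powr \<beta>\<close> and \<open>w\<close> like \<open>x powr (\<beta> - m0)\<close>, so transversality \<open>\<beta> > m0 - 1\<close> says that
  \<open>w\<close> is integrable there. It also makes \<open>p\<close> vanish at the endpoint: a function that is regular up
  to the boundary has no flux \<open>p f'\<close> through it, and \<open>L\<close> is symmetric on such functions.

  The Poincare inequality comes from Hardy's method: if \<open>\<phi>' \<ge> w\<close> and \<open>\<phi>\<^sup>2 \<le> K w p\<close>, then
  \<open>(g\<^sup>2 \<phi>)' \<ge> g\<^sup>2 w / 2 - 2 K g'\<^sup>2 p\<close>, and integrating this for \<open>g = f - f (1/2)\<close> on each side of the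
  midpoint bounds the variance of \<open>f\<close> by its energy (\<open>hardy_interval\<close>, \<open>poincare\<close>). At the endpoint \<open>0\<close>, a barrier \<open>\<phi>\<close>
  with these properties is a multiple of \<open>x powr (1 - m) * p x * exp (l x)\<close>. Its derivative is of the size of \<open>w\<close>
  because of transversality, and \<open>\<phi>\<^sup>2 \<le> K w p\<close> compares \<open>x powr (2 - 2 m)\<close> with \<open>x powr (- m)\<close>, which is
  where \<open>m \<le> 2\<close> enters (\<open>endpoint_barrier\<close>). The barrier also gives the integrability of \<open>w\<close>.

  The decay comes from energy estimates. For a classical solution and a \<open>C\<^sup>2\<close> function \<open>\<psi>\<close>, integration by parts gives
  \<open>d/dt \<integral> \<psi> (u) d\<mu> = - \<integral> \<psi>'' (u) A (\<partial>\<^sub>x u)\<^sup>2 d\<mu>\<close> (\<open>solution_entropy\<close>). The choice \<open>\<psi> y = y\<close> is conservation of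
  mass; \<open>\<psi> y = (y - c)\<^sup>2\<close>, with \<open>c\<close> the mean, together with the Poincare inequality with constant \<open>C\<close> gives the
  exponential rate \<open>1 / (2 C)\<close> for the \<open>L\<^sup>2\<close> norm; a Lipschitz convex \<open>\<psi>\<close> that vanishes exactly on the nonnegative numbers
  gives positivity. Each of the three statements is continuous in \<open>L\<^sup>2\<close>, and polynomials, which are
  admissible data, are dense (\<open>L2_polynomial_approximation\<close>), so they hold for all of \<open>L\<^sup>2\<close>.

  The Lyapunov-Poincare inequality holds for the weight \<open>W = 1\<close> with the same constant \<open>C\<close>. As
  \<open>|\<nabla>f|\<^sup>2 - L (f\<^sup>2) = - 2 f L f\<close> pointwise, the claim is \<open>\<integral> f\<^sup>2 d\<mu> \<le> - 2 C \<integral> f L f d\<mu>\<close>. With the generator \<open>g\<close> of the semigroup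
  in place of \<open>L f\<close> this is the derivative at \<open>t = 0\<close> of the decay estimate
  (\<open>generator_dissipative\<close>), and \<open>g = L f\<close> holds almost everywhere because
  \<open>\<integral> g v d\<mu> = \<integral> f L v d\<mu>\<close> for all test functions \<open>v\<close> (\<open>generator_weak\<close>, \<open>generator_eq_L\<close>). The identification only
  looks at the interior; membership of \<open>f\<close> in the domain has taken care of the boundary.

  For the total variation bound, positivity and \<open>L\<^sup>2\<close> continuity make the dual action a measure. Its deviation from
  \<open>\<mu>\<close> on a set \<open>S\<close> is the pairing of \<open>Q\<^sub>t 1\<^sub>S - \<mu> S\<close> with \<open>h - 1\<close>, to which the decay estimate applies.
\<close>

section \<open>Functions of a real variable\<close>

lemma le_from_approx:
  fixes x y c :: real
  assumes "\<And>e. e > 0 \<Longrightarrow> x \<le> y + c * e" "c \<ge> 0"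
  shows "x \<le> y"
proof (rule field_le_epsilon)
  fix e :: real assume "e > 0"
  have "e / (c + 1) > 0" using assms(2) \<open>e > 0\<close> by simp
  then have "x \<le> y + c * (e / (c + 1))" by (rule assms(1))
  also have "c * (e / (c + 1)) \<le> e"
    using assms(2) \<open>e > 0\<close> by (simp add: field_simps)
  finally show "x \<le> y + e" by simp
qed

lemma bounded_continuous_Icc:
  fixes f :: "real \<Rightarrow> real"
  assumes "continuous_on {s..t} f"
  obtains N where "N \<ge> 0" "\<And>x. x \<in> {s..t} \<Longrightarrow> \<bar>f x\<bar> \<le> N"
proof -
  obtain N where N: "\<forall>y\<in>f ` {s..t}. norm y \<le> N"
    using compact_imp_bounded[OF compact_continuous_image[OF assms compact_Icc]]
    unfolding bounded_iff by blast
  show ?thesis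
  proof (rule that[of "\<bar>N\<bar>"])
    fix x assume "x \<in> {s..t}"
    then have "\<bar>f x\<bar> \<le> N" using N by simp
    then show "\<bar>f x\<bar> \<le> \<bar>N\<bar>" by simp
  qed simp
qed

text \<open>The derivative at time \<open>0\<close> is one-sided, as in the definition of a classical solution.\<close>

lemma nonincreasing_from_0:
  fixes F D :: "real \<Rightarrow> real"
  assumes F: "\<And>t. t \<ge> 0 \<Longrightarrow> (F has_real_derivative D t) (at t within {0..})"
    and D: "\<And>t. t \<ge> 0 \<Longrightarrow> D t \<le> 0" and t: "t \<ge> 0"
  shows "F t \<le> F 0"
proof (rule DERIV_nonpos_imp_decreasing_open[OF t])
  fix x :: real assume "0 < x" "x < t"
  then have "(F has_real_derivative D x) (at x)"
    using F[of x] at_within_interior[of x "{0..}"] by simp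
  then show "\<exists>y. (F has_real_derivative y) (at x) \<and> y \<le> 0"
    using D[of x] \<open>0 < x\<close> by auto
next
  have "continuous_on {0..} F" by (rule DERIV_continuous_on) (use F in auto)
  then show "continuous_on {0..t} F" by (rule continuous_on_subset) auto
qed

lemma has_integral_real_derivative:
  fixes F f :: "real \<Rightarrow> real"
  assumes "s \<le> t" "\<And>x. x \<in> {s..t} \<Longrightarrow> (F has_real_derivative f x) (at x)"
  shows "(f has_integral F t - F s) {s..t}"
  using assms by (intro fundamental_theorem_of_calculus)
    (blast intro: has_field_derivative_at_within
      has_real_derivative_iff_has_vector_derivative[THEN iffD1])+

lemma has_real_derivative_transform_on:
  assumes "x \<in> S" "\<And>y. y \<in> S \<Longrightarrow> g y = f y" "(f has_real_derivative D) (at x within S)"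
  shows "(g has_real_derivative D) (at x within S)"
  using assms unfolding has_field_derivative_def by (rule has_derivative_transform)

text \<open>The kink of \<open>max 0\<close> disappears under a function that vanishes to first order at \<open>0\<close>. The
  bump functions and the entropy that detects negative values are built in this way.\<close>

lemma has_derivative_positive_part:
  fixes g g' :: "real \<Rightarrow> real"
  assumes g: "\<And>s. (g has_real_derivative g' s) (at s)" and g0: "g 0 = 0" "g' 0 = 0"
  shows "((\<lambda>y. g (max 0 y)) has_real_derivative g' (max 0 y)) (at y)"
proof -
  consider "y > 0" | "y < 0" | "y = 0" by linarith
  then show ?thesis
  proof cases
    case 1
    have "(g has_real_derivative g' (max 0 y)) (at y)" using g[of y] 1 by simp
    then show ?thesis
    proof (rule has_field_derivative_transform_within_open[where S = "{0<..}"])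
    qed (use 1 in auto)
  next
    case 2
    have "((\<lambda>_. 0) has_real_derivative g' (max 0 y)) (at y)" using g0 2 by simp
    then show ?thesis
    proof (rule has_field_derivative_transform_within_open[where S = "{..<0}"])
    qed (use 2 g0 in auto)
  next
    case 3
    have lim: "((\<lambda>z. \<bar>g z / z\<bar>) \<longlongrightarrow> 0) (at 0)"
      using g[of 0] g0 unfolding has_field_derivative_iff
      by (intro tendsto_rabs_zero) simp
    have "((\<lambda>z. g (max 0 z) / z) \<longlongrightarrow> 0) (at 0)"
    proof (rule Lim_null_comparison[OF _ lim])
      show "\<forall>\<^sub>F z in at 0. norm (g (max 0 z) / z) \<le> \<bar>g z / z\<bar>"
      proof (intro always_eventually allI)
        fix z show "norm (g (max 0 z) / z) \<le> \<bar>g z / z\<bar>"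
        proof (cases "0 \<le> z")
          case False
          then have "g (max 0 z) / z = 0" using g0 by (simp add: max_def)
          then show ?thesis by (simp only: norm_zero abs_ge_zero)
        qed (simp add: max_def)
      qed
    qed
    then show ?thesis
      using 3 g0 by (simp add: has_field_derivative_iff)
  qed
qed

section \<open>Square integrable functions\<close>

lemma L2_D:
  assumes "f \<in> L2 M"
  shows "f \<in> borel_measurable M" "integrable M (\<lambda>x. (f x)\<^sup>2)"
  using assms by (auto simp: L2_def)

lemma L2_mult_integrable:
  assumes f: "f \<in> L2 M" and g: "g \<in> L2 M"
  shows "integrable M (\<lambda>x. f x * g x)"
proof (rule Bochner_Integration.integrable_bound)
  show "integrable M (\<lambda>x. (f x)\<^sup>2 + (g x)\<^sup>2)"
    using L2_D[OF f] L2_D[OF g] by simp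
  show "(\<lambda>x. f x * g x) \<in> borel_measurable M"
    using L2_D[OF f] L2_D[OF g] by simp
  have "\<bar>u * v\<bar> \<le> u\<^sup>2 + v\<^sup>2" for u v :: real
  proof -
    have "2 * (\<bar>u\<bar> * \<bar>v\<bar>) \<le> u\<^sup>2 + v\<^sup>2"
      using sum_squares_bound[of "\<bar>u\<bar>" "\<bar>v\<bar>"] by simp
    moreover have "0 \<le> \<bar>u\<bar> * \<bar>v\<bar>" by simp
    ultimately show ?thesis unfolding abs_mult by linarith
  qed
  then show "AE x in M. norm (f x * g x) \<le> norm ((f x)\<^sup>2 + (g x)\<^sup>2)"
    by (auto intro!: AE_I2)
qed

lemma L2_lincomb:
  assumes f: "f \<in> L2 M" and g: "g \<in> L2 M"
  shows "(\<lambda>x. c * f x + d * g x) \<in> L2 M"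
proof -
  have "integrable M (\<lambda>x. c\<^sup>2 * (f x)\<^sup>2 + 2 * c * d * (f x * g x) + d\<^sup>2 * (g x)\<^sup>2)"
    using L2_D[OF f] L2_D[OF g] L2_mult_integrable[OF f g] by simp
  then have "integrable M (\<lambda>x. (c * f x + d * g x)\<^sup>2)"
    by (rule back_subst) (auto simp: fun_eq_iff power2_eq_square algebra_simps)
  then show ?thesis
    using L2_D[OF f] L2_D[OF g] by (simp add: L2_def)
qed

lemma L2_scale: "f \<in> L2 M \<Longrightarrow> (\<lambda>x. c * f x) \<in> L2 M"
  using L2_lincomb[of f M f c 0] by simp

lemma L2_diff: "f \<in> L2 M \<Longrightarrow> g \<in> L2 M \<Longrightarrow> (\<lambda>x. f x - g x) \<in> L2 M"
  using L2_lincomb[of f M g 1 "-1"] by simp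

lemma l2norm_nonneg [simp]: "0 \<le> l2norm M f"
  by (simp add: l2norm_def)

lemma l2norm_sq: "(l2norm M f)\<^sup>2 = (LINT x|M. (f x)\<^sup>2)"
  by (simp add: l2norm_def)

lemma l2norm_cong_AE:
  assumes "f \<in> borel_measurable M" "g \<in> borel_measurable M" "AE x in M. f x = g x"
  shows "l2norm M f = l2norm M g"
proof -
  have "(LINT x|M. (f x)\<^sup>2) = (LINT x|M. (g x)\<^sup>2)"
    by (rule integral_cong_AE) (use assms in auto)
  then show ?thesis by (simp add: l2norm_def)
qed

lemma l2norm_Cauchy_Schwarz:
  assumes f: "f \<in> L2 M" and g: "g \<in> L2 M"
  shows "\<bar>LINT x|M. f x * g x\<bar> \<le> l2norm M f * l2norm M g"
proof -
  define F G H where "F = (LINT x|M. (f x)\<^sup>2)" and "G = (LINT x|M. (g x)\<^sup>2)"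
    and "H = (LINT x|M. f x * g x)"
  have quad: "0 \<le> F + 2 * r * H + r\<^sup>2 * G" for r
  proof -
    have "0 \<le> (LINT x|M. (f x + r * g x)\<^sup>2)" by simp
    also have "\<dots> = (LINT x|M. (f x)\<^sup>2 + 2 * r * (f x * g x) + r\<^sup>2 * (g x)\<^sup>2)"
      by (intro Bochner_Integration.integral_cong) (auto simp: power2_eq_square algebra_simps)
    also have "\<dots> = F + 2 * r * H + r\<^sup>2 * G"
      using L2_D[OF f] L2_D[OF g] L2_mult_integrable[OF f g] by (simp add: F_def G_def H_def)
    finally show ?thesis .
  qed
  have "H\<^sup>2 \<le> F * G"
  proof (cases "G = 0")
    case True
    have "H = 0"
    proof (rule ccontr)
      assume "H \<noteq> 0"
      with quad[of "-(F + 1) / (2 * H)"] True show False by (simp add: field_simps)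
    qed
    then show ?thesis using True by simp
  next
    case False
    have "G \<ge> 0" by (simp add: G_def)
    with False have "G > 0" by simp
    have "F + 2 * (- H / G) * H + (- H / G)\<^sup>2 * G = F - H\<^sup>2 / G"
      using \<open>G > 0\<close> by (simp add: power2_eq_square field_simps)
    with quad[of "- H / G"] have "H\<^sup>2 / G \<le> F" by simp
    with \<open>G > 0\<close> show ?thesis by (simp add: field_simps)
  qed
  then have "sqrt (H\<^sup>2) \<le> sqrt (F * G)" by (rule real_sqrt_le_mono)
  then show ?thesis by (simp add: real_sqrt_mult l2norm_def F_def G_def H_def)
qed

lemma l2norm_triangle:
  assumes f: "f \<in> L2 M" and g: "g \<in> L2 M"
  shows "l2norm M (\<lambda>x. f x + g x) \<le> l2norm M f + l2norm M g"
proof (rule power2_le_imp_le)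
  have "(l2norm M (\<lambda>x. f x + g x))\<^sup>2 = (LINT x|M. (f x)\<^sup>2 + 2 * (f x * g x) + (g x)\<^sup>2)"
    unfolding l2norm_sq
    by (intro Bochner_Integration.integral_cong) (auto simp: power2_eq_square algebra_simps)
  also have "\<dots> = (l2norm M f)\<^sup>2 + 2 * (LINT x|M. f x * g x) + (l2norm M g)\<^sup>2"
    using L2_D[OF f] L2_D[OF g] L2_mult_integrable[OF f g] by (simp add: l2norm_sq)
  also have "\<dots> \<le> (l2norm M f)\<^sup>2 + 2 * (l2norm M f * l2norm M g) + (l2norm M g)\<^sup>2"
    using l2norm_Cauchy_Schwarz[OF f g] by simp
  finally show "(l2norm M (\<lambda>x. f x + g x))\<^sup>2 \<le> (l2norm M f + l2norm M g)\<^sup>2"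
    by (simp add: power2_sum)
qed simp

lemma l2norm_scale: "l2norm M (\<lambda>x. c * f x) = \<bar>c\<bar> * l2norm M f"
  by (simp add: l2norm_def power_mult_distrib real_sqrt_mult)

lemma l2norm_triangle3:
  assumes "f \<in> L2 M" "g \<in> L2 M" "h \<in> L2 M"
  shows "l2norm M (\<lambda>x. f x - g x) \<le> l2norm M (\<lambda>x. f x - h x) + l2norm M (\<lambda>x. h x - g x)"
  using l2norm_triangle[OF L2_diff[OF assms(1,3)] L2_diff[OF assms(3,2)]] by simp

lemma l2norm_minus_commute: "l2norm M (\<lambda>x. f x - g x) = l2norm M (\<lambda>x. g x - f x)"
  by (simp add: l2norm_def power2_commute)

lemma L2_bounded_mult:
  assumes f: "f \<in> L2 M" and h: "h \<in> borel_measurable M" "\<And>x. x \<in> space M \<Longrightarrow> \<bar>h x\<bar> \<le> N"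
  shows "(\<lambda>x. h x * f x) \<in> L2 M"
proof -
  have "integrable M (\<lambda>x. (h x * f x)\<^sup>2)"
  proof (rule Bochner_Integration.integrable_bound)
    show "integrable M (\<lambda>x. N\<^sup>2 * (f x)\<^sup>2)" using L2_D[OF f] by simp
    show "AE x in M. norm ((h x * f x)\<^sup>2) \<le> norm (N\<^sup>2 * (f x)\<^sup>2)"
    proof (rule AE_I2)
      fix x assume "x \<in> space M"
      then have "\<bar>h x\<bar> \<le> \<bar>N\<bar>" using h(2)[of x] by simp
      then have "(h x)\<^sup>2 \<le> N\<^sup>2" by (simp add: abs_le_square_iff)
      then show "norm ((h x * f x)\<^sup>2) \<le> norm (N\<^sup>2 * (f x)\<^sup>2)"
        by (simp add: power_mult_distrib mult_right_mono)
    qed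
  qed (use L2_D[OF f] h in simp)
  then show ?thesis using L2_D[OF f] h by (simp add: L2_def)
qed

context prob_space
begin

lemma L2_bounded:
  assumes "f \<in> borel_measurable M" "\<And>x. x \<in> space M \<Longrightarrow> \<bar>f x\<bar> \<le> B"
  shows "f \<in> L2 M"
proof -
  have "integrable M (\<lambda>x. (f x)\<^sup>2)"
  proof (rule integrable_const_bound[where B = "B\<^sup>2"])
    show "AE x in M. norm ((f x)\<^sup>2) \<le> B\<^sup>2"
    proof (rule AE_I2)
      fix x assume "x \<in> space M"
      then have "\<bar>f x\<bar> \<le> \<bar>B\<bar>" using assms(2)[of x] by simp
      then show "norm ((f x)\<^sup>2) \<le> B\<^sup>2"
        by (simp add: abs_le_square_iff)
    qed
  qed (use assms in simp)
  then show ?thesis using assms by (simp add: L2_def)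
qed

lemma L2_const [simp]: "(\<lambda>_. c) \<in> L2 M"
  by (rule L2_bounded[of _ "\<bar>c\<bar>"]) auto

lemma L2_indicator: "A \<in> sets M \<Longrightarrow> indicator A \<in> L2 M"
  by (rule L2_bounded[of _ 1]) (auto simp: indicator_def)

lemma L2_integrable: "f \<in> L2 M \<Longrightarrow> integrable M f"
  using L2_mult_integrable[of f M "\<lambda>_. 1"] by simp

lemma l2norm_const: "l2norm M (\<lambda>_. c) = \<bar>c\<bar>"
  by (simp add: l2norm_def prob_space)

lemma abs_integral_le_l2norm: "f \<in> L2 M \<Longrightarrow> \<bar>LINT x|M. f x\<bar> \<le> l2norm M f"
  using l2norm_Cauchy_Schwarz[of f M "\<lambda>_. 1"] by (simp add: l2norm_const)

lemma l2norm_sup_bound: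
  assumes "f \<in> borel_measurable M" "\<And>x. x \<in> space M \<Longrightarrow> \<bar>f x\<bar> \<le> B" "0 \<le> B"
  shows "l2norm M f \<le> B"
proof -
  have "f \<in> L2 M" using assms by (intro L2_bounded)
  have "(LINT x|M. (f x)\<^sup>2) \<le> (LINT x|M. B\<^sup>2)"
  proof (rule integral_mono)
    fix x assume "x \<in> space M"
    then have "\<bar>f x\<bar> \<le> \<bar>B\<bar>" using assms(2)[of x] by simp
    then show "(f x)\<^sup>2 \<le> B\<^sup>2" by (simp add: abs_le_square_iff)
  qed (use L2_D[OF \<open>f \<in> L2 M\<close>] in auto)
  also have "\<dots> = B\<^sup>2" by (simp add: prob_space)
  finally show ?thesis
    unfolding l2norm_def using assms(3) by (simp add: real_le_lsqrt)
qed

lemma integral_variance: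
  assumes f: "f \<in> L2 M"
  shows "(LINT x|M. (f x - c)\<^sup>2) = (LINT x|M. (f x)\<^sup>2) - 2 * c * (LINT x|M. f x) + c\<^sup>2"
proof -
  have "(LINT x|M. (f x - c)\<^sup>2) = (LINT x|M. (f x)\<^sup>2 - 2 * c * f x + c\<^sup>2)"
    by (intro Bochner_Integration.integral_cong) (auto simp: power2_eq_square algebra_simps)
  then show ?thesis
    using L2_D[OF f] L2_integrable[OF f] by (simp add: prob_space)
qed

lemma l2norm_centered_le:
  assumes f: "f \<in> L2 M"
  shows "l2norm M (\<lambda>x. f x - (LINT y|M. f y)) \<le> l2norm M f"
  unfolding l2norm_def integral_variance[OF f]
  by (rule real_sqrt_le_mono) (simp add: power2_eq_square)

end

section \<open>Polynomials are dense\<close>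

text \<open>Membership in the \<open>L\<^sup>2\<close> closure of the polynomials. The predicate asks for \<open>poly q \<in> L2 M\<close>
  because polynomials need not be square integrable for a general measure.\<close>

definition poly_approx :: "real measure \<Rightarrow> (real \<Rightarrow> real) \<Rightarrow> bool" where
  "poly_approx M f \<longleftrightarrow> f \<in> L2 M \<and>
     (\<forall>e>0. \<exists>q. poly q \<in> L2 M \<and> l2norm M (\<lambda>x. f x - poly q x) < e)"

lemma poly_approx_lincomb:
  assumes f: "poly_approx M f" and g: "poly_approx M g"
  shows "poly_approx M (\<lambda>x. c * f x + d * g x)"
  unfolding poly_approx_def
proof (intro conjI allI impI)
  have L: "f \<in> L2 M" "g \<in> L2 M" using f g by (auto simp: poly_approx_def)
  then show "(\<lambda>x. c * f x + d * g x) \<in> L2 M" by (rule L2_lincomb)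
  fix e :: real assume "e > 0"
  define e' where "e' = e / (2 * (\<bar>c\<bar> + \<bar>d\<bar> + 1))"
  have "e' > 0" using \<open>e > 0\<close> by (simp add: e'_def add_nonneg_pos)
  obtain q r where q: "poly q \<in> L2 M" "l2norm M (\<lambda>x. f x - poly q x) < e'"
    and r: "poly r \<in> L2 M" "l2norm M (\<lambda>x. g x - poly r x) < e'"
    using f g \<open>e' > 0\<close> unfolding poly_approx_def by blast
  let ?s = "smult c q + smult d r"
  have s: "poly ?s \<in> L2 M"
    using L2_lincomb[OF q(1) r(1), of c d] unfolding poly_add[abs_def] poly_smult[abs_def] by simp
  have "l2norm M (\<lambda>x. c * f x + d * g x - poly ?s x)
      = l2norm M (\<lambda>x. c * (f x - poly q x) + d * (g x - poly r x))"
    by (simp add: algebra_simps)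
  also have "\<dots> \<le> \<bar>c\<bar> * l2norm M (\<lambda>x. f x - poly q x) + \<bar>d\<bar> * l2norm M (\<lambda>x. g x - poly r x)"
    using l2norm_triangle[OF L2_scale[OF L2_diff[OF L(1) q(1)]] L2_scale[OF L2_diff[OF L(2) r(1)]]]
    by (simp add: l2norm_scale)
  also have "\<dots> \<le> \<bar>c\<bar> * e' + \<bar>d\<bar> * e'"
    using q(2) r(2) by (intro add_mono mult_left_mono) auto
  also have "\<dots> < 2 * (\<bar>c\<bar> + \<bar>d\<bar> + 1) * e'"
    using \<open>e' > 0\<close> by (simp add: algebra_simps) (smt (verit) abs_ge_zero mult_nonneg_nonneg)
  also have "\<dots> = e" by (simp add: e'_def)
  finally show "\<exists>q. poly q \<in> L2 M \<and> l2norm M (\<lambda>x. c * f x + d * g x - poly q x) < e"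
    using s by blast
qed

lemma poly_approx_limit:
  assumes f: "f \<in> L2 M" and g: "\<And>n. poly_approx M (g n)"
    and lim: "(\<lambda>n. l2norm M (\<lambda>x. f x - g n x)) \<longlonglongrightarrow> 0"
  shows "poly_approx M f"
  unfolding poly_approx_def
proof (intro conjI allI impI f)
  fix e :: real assume "e > 0"
  then have "\<forall>\<^sub>F n in sequentially. l2norm M (\<lambda>x. f x - g n x) < e / 2"
    using lim by (intro order_tendstoD(2)) auto
  then obtain n where n: "l2norm M (\<lambda>x. f x - g n x) < e / 2"
    by (auto simp: eventually_sequentially)
  obtain q where q: "poly q \<in> L2 M" "l2norm M (\<lambda>x. g n x - poly q x) < e / 2"
    using g[of n] \<open>e > 0\<close> unfolding poly_approx_def by (meson half_gt_zero)
  have "g n \<in> L2 M" using g by (auto simp: poly_approx_def)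
  from l2norm_triangle3[OF f q(1) this] n q
  show "\<exists>q. poly q \<in> L2 M \<and> l2norm M (\<lambda>x. f x - poly q x) < e"
    by (intro exI[of _ q]) auto
qed

lemma l2norm_dominated_tendsto:
  assumes f: "f \<in> borel_measurable M" and g: "\<And>n. g n \<in> borel_measurable M"
    and h: "h \<in> L2 M" and bound: "\<And>n x. x \<in> space M \<Longrightarrow> \<bar>f x - g n x\<bar> \<le> \<bar>h x\<bar>"
    and lim: "\<And>x. x \<in> space M \<Longrightarrow> (\<lambda>n. g n x) \<longlonglongrightarrow> f x"
  shows "(\<lambda>n. l2norm M (\<lambda>x. f x - g n x)) \<longlonglongrightarrow> 0"
proof -
  have "(\<lambda>n. LINT x|M. (f x - g n x)\<^sup>2) \<longlonglongrightarrow> (LINT x|M. 0)"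
  proof (rule integral_dominated_convergence[where w = "\<lambda>x. (h x)\<^sup>2"])
    show "AE x in M. (\<lambda>n. (f x - g n x)\<^sup>2) \<longlonglongrightarrow> 0"
    proof (rule AE_I2)
      fix x assume "x \<in> space M"
      from tendsto_diff[OF tendsto_const lim[OF this], of "f x"]
      have "(\<lambda>n. f x - g n x) \<longlonglongrightarrow> 0" by simp
      from tendsto_power[OF this, of 2] show "(\<lambda>n. (f x - g n x)\<^sup>2) \<longlonglongrightarrow> 0" by simp
    qed
    show "AE x in M. norm ((f x - g n x)\<^sup>2) \<le> (h x)\<^sup>2" for n
      using bound by (auto intro!: AE_I2 simp: abs_le_square_iff[symmetric])
  qed (use f g L2_D[OF h] in auto)
  from tendsto_real_sqrt[OF this] show ?thesis by (simp add: l2norm_def)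
qed

text \<open>Continuity on the open interval suffices, since the two endpoints are atoms of the
  \<open>\<sigma>\<close>-algebra.\<close>

lemma borel_measurable_continuous_Ioo:
  fixes f :: "real \<Rightarrow> real"
  assumes "continuous_on {0<..<1} f"
  shows "f \<in> borel_measurable (restrict_space borel {0..1})"
proof -
  let ?g = "\<lambda>x. indicator {0<..<1} x *\<^sub>R f x + indicator {0} x * f 0 + indicator {1} x * f 1"
  have "?g \<in> borel_measurable borel"
    using borel_measurable_continuous_on_indicator[OF _ assms] by simp
  then have "?g \<in> borel_measurable (restrict_space borel {0..1})" by (rule measurable_restrict_space1)
  then show ?thesis
    by (rule measurable_cong[THEN iffD1, rotated]) (auto simp: space_restrict_space indicator_def)
qed

text \<open>The \<open>\<sigma>\<close>-algebra is that of the invariant measure, whose space is the interval and not the line.\<close>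

locale unit_interval_prob = prob_space M for M :: "real measure" +
  assumes sets_M: "sets M = sets (restrict_space borel {0..1})"
begin

lemma space_M: "space M = {0..1}"
  using sets_eq_imp_space_eq[OF sets_M] by (simp add: space_restrict_space)

lemma measurable_continuous_Icc:
  assumes "continuous_on {0..1} f"
  shows "f \<in> borel_measurable M"
  using borel_measurable_continuous_on_restrict[OF assms]
  by (subst measurable_cong_sets[OF sets_M refl])

lemma measurable_borel:
  assumes "f \<in> borel_measurable borel"
  shows "f \<in> borel_measurable M"
  using measurable_restrict_space1[OF assms] by (subst measurable_cong_sets[OF sets_M refl])

lemma measurable_continuous_Ioo:
  fixes f :: "real \<Rightarrow> real"
  assumes "continuous_on {0<..<1} f"
  shows "f \<in> borel_measurable M"
  using borel_measurable_continuous_Ioo[OF assms]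
  by (subst measurable_cong_sets[OF sets_M refl])

lemma L2_continuous:
  assumes "continuous_on {0..1} f"
  shows "f \<in> L2 M"
proof -
  obtain B where "\<And>x. x \<in> {0..1} \<Longrightarrow> \<bar>f x\<bar> \<le> B"
    by (rule bounded_continuous_Icc[OF assms]) (rule that)
  then show ?thesis
    using measurable_continuous_Icc[OF assms] by (intro L2_bounded[of _ B]) (auto simp: space_M)
qed

lemma poly_L2: "poly q \<in> L2 M"
  by (rule L2_continuous) (intro continuous_intros)

lemma poly_approx_continuous:
  assumes f: "continuous_on {0..1} f"
  shows "poly_approx M f"
  unfolding poly_approx_def
proof (intro conjI allI impI L2_continuous f)
  fix e :: real assume "e > 0"
  obtain g where g: "real_polynomial_function g" "\<And>x. x \<in> {0..1} \<Longrightarrow> \<bar>f x - g x\<bar> < e / 2"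
    using Stone_Weierstrass_real_polynomial_function[OF compact_Icc f, of "e / 2"] \<open>e > 0\<close>
    by auto
  obtain c n where c: "g = (\<lambda>x. \<Sum>i\<le>n. c i * x ^ i)"
    using g(1) real_polynomial_function_iff_sum by blast
  define q where "q = (\<Sum>i\<le>n. monom (c i) i)"
  have q: "poly q x = g x" for x
    by (simp add: q_def c poly_sum poly_monom)
  have "l2norm M (\<lambda>x. f x - poly q x) \<le> e / 2"
    using L2_D(1)[OF L2_diff[OF L2_continuous[OF f] poly_L2, of q]] g(2) \<open>e > 0\<close>
    by (intro l2norm_sup_bound) (auto simp: q space_M less_imp_le)
  then show "\<exists>q. poly q \<in> L2 M \<and> l2norm M (\<lambda>x. f x - poly q x) < e"
    using poly_L2 \<open>e > 0\<close> by (intro exI[of _ q]) auto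
qed

text \<open>Closed sets form a \<open>\<pi>\<close>-system generating the Borel sets, and the indicator of a closed set \<open>A\<close>
  is the limit of the continuous functions \<open>max 0 (1 - n d(x, A))\<close>.\<close>

lemma poly_approx_indicator:
  assumes "A \<in> sets borel"
  shows "poly_approx M (indicator A)"
proof -
  have meas: "(indicator B :: real \<Rightarrow> real) \<in> borel_measurable M" if "B \<in> sets borel" for B :: "real set"
    using that by (intro measurable_borel) simp
  have closed: "poly_approx M (indicator B)" if B: "closed B" for B :: "real set"
  proof (cases "B = {}")
    case True
    then have "indicator B = (\<lambda>_. 0::real)" by auto
    then show ?thesis using poly_approx_continuous[of "\<lambda>_. 0"] by simp
  next
    case False
    define g where "g n x = max 0 (1 - real n * infdist x B)" for n x
    have cont: "continuous_on {0..1} (g n)" for n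
      unfolding g_def by (intro continuous_intros)
    show ?thesis
    proof (rule poly_approx_limit)
      show "poly_approx M (g n)" for n by (rule poly_approx_continuous[OF cont])
      show "(\<lambda>n. l2norm M (\<lambda>x. indicator B x - g n x)) \<longlonglongrightarrow> 0"
      proof (rule l2norm_dominated_tendsto)
        show "(\<lambda>_. 1) \<in> L2 M" by simp
        show "\<bar>indicator B x - g n x\<bar> \<le> \<bar>1\<bar>" for n x
          using infdist_nonneg[of x B] by (auto simp: g_def indicator_def max_def)
        show "(\<lambda>n. g n x) \<longlonglongrightarrow> indicator B x" for x
        proof (cases "x \<in> B")
          case True then show ?thesis by (simp add: g_def)
        next
          case False
          have "infdist x B > 0"
            using False \<open>B \<noteq> {}\<close> B infdist_pos_not_in_closed by blast
          obtain N :: nat where N: "1 / infdist x B < N" using reals_Archimedean2 by blast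
          have "g n x = 0" if "n \<ge> N" for n
          proof -
            have "1 < N * infdist x B" using N \<open>infdist x B > 0\<close> by (simp add: field_simps)
            also have "\<dots> \<le> n * infdist x B"
              using that \<open>infdist x B > 0\<close> by (intro mult_right_mono) auto
            finally show ?thesis by (simp add: g_def)
          qed
          then show ?thesis
            using False by (intro tendsto_eventually) (auto simp: eventually_sequentially)
        qed
      qed (use meas[OF borel_closed[OF B]] measurable_continuous_Icc[OF cont] in auto)
      show "indicator B \<in> L2 M"
        using meas B by (intro L2_bounded[of _ 1]) (auto simp: indicator_def)
    qed
  qed
  have "Int_stable {B :: real set. closed B}" by (auto simp: Int_stable_def)
  moreover have "{B :: real set. closed B} \<subseteq> Pow UNIV" by simp
  moreover have "A \<in> sigma_sets UNIV {B. closed B}"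
    using assms by (simp add: borel_eq_closed)
  ultimately show ?thesis
  proof (induction rule: sigma_sets_induct_disjoint)
    case (basic B) then show ?case by (simp add: closed)
  next
    case empty then show ?case using closed[OF closed_empty] by (simp only:)
  next
    case (compl B)
    have "indicator (UNIV - B) = (\<lambda>x. 1 * 1 + (-1) * indicator B x :: real)"
      by (auto simp: indicator_def)
    then show ?case
      using poly_approx_lincomb[OF poly_approx_continuous[of "\<lambda>_. 1"] compl(2), of 1 "-1"] by simp
  next
    case (union B)
    have Bm: "B i \<in> sets borel" for i using union(2) by (simp add: borel_eq_closed image_subset_iff)
    define U where "U n = (\<Union>i<n. B i)" for n :: nat
    have U: "poly_approx M (indicator (U n))" for n
    proof (induction n)
      case 0
      have "U 0 = {}" by (simp add: U_def)
      then show ?case using closed[OF closed_empty] by (simp only:)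
    next
      case (Suc n)
      have "B n \<inter> B i = {}" if "i < n" for i
        using that by (intro disjoint_family_onD[OF union(1)]) auto
      then have "B n \<inter> U n = {}" by (auto simp: U_def)
      then have "indicator (U (Suc n)) = (\<lambda>x. 1 * indicator (U n) x + 1 * indicator (B n) x :: real)"
        by (auto simp: U_def lessThan_Suc indicator_def fun_eq_iff)
      then show ?case using poly_approx_lincomb[OF Suc union(3)[of n], of 1 1] by (simp only:)
    qed
    show ?case
    proof (rule poly_approx_limit[OF _ U])
      show "(indicator (\<Union> (range B)) :: real \<Rightarrow> real) \<in> L2 M"
        using Bm meas[of "\<Union> (range B)"] by (intro L2_bounded[of _ 1]) (auto simp: indicator_def)
      show "(\<lambda>n. l2norm M (\<lambda>x. indicator (\<Union> (range B)) x - indicator (U n) x)) \<longlonglongrightarrow> 0"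
      proof (rule l2norm_dominated_tendsto)
        show "(\<lambda>_. 1) \<in> L2 M" by simp
        show "(\<lambda>n. indicator (U n) x :: real) \<longlonglongrightarrow> indicator (\<Union> (range B)) x" for x
        proof -
          have "(\<Union>n. U n) = \<Union> (range B)" by (auto simp: U_def)
          moreover have "incseq U" by (force simp: incseq_def U_def intro: order.strict_trans2)
          ultimately show ?thesis using LIMSEQ_indicator_incseq[of U x] by metis
        qed
        show "\<bar>indicator (\<Union> (range B)) x - indicator (U n) x\<bar> \<le> \<bar>1::real\<bar>" for n x
          by (auto simp: indicator_def)
      qed (use Bm meas in \<open>auto simp: U_def\<close>)
    qed
  qed
qed

text \<open>From indicators to all of \<open>L\<^sup>2\<close> by the monotone class argument for nonnegative functions, applied to
  the positive and the negative part.\<close>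

lemma poly_approx_L2:
  assumes f: "f \<in> L2 M"
  shows "poly_approx M f"
proof -
  have nonneg: "g \<in> L2 M \<longrightarrow> poly_approx M g" if "g \<in> borel_measurable M" "\<And>x. 0 \<le> g x" for g
    using that
  proof (induction rule: borel_measurable_induct_real)
    case (set A)
    then have "A \<in> sets borel"
      unfolding sets_M by (auto simp: sets_restrict_space)
    then show ?case by (simp add: poly_approx_indicator)
  next
    case (mult u c)
    show ?case
    proof (cases "c = 0")
      case True
      then show ?thesis using poly_approx_continuous[of "\<lambda>_. 0"] by simp
    next
      case False
      show ?thesis
      proof
        assume "(\<lambda>x. c * u x) \<in> L2 M"
        from L2_scale[OF this, of "1 / c"] False have "u \<in> L2 M" by simp
        then show "poly_approx M (\<lambda>x. c * u x)"
          using mult poly_approx_lincomb[of M u u c 0] by simp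
      qed
    qed
  next
    case (add u v)
    show ?case
    proof
      assume L: "(\<lambda>x. v x + u x) \<in> L2 M"
      have "u \<in> L2 M" "v \<in> L2 M"
        unfolding L2_def using add
        by (auto intro!: Bochner_Integration.integrable_bound[OF L2_D(2)[OF L]] AE_I2 power_mono)
      then show "poly_approx M (\<lambda>x. v x + u x)"
        using add poly_approx_lincomb[of M v u 1 1] by simp
    qed
  next
    case (seq U)
    show ?case
    proof
      assume g: "g \<in> L2 M"
      have le: "U n x \<le> g x" if "x \<in> space M" for n x
        using seq(3) by (intro incseq_le[OF _ seq(4)[OF that]]) (auto simp: incseq_def le_fun_def)
      have "U n \<in> L2 M" for n
        unfolding L2_def using seq(1,2) le
        by (auto intro!: Bochner_Integration.integrable_bound[OF L2_D(2)[OF g]] AE_I2 power_mono)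
      then have "poly_approx M (U n)" for n using seq(5) by simp
      then show "poly_approx M g"
      proof (rule poly_approx_limit[OF g])
        show "(\<lambda>n. l2norm M (\<lambda>x. g x - U n x)) \<longlonglongrightarrow> 0"
        proof (rule l2norm_dominated_tendsto[OF _ _ g])
          show "\<bar>g x - U n x\<bar> \<le> \<bar>g x\<bar>" if "x \<in> space M" for n x
            using le[OF that, of n] seq(2)[of n x] by linarith
        qed (use seq(1,4) L2_D(1)[OF g] in auto)
      qed
    qed
  qed
  have "(\<lambda>x. max 0 (f x)) \<in> L2 M" "(\<lambda>x. max 0 (- f x)) \<in> L2 M"
    unfolding L2_def using L2_D[OF f]
    by (auto intro!: Bochner_Integration.integrable_bound[OF L2_D(2)[OF f]] AE_I2
        simp: max_def)
  then have "poly_approx M (\<lambda>x. max 0 (f x))" "poly_approx M (\<lambda>x. max 0 (- f x))"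
    using nonneg[OF L2_D(1)] by auto
  from poly_approx_lincomb[OF this, of 1 "-1"]
  have "poly_approx M (\<lambda>x. 1 * max 0 (f x) + - 1 * max 0 (- f x))" .
  moreover have "(\<lambda>x. 1 * max 0 (f x) + - 1 * max 0 (- f x)) = f"
    by (auto simp: fun_eq_iff max_def)
  ultimately show ?thesis by (simp only:)
qed

lemma L2_polynomial_approximation:
  assumes "f \<in> L2 M" "e > 0"
  obtains q where "l2norm M (\<lambda>x. f x - poly q x) < e"
  using poly_approx_L2[OF assms(1)] assms(2) by (auto simp: poly_approx_def)

end

section \<open>Barriers at an endpoint\<close>

text \<open>The hypothesis \<open>q' = \<rho> q / x\<close> makes \<open>q\<close> comparable to \<open>x powr (\<rho> 0)\<close> near \<open>0\<close>. Differentiating the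
  product gives the factor \<open>\<rho> x - \<gamma> + l x\<close>, which is positive near \<open>0\<close> by the gap
  \<open>\<rho> 0 > \<gamma>\<close>; a large \<open>l\<close> makes it positive on the rest of the half interval. The lower bound is used
  with \<open>\<gamma> = m - 1\<close> for the barrier and with \<open>0 < \<gamma> < \<rho> 0\<close> for the decay of \<open>q\<close>.\<close>

lemma barrier_derivative:
  fixes q \<rho> :: "real \<Rightarrow> real"
  assumes cont: "continuous_on {0..1/2} \<rho>" and gap: "\<rho> 0 > \<gamma>"
    and pos: "\<And>x. x \<in> {0<..1/2} \<Longrightarrow> q x > 0"
    and deriv: "\<And>x. x \<in> {0<..1/2} \<Longrightarrow> (q has_real_derivative \<rho> x / x * q x) (at x)"
  obtains l \<kappa> d where "\<kappa> > 0" "l \<ge> 0"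
    "\<And>x. x \<in> {0<..1/2} \<Longrightarrow>
       ((\<lambda>x. x powr (- \<gamma>) * q x * exp (l * x)) has_real_derivative d x) (at x)"
    "\<And>x. x \<in> {0<..1/2} \<Longrightarrow> d x \<ge> \<kappa> * (x powr (- \<gamma> - 1) * q x)"
proof -
  define \<kappa> where "\<kappa> = (\<rho> 0 - \<gamma>) / 2"
  have \<kappa>: "\<kappa> > 0" using gap by (simp add: \<kappa>_def)
  obtain \<delta> where \<delta>: "\<delta> > 0" "\<And>x. x \<in> {0..1/2} \<Longrightarrow> dist x 0 < \<delta> \<Longrightarrow> dist (\<rho> x) (\<rho> 0) < \<kappa>"
    using cont \<kappa> unfolding continuous_on_iff by (metis atLeastAtMost_iff order_refl zero_le_divide_1_iff zero_le_numeral)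
  obtain B where B: "B \<ge> 0" "\<And>x. x \<in> {0..1/2} \<Longrightarrow> \<bar>\<rho> x\<bar> \<le> B"
    by (rule bounded_continuous_Icc[OF cont]) (rule that)
  (* Chosen so that l * x dominates |rho - gamma| + kappa for all x from delta on. *)
  define l where "l = (B + \<bar>\<gamma>\<bar> + \<kappa>) / \<delta>"
  have l: "l \<ge> 0" using \<kappa> \<delta> B(1) by (simp add: l_def)
  have key: "\<rho> x - \<gamma> + l * x \<ge> \<kappa>" if x: "x \<in> {0<..1/2}" for x
  proof (cases "x < \<delta>")
    case True
    then have "\<bar>\<rho> x - \<rho> 0\<bar> < \<kappa>" using \<delta>(2)[of x] x by (simp add: dist_real_def)
    moreover have "l * x \<ge> 0" using l x by simp
    ultimately show ?thesis unfolding \<kappa>_def by (simp add: abs_if split: if_splits)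
  next
    case False
    have "l * x \<ge> l * \<delta>" using False l by (intro mult_left_mono) auto
    also have "l * \<delta> = B + \<bar>\<gamma>\<bar> + \<kappa>" using \<delta> by (simp add: l_def)
    finally show ?thesis using B(2)[of x] x by auto
  qed
  define d where "d x = x powr (- \<gamma> - 1) * q x * (exp (l * x) * (\<rho> x - \<gamma> + l * x))" for x
  show ?thesis
  proof (rule that[OF \<kappa> l])
    fix x :: real assume x: "x \<in> {0<..1/2}"
    have pw: "x powr (- \<gamma> - 1) = x powr (- \<gamma>) / x"
      using x by (simp add: powr_diff)
    show "((\<lambda>x. x powr (- \<gamma>) * q x * exp (l * x)) has_real_derivative d x) (at x)"
      unfolding d_def pw
      by (rule derivative_eq_intros deriv[OF x] refl | use x in \<open>simp add: pw field_simps\<close>)+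
    have "1 * \<kappa> \<le> exp (l * x) * (\<rho> x - \<gamma> + l * x)"
      using key[OF x] \<kappa> l x by (intro mult_mono) auto
    then show "d x \<ge> \<kappa> * (x powr (- \<gamma> - 1) * q x)"
      unfolding d_def using pos[OF x] x
      by (subst mult.commute, intro mult_left_mono) (auto intro!: mult_nonneg_nonneg less_imp_le)
  qed
qed

text \<open>For \<open>\<gamma>\<close> between \<open>0\<close> and \<open>\<rho> 0\<close> the function \<open>x powr (- \<gamma>) * q x * exp (l x)\<close> is nondecreasing, hence
  bounded on the half interval, so \<open>q\<close> is at most a constant times \<open>x powr \<gamma>\<close>.\<close>

lemma vanishes_at_endpoint:
  fixes q \<rho> :: "real \<Rightarrow> real"
  assumes cont: "continuous_on {0..1/2} \<rho>" and gap: "\<rho> 0 > 0"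
    and pos: "\<And>x. x \<in> {0<..1/2} \<Longrightarrow> q x > 0"
    and deriv: "\<And>x. x \<in> {0<..1/2} \<Longrightarrow> (q has_real_derivative \<rho> x / x * q x) (at x)"
  shows "(q \<longlongrightarrow> 0) (at_right 0)"
proof -
  define \<gamma> where "\<gamma> = \<rho> 0 / 2"
  have \<gamma>: "\<gamma> > 0" "\<rho> 0 > \<gamma>" using gap by (auto simp: \<gamma>_def)
  obtain l \<kappa> d where l: "\<kappa> > 0" "l \<ge> 0"
    "\<And>x. x \<in> {0<..1/2} \<Longrightarrow>
       ((\<lambda>x. x powr (- \<gamma>) * q x * exp (l * x)) has_real_derivative d x) (at x)"
    "\<And>x. x \<in> {0<..1/2} \<Longrightarrow> d x \<ge> \<kappa> * (x powr (- \<gamma> - 1) * q x)"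
    by (rule barrier_derivative[OF cont \<gamma>(2) pos deriv]) (assumption | rule that)+
  let ?\<phi> = "\<lambda>x. x powr (- \<gamma>) * q x * exp (l * x)"
  have d0: "d x \<ge> 0" if "x \<in> {0<..1/2}" for x
    using l(4)[OF that] pos[OF that] \<open>\<kappa> > 0\<close>
    by (smt (verit) mult_nonneg_nonneg powr_ge_zero)
  have bound: "q x \<le> ?\<phi> (1/2) * x powr \<gamma>" if x: "x \<in> {0<..1/2}" for x
  proof -
    have "?\<phi> x \<le> ?\<phi> (1/2)"
    proof (rule DERIV_nonneg_imp_nondecreasing[of x "1/2" ?\<phi>])
      show "x \<le> 1/2" using x by simp
      fix y assume "x \<le> y" "y \<le> 1/2"
      then have "y \<in> {0<..1/2}" using x by simp
      then show "\<exists>D. (?\<phi> has_real_derivative D) (at y) \<and> 0 \<le> D"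
        using l(3) d0 by blast
    qed
    moreover have "x powr (- \<gamma>) * q x * 1 \<le> ?\<phi> x"
      using x pos[OF x] l(2) by (intro mult_left_mono) (auto intro!: mult_nonneg_nonneg less_imp_le)
    ultimately have "x powr (- \<gamma>) * q x \<le> ?\<phi> (1/2)" by linarith
    then have "(x powr (- \<gamma>) * q x) * x powr \<gamma> \<le> ?\<phi> (1/2) * x powr \<gamma>"
      by (rule mult_right_mono) simp
    moreover have "(x powr (- \<gamma>) * q x) * x powr \<gamma> = q x"
      using x by (simp add: powr_minus field_simps)
    ultimately show ?thesis by simp
  qed
  have ev: "\<forall>\<^sub>F x in at_right (0::real). x \<in> {0<..1/2}"
    by (auto simp: eventually_at_right_field intro!: exI[of _ "1/2"])
  show ?thesis
  proof (rule tendsto_sandwich)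
    show "\<forall>\<^sub>F x in at_right 0. 0 \<le> q x"
      using ev by eventually_elim (use pos in \<open>auto intro: less_imp_le\<close>)
    show "\<forall>\<^sub>F x in at_right 0. q x \<le> ?\<phi> (1/2) * x powr \<gamma>"
      using ev by eventually_elim (rule bound)
    have "((\<lambda>x::real. x powr \<gamma>) \<longlongrightarrow> 0) (at_right 0)"
    proof (rule tendsto_zero_powrI)
      show "\<forall>\<^sub>F x in at_right (0::real). 0 \<le> x"
        by (auto simp: eventually_at_right_field intro!: exI[of _ 1])
    qed (use \<gamma> in \<open>auto intro!: tendsto_intros\<close>)
    from tendsto_mult_left[OF this, of "?\<phi> (1/2)"]
    show "((\<lambda>x. ?\<phi> (1/2) * x powr \<gamma>) \<longlongrightarrow> 0) (at_right 0)" by simp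
  qed simp
qed

text \<open>With \<open>q\<close> equal to \<open>p\<close>, reflected in the case of the endpoint \<open>1\<close>, and \<open>\<alpha> x * x ^ m\<close> the leading coefficient, the quotient \<open>q x / (\<alpha> x * x ^ m)\<close> is the weight
  \<open>w\<close>. The assumption \<open>\<rho> 0 > m - 1\<close> is transversality, in the same form for Kimura and quadratic
  endpoints.\<close>

lemma endpoint_barrier:
  fixes q \<rho> \<alpha> :: "real \<Rightarrow> real" and m :: nat
  assumes cont: "continuous_on {0..1/2} \<rho>" and gap: "\<rho> 0 > real m - 1" and m: "m \<in> {1, 2}"
    and pos: "\<And>x. x \<in> {0<..1/2} \<Longrightarrow> q x > 0"
    and deriv: "\<And>x. x \<in> {0<..1/2} \<Longrightarrow> (q has_real_derivative \<rho> x / x * q x) (at x)"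
    and \<alpha>: "continuous_on {0..1/2} \<alpha>" "\<And>x. x \<in> {0..1/2} \<Longrightarrow> \<alpha> x > 0"
  obtains \<phi> d K where "K \<ge> 0"
    "\<And>x. x \<in> {0<..1/2} \<Longrightarrow> (\<phi> has_real_derivative d x) (at x)"
    "\<And>x. x \<in> {0<..1/2} \<Longrightarrow> d x \<ge> q x / (\<alpha> x * x ^ m)"
    "\<And>x. x \<in> {0<..1/2} \<Longrightarrow> \<phi> x \<ge> 0"
    "\<And>x. x \<in> {0<..1/2} \<Longrightarrow> (\<phi> x)\<^sup>2 \<le> K * (q x / (\<alpha> x * x ^ m)) * q x"
proof -
  obtain l \<kappa> d where l: "\<kappa> > 0" "l \<ge> 0"
    "\<And>x. x \<in> {0<..1/2} \<Longrightarrow>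
       ((\<lambda>x. x powr (- (real m - 1)) * q x * exp (l * x)) has_real_derivative d x) (at x)"
    "\<And>x. x \<in> {0<..1/2} \<Longrightarrow> d x \<ge> \<kappa> * (x powr (- (real m - 1) - 1) * q x)"
    by (rule barrier_derivative[OF cont gap pos deriv]) (assumption | rule that)+
  have ne: "{0..1/2::real} \<noteq> {}" by simp
  obtain x0 where x0: "x0 \<in> {0..1/2}" "\<And>x. x \<in> {0..1/2} \<Longrightarrow> \<alpha> x0 \<le> \<alpha> x"
    using continuous_attains_inf[OF compact_Icc ne \<alpha>(1)] by blast
  obtain x1 where x1: "x1 \<in> {0..1/2}" "\<And>x. x \<in> {0..1/2} \<Longrightarrow> \<alpha> x \<le> \<alpha> x1"
    using continuous_attains_sup[OF compact_Icc ne \<alpha>(1)] by blast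
  (* The rescaling turns the bound by kappa * q / x ^ m into one by the weight itself. *)
  define c where "c = 1 / (\<kappa> * \<alpha> x0)"
  have c: "c > 0" using l \<alpha>(2)[OF x0(1)] by (simp add: c_def)
  define K where "K = c\<^sup>2 * exp (2 * l) * \<alpha> x1"
  let ?\<phi> = "\<lambda>x. x powr (- (real m - 1)) * q x * exp (l * x)"
  show ?thesis
  proof (rule that)
    show "K \<ge> 0" using \<alpha>(2)[OF x1(1)] by (simp add: K_def)
    fix x :: real assume x: "x \<in> {0<..1/2}"
    have x': "x \<in> {0..1/2}" "0 < x" "x \<le> 1" using x by auto
    have \<alpha>x: "\<alpha> x > 0" "\<alpha> x0 \<le> \<alpha> x" "\<alpha> x \<le> \<alpha> x1" using \<alpha>(2) x0 x1 x' by auto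
    show "((\<lambda>x. c * ?\<phi> x) has_real_derivative c * d x) (at x)"
      by (rule DERIV_cmult[OF l(3)[OF x]])
    have "q x / (\<alpha> x * x ^ m) \<le> q x / (\<alpha> x0 * x ^ m)"
      using \<alpha>x \<alpha>(2)[OF x0(1)] x' pos[OF x]
      by (intro divide_left_mono mult_right_mono mult_pos_pos) auto
    also have "\<dots> = c * (\<kappa> * (x powr (- (real m - 1) - 1) * q x))"
      using l x' \<alpha>(2)[OF x0(1)] by (simp add: c_def powr_minus powr_realpow field_simps)
    also have "\<dots> \<le> c * d x" using c l(4)[OF x] by (intro mult_left_mono) auto
    finally show "q x / (\<alpha> x * x ^ m) \<le> c * d x" .
    show "c * ?\<phi> x \<ge> 0" using c pos[OF x] by simp
    have e: "(exp (l * x))\<^sup>2 \<le> exp (2 * l)"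
    proof -
      have "(exp (l * x))\<^sup>2 = exp (2 * (l * x))" by (simp add: exp_double)
      also have "\<dots> \<le> exp (2 * l)" using mult_left_mono[OF x'(3) l(2)] by simp
      finally show ?thesis .
    qed
    have p: "(x powr (- (real m - 1)))\<^sup>2 \<le> 1 / x ^ m"
    proof -
      have "(x powr (- (real m - 1)))\<^sup>2 = x powr (- (2 * real m - 2))"
        using x' by (simp add: power2_eq_square powr_add[symmetric])
      also have "\<dots> \<le> x powr (- real m)"
        using m x' by (intro powr_mono') auto
      also have "\<dots> = 1 / x ^ m" using x' by (simp add: powr_minus powr_realpow field_simps)
      finally show ?thesis .
    qed
    have "(c * ?\<phi> x)\<^sup>2 = c\<^sup>2 * ((x powr (- (real m - 1)))\<^sup>2 * (exp (l * x))\<^sup>2) * (q x)\<^sup>2"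
      by (simp add: power_mult_distrib mult_ac)
    also have "\<dots> \<le> c\<^sup>2 * (1 / x ^ m * exp (2 * l)) * (q x)\<^sup>2"
      using e p x' by (intro mult_right_mono mult_left_mono mult_mono) auto
    also have "\<dots> \<le> c\<^sup>2 * (1 / x ^ m * exp (2 * l)) * (q x)\<^sup>2 * (\<alpha> x1 / \<alpha> x)"
    proof -
      have "1 \<le> \<alpha> x1 / \<alpha> x" using \<alpha>x by simp
      moreover have "0 \<le> c\<^sup>2 * (1 / x ^ m * exp (2 * l)) * (q x)\<^sup>2" using x' by simp
      ultimately show ?thesis using mult_left_mono by fastforce
    qed
    also have "\<dots> = K * (q x / (\<alpha> x * x ^ m)) * q x"
      using \<alpha>x x' by (simp add: K_def power2_eq_square field_simps)
    finally show "(c * ?\<phi> x)\<^sup>2 \<le> K * (q x / (\<alpha> x * x ^ m)) * q x" .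
  qed
qed

text \<open>The derivative of \<open>g\<^sup>2 \<phi>\<close> is at least \<open>w g\<^sup>2 / 2 - 2 K p g'\<^sup>2\<close>, by completing the square in the cross
  term \<open>2 g g' \<phi>\<close> and using \<open>\<phi>\<^sup>2 \<le> K w p\<close>. Integrating leaves only the boundary terms, whose sign is an assumption.\<close>

lemma hardy_interval:
  fixes g g' \<phi> d w p :: "real \<Rightarrow> real"
  assumes st: "s \<le> t" and K: "K \<ge> 0"
    and g: "\<And>x. x \<in> {s..t} \<Longrightarrow> (g has_real_derivative g' x) (at x)"
    and \<phi>: "\<And>x. x \<in> {s..t} \<Longrightarrow> (\<phi> has_real_derivative d x) (at x)"
    and w: "\<And>x. x \<in> {s..t} \<Longrightarrow> w x > 0" "\<And>x. x \<in> {s..t} \<Longrightarrow> w x \<le> d x"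
    and K': "\<And>x. x \<in> {s..t} \<Longrightarrow> (\<phi> x)\<^sup>2 \<le> K * w x * p x"
    and bdry: "(g t)\<^sup>2 * \<phi> t \<le> (g s)\<^sup>2 * \<phi> s"
    and cont: "continuous_on {s..t} w" "continuous_on {s..t} p" "continuous_on {s..t} g'"
  shows "integral {s..t} (\<lambda>x. w x * (g x)\<^sup>2) \<le> 4 * K * integral {s..t} (\<lambda>x. p x * (g' x)\<^sup>2)"
proof -
  have cg: "continuous_on {s..t} g"
    using g by (meson DERIV_continuous continuous_at_imp_continuous_on)
  have deriv: "((\<lambda>x. (g x)\<^sup>2 * \<phi> x) has_vector_derivative
      2 * g x * g' x * \<phi> x + (g x)\<^sup>2 * d x) (at x within {s..t})" if "x \<in> {s..t}" for x
  proof -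
    have "((\<lambda>x. (g x)\<^sup>2 * \<phi> x) has_real_derivative
      2 * g x * g' x * \<phi> x + (g x)\<^sup>2 * d x) (at x)"
      by (rule derivative_eq_intros g[OF that] \<phi>[OF that] refl | simp)+
    then show ?thesis
      using has_field_derivative_at_within has_real_derivative_iff_has_vector_derivative by blast
  qed
  have int: "((\<lambda>x. 2 * g x * g' x * \<phi> x + (g x)\<^sup>2 * d x) has_integral
      (g t)\<^sup>2 * \<phi> t - (g s)\<^sup>2 * \<phi> s) {s..t}"
    using deriv by (intro fundamental_theorem_of_calculus st) auto
  have i1: "(\<lambda>x. w x * (g x)\<^sup>2) integrable_on {s..t}"
    and i2: "(\<lambda>x. p x * (g' x)\<^sup>2) integrable_on {s..t}"
    by (intro integrable_continuous_real continuous_intros cont cg)+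
  have "((\<lambda>x. 1/2 * (w x * (g x)\<^sup>2) - 2 * K * (p x * (g' x)\<^sup>2)) has_integral
      1/2 * integral {s..t} (\<lambda>x. w x * (g x)\<^sup>2) - 2 * K * integral {s..t} (\<lambda>x. p x * (g' x)\<^sup>2)) {s..t}"
    by (intro has_integral_diff has_integral_mult_right integrable_integral i1 i2)
  then have "1/2 * integral {s..t} (\<lambda>x. w x * (g x)\<^sup>2) - 2 * K * integral {s..t} (\<lambda>x. p x * (g' x)\<^sup>2)
      \<le> (g t)\<^sup>2 * \<phi> t - (g s)\<^sup>2 * \<phi> s"
  proof (rule has_integral_le[OF _ int])
    fix x assume x: "x \<in> {s..t}"
    (* The inequality is first proved multiplied by w x, which avoids dividing by it. *)
    have "0 \<le> (w x * g x + 2 * (g' x * \<phi> x))\<^sup>2" by simp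
    then have "0 \<le> w x * (w x * (g x)\<^sup>2 / 2 + 2 * (g x * g' x * \<phi> x)) + 2 * ((g' x)\<^sup>2 * (\<phi> x)\<^sup>2)"
      by (simp add: power2_eq_square algebra_simps)
    also have "\<dots> \<le> w x * (w x * (g x)\<^sup>2 / 2 + 2 * (g x * g' x * \<phi> x)) + 2 * ((g' x)\<^sup>2 * (K * w x * p x))"
      using K'[OF x] by (intro add_left_mono mult_left_mono) auto
    also have "\<dots> = w x * (w x * (g x)\<^sup>2 / 2 + 2 * (g x * g' x * \<phi> x) + 2 * K * (p x * (g' x)\<^sup>2))"
      by (simp add: algebra_simps)
    finally have "0 \<le> w x * (g x)\<^sup>2 / 2 + 2 * (g x * g' x * \<phi> x) + 2 * K * (p x * (g' x)\<^sup>2)"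
      using w(1)[OF x] by (simp add: zero_le_mult_iff)
    moreover have "w x * (g x)\<^sup>2 \<le> d x * (g x)\<^sup>2"
      using w(2)[OF x] by (intro mult_right_mono) auto
    ultimately show "1/2 * (w x * (g x)\<^sup>2) - 2 * K * (p x * (g' x)\<^sup>2)
        \<le> 2 * g x * g' x * \<phi> x + (g x)\<^sup>2 * d x"
      by (simp add: algebra_simps)
  qed
  with bdry show ?thesis by simp
qed

section \<open>Derivatives up to the boundary\<close>

lemma dx_eq:
  assumes "x \<in> {0..1}" "(f has_real_derivative y) (at x within {0..1})"
  shows "dx f x = y"
proof -
  have "(f has_vector_derivative y) (at x within cbox 0 1)"
    using assms(2) by (simp add: has_real_derivative_iff_has_vector_derivative)
  then have "vector_derivative f (at x within cbox 0 1) = y"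
    using assms(1) by (intro vector_derivative_within_cbox) auto
  then show ?thesis by (simp add: dx_def)
qed

lemma Cinf_continuous: "Cinf S f \<Longrightarrow> continuous_on S f"
proof -
  assume "Cinf S f"
  then have "Ck 0 S f" by (simp add: Cinf_def)
  then obtain D :: "nat \<Rightarrow> real \<Rightarrow> real" where "\<forall>x\<in>S. D 0 x = f x" "continuous_on S (D 0)"
    unfolding Ck_def by blast
  then show ?thesis using continuous_on_cong[of S S "D 0" f] by auto
qed

lemma Cinf_poly: "Cinf S (poly q)"
  unfolding Cinf_def Ck_def
proof (intro allI exI[of _ "\<lambda>n. poly ((pderiv ^^ n) q)"] conjI ballI impI)
  show "(poly ((pderiv ^^ n) q) has_real_derivative poly ((pderiv ^^ Suc n) q) x) (at x within S)"
    for n x by (simp add: poly_DERIV has_field_derivative_at_within)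
qed (auto intro!: continuous_intros)

lemma Ck1_open:
  assumes "Ck 1 {0<..<1} f"
  obtains f1 where "continuous_on {0<..<1} f1"
    "\<And>x. x \<in> {0<..<1} \<Longrightarrow> (f has_real_derivative f1 x) (at x)"
    "\<And>x. x \<in> {0<..<1} \<Longrightarrow> dx f x = f1 x"
proof -
  obtain D :: "nat \<Rightarrow> real \<Rightarrow> real" where D: "\<forall>x\<in>{0<..<1}. D 0 x = f x"
    "\<forall>n<1. \<forall>x\<in>{0<..<1}. (D n has_real_derivative D (Suc n) x) (at x within {0<..<1})"
    "continuous_on {0<..<1} (D 1)"
    using assms unfolding Ck_def by blast
  have der: "(f has_real_derivative D 1 x) (at x)" if x: "x \<in> {0<..<1}" for x
  proof -
    have "(f has_real_derivative D 1 x) (at x within {0<..<1})"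
      using D(1,2) x by (intro has_real_derivative_transform_on[of x _ f "D 0"]) auto
    then show ?thesis using x at_within_open[of x "{0<..<1}"] by simp
  qed
  show ?thesis
    by (rule that[OF D(3) der dx_eq]) (use der in \<open>auto intro: has_field_derivative_at_within\<close>)
qed

lemma Ck2_closed:
  assumes "Ck 2 {0..1} f"
  obtains f1 f2 where
    "continuous_on {0..1} f" "continuous_on {0..1} f1" "continuous_on {0..1} f2"
    "\<And>x. x \<in> {0..1} \<Longrightarrow> (f has_real_derivative f1 x) (at x within {0..1})"
    "\<And>x. x \<in> {0..1} \<Longrightarrow> (f1 has_real_derivative f2 x) (at x within {0..1})"
    "\<And>x. x \<in> {0..1} \<Longrightarrow> dx f x = f1 x" "\<And>x. x \<in> {0..1} \<Longrightarrow> dx (dx f) x = f2 x"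
proof -
  obtain D :: "nat \<Rightarrow> real \<Rightarrow> real" where D: "\<forall>x\<in>{0..1}. D 0 x = f x"
    "\<forall>n<2. \<forall>x\<in>{0..1}. (D n has_real_derivative D (Suc n) x) (at x within {0..1})"
    "continuous_on {0..1} (D 2)"
    using assms unfolding Ck_def by blast
  have D1: "(f has_real_derivative D 1 x) (at x within {0..1})" if "x \<in> {0..1}" for x
    using D(1,2) that by (intro has_real_derivative_transform_on[of x _ f "D 0"]) auto
  have D2: "(D 1 has_real_derivative D 2 x) (at x within {0..1})" if "x \<in> {0..1}" for x
    using D(2)[rule_format, of 1 x] that by (simp add: numeral_2_eq_2)
  have dx1: "dx f x = D 1 x" if "x \<in> {0..1}" for x
    by (rule dx_eq[OF that D1[OF that]])
  have "(dx f has_real_derivative D 2 x) (at x within {0..1})" if "x \<in> {0..1}" for x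
    by (rule has_real_derivative_transform_on[OF that dx1 D2[OF that]])
  then have dx2: "dx (dx f) x = D 2 x" if "x \<in> {0..1}" for x
    using that by (intro dx_eq)
  show ?thesis
    by (rule that[OF DERIV_continuous_on[OF D1] DERIV_continuous_on[OF D2] D(3) D1 D2 dx1 dx2])
qed

lemma Ck2_open:
  assumes "Ck 2 {0<..<1} f"
  obtains f1 f2 where
    "continuous_on {0<..<1} f" "continuous_on {0<..<1} f1" "continuous_on {0<..<1} f2"
    "\<And>x. x \<in> {0<..<1} \<Longrightarrow> (f has_real_derivative f1 x) (at x)"
    "\<And>x. x \<in> {0<..<1} \<Longrightarrow> (f1 has_real_derivative f2 x) (at x)"
    "\<And>x. x \<in> {0<..<1} \<Longrightarrow> dx f x = f1 x" "\<And>x. x \<in> {0<..<1} \<Longrightarrow> dx (dx f) x = f2 x"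
proof -
  obtain D :: "nat \<Rightarrow> real \<Rightarrow> real" where D: "\<forall>x\<in>{0<..<1}. D 0 x = f x"
    "\<forall>n<2. \<forall>x\<in>{0<..<1}. (D n has_real_derivative D (Suc n) x) (at x within {0<..<1})"
    "continuous_on {0<..<1} (D 2)"
    using assms unfolding Ck_def by blast
  have at: "at x within {0<..<1} = at x" if "x \<in> {0<..<1::real}" for x
    using that by (intro at_within_open) auto
  have D1: "(f has_real_derivative D 1 x) (at x)" if x: "x \<in> {0<..<1}" for x
  proof -
    have "(f has_real_derivative D 1 x) (at x within {0<..<1})"
      using D(1,2) x by (intro has_real_derivative_transform_on[of x _ f "D 0"]) auto
    then show ?thesis using at[OF x] by simp
  qed
  have D2: "(D 1 has_real_derivative D 2 x) (at x)" if "x \<in> {0<..<1}" for x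
    using D(2)[rule_format, of 1 x] that at[OF that] by (simp add: numeral_2_eq_2)
  have dx1: "dx f x = D 1 x" if "x \<in> {0<..<1}" for x
    using that D1[OF that] by (intro dx_eq) (auto intro: has_field_derivative_at_within)
  have "(dx f has_real_derivative D 2 x) (at x)" if "x \<in> {0<..<1}" for x
    using has_real_derivative_transform_on[of x "{0<..<1}" "dx f" "D 1" "D 2 x"]
      dx1 that D2[OF that] at[OF that] by simp
  then have dx2: "dx (dx f) x = D 2 x" if "x \<in> {0<..<1}" for x
    using that by (intro dx_eq) (auto intro: has_field_derivative_at_within)
  show ?thesis
    by (rule that[OF DERIV_continuous_on[OF has_field_derivative_at_within[OF D1]]
            DERIV_continuous_on[OF has_field_derivative_at_within[OF D2]] D(3) D1 D2 dx1 dx2])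
qed

section \<open>The invariant measure of a transverse operator\<close>

locale transverse_kimura =
  fixes a b :: "real \<Rightarrow> real" and m0 m1 :: nat
  assumes kimura: "mixed_kimura a b m0 m1"
    and trans0: "transverse0 a b m0" and trans1: "transverse1 a b m1"
begin

abbreviation "A \<equiv> a_tilde a m0 m1"
abbreviation "B \<equiv> b_tilde b m0 m1"
abbreviation "L \<equiv> kimura_op a b m0 m1"
abbreviation "w \<equiv> kimura_weight a b m0 m1"
abbreviation "\<mu> \<equiv> kimura_measure a b m0 m1"

text \<open>The function \<open>p = A w\<close> is the coefficient of the Sturm-Liouville form \<open>L f = (p f')' / w\<close>.\<close>

definition p :: "real \<Rightarrow> real" where
  "p x = exp (LBINT y=ereal (1/2)..ereal x. B y / A y)"

definition Z :: real where
  "Z = (LINT x|restrict_space lborel {0..1}. w x)"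

lemma cont_a: "continuous_on {0..1} a" and cont_b: "continuous_on {0..1} b"
  and a_pos: "x \<in> {0..1} \<Longrightarrow> a x > 0" and m0: "m0 \<in> {1, 2}" and m1: "m1 \<in> {1, 2}"
  using kimura by (auto simp: mixed_kimura_def Cinf_continuous)

lemma cont_A: "continuous_on {0..1} A" and cont_B: "continuous_on {0..1} B"
  unfolding a_tilde_def b_tilde_def by (intro continuous_intros cont_a cont_b)+

lemma A_pos: "x \<in> {0<..<1} \<Longrightarrow> A x > 0"
  using a_pos[of x] by (simp add: a_tilde_def)

lemma A_nonneg: "x \<in> {0..1} \<Longrightarrow> A x \<ge> 0"
  using a_pos[of x] by (simp add: a_tilde_def)

lemma B_div_A:
  assumes "x \<in> {0<..<1}"
  shows "B x / A x = b x / (a x * (1 - x)) / x" "B x / A x = b x / (a x * x) / (1 - x)"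
  using m0 m1 assms a_pos[of x]
  by (auto simp: a_tilde_def b_tilde_def field_simps power2_eq_square)

lemma p_pos: "p x > 0" by (simp add: p_def)

lemma p_deriv:
  assumes x: "x \<in> {0<..<1}"
  shows "(p has_real_derivative B x / A x * p x) (at x)"
proof -
  (* A compact interval around both x and the base point 1/2 of the integral. *)
  define s t where "s = min x (1/2) / 2" and "t = (1 + max x (1/2)) / 2"
  have st: "0 < s" "s < x" "x < t" "t < 1" "s \<le> 1/2" "1/2 \<le> t"
    using x by (auto simp: s_def t_def min_def max_def field_simps)
  have sub: "{s..t} \<subseteq> {0..1}" "\<And>y. y \<in> {s..t} \<Longrightarrow> y \<in> {0<..<1}" using st by auto
  have "continuous_on {s..t} (\<lambda>y. B y / A y)"
  proof (intro continuous_on_divide continuous_on_subset[OF cont_A] continuous_on_subset[OF cont_B] ballI)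
    fix y assume "y \<in> {s..t}"
    then show "A y \<noteq> 0" using A_pos[OF sub(2)[of y]] by simp
  qed (use sub in auto)
  from interval_integral_FTC2[OF st(5,6) this, of x]
  have "((\<lambda>u. LBINT y=ereal (1/2)..ereal u. B y / A y) has_vector_derivative B x / A x)
      (at x within {s..t})"
    using st by simp
  then have "((\<lambda>u. LBINT y=ereal (1/2)..ereal u. B y / A y) has_real_derivative B x / A x) (at x)"
    using at_within_Icc_at[OF st(2,3)] by (simp add: has_real_derivative_iff_has_vector_derivative)
  from DERIV_chain2[OF DERIV_exp this] show ?thesis
    by (simp add: p_def[abs_def] mult.commute)
qed

lemma w_eq: "w x = p x / A x"
  by (simp add: kimura_weight_def p_def)

lemma w_A: "x \<in> {0<..<1} \<Longrightarrow> w x * A x = p x"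
  using A_pos[of x] by (simp add: w_eq)

lemma w_pos: "x \<in> {0<..<1} \<Longrightarrow> w x > 0"
  using A_pos[of x] p_pos by (simp add: w_eq)

lemma w_endpoints: "w 0 = 0" "w 1 = 0"
  using m0 m1 by (auto simp: w_eq a_tilde_def)

lemma w_nonneg: "x \<in> {0..1} \<Longrightarrow> w x \<ge> 0"
  using A_nonneg[of x] p_pos[of x] by (simp add: w_eq)

lemma cont_p: "continuous_on {0<..<1} p"
  using p_deriv by (meson DERIV_continuous continuous_at_imp_continuous_on)

lemma cont_A': "continuous_on {0<..<1} A"
  by (rule continuous_on_subset[OF cont_A]) auto

lemma cont_w: "continuous_on {0<..<1} w"
  unfolding w_eq[abs_def] using A_pos
  by (intro continuous_on_divide cont_p cont_A') force

text \<open>The hypotheses of the barrier lemmas at the endpoint \<open>0\<close>, with \<open>\<rho> x = x B x / A x\<close>.\<close>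

lemma left_slope:
  "continuous_on {0..1/2} (\<lambda>x. b x / (a x * (1 - x)))"
  "b 0 / (a 0 * (1 - 0)) > real m0 - 1"
  "x \<in> {0<..1/2} \<Longrightarrow> (p has_real_derivative b x / (a x * (1 - x)) / x * p x) (at x)"
proof -
  show "continuous_on {0..1/2} (\<lambda>x. b x / (a x * (1 - x)))"
    using a_pos by (intro continuous_intros continuous_on_subset[OF cont_a]
        continuous_on_subset[OF cont_b]) (force simp: less_le)+
  show "b 0 / (a 0 * (1 - 0)) > real m0 - 1"
    using trans0 m0 a_pos[of 0] by (auto simp: transverse0_def)
  assume "x \<in> {0<..1/2}"
  then show "(p has_real_derivative b x / (a x * (1 - x)) / x * p x) (at x)"
    using p_deriv[of x] B_div_A(1)[of x] by simp
qed

text \<open>The same at the endpoint \<open>1\<close>, in the reflected variable \<open>1 - x\<close>; the reflection turns the sign of \<open>b\<close>.\<close>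

lemma right_slope:
  "continuous_on {0..1/2} (\<lambda>x. - b (1 - x) / (a (1 - x) * (1 - x)))"
  "- b (1 - 0) / (a (1 - 0) * (1 - 0)) > real m1 - 1"
  "x \<in> {0<..1/2} \<Longrightarrow> ((\<lambda>x. p (1 - x)) has_real_derivative
     - b (1 - x) / (a (1 - x) * (1 - x)) / x * p (1 - x)) (at x)"
proof -
  have "continuous_on {0..1/2} (\<lambda>x. a (1 - x))" "continuous_on {0..1/2} (\<lambda>x. b (1 - x))"
    by (rule continuous_on_compose2[OF cont_a] continuous_on_compose2[OF cont_b];
        auto intro!: continuous_intros)+
  then show "continuous_on {0..1/2} (\<lambda>x. - b (1 - x) / (a (1 - x) * (1 - x)))"
    using a_pos by (intro continuous_intros) (force simp: less_le)+
  show "- b (1 - 0) / (a (1 - 0) * (1 - 0)) > real m1 - 1"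
    using trans1 m1 a_pos[of 1] by (auto simp: transverse1_def field_simps)
  assume x: "x \<in> {0<..1/2}"
  have *: "((\<lambda>x. p (1 - x)) has_real_derivative (B (1 - x) / A (1 - x) * p (1 - x)) * (0 - 1)) (at x)"
    by (rule DERIV_chain2[OF p_deriv]) (use x in \<open>auto intro!: derivative_eq_intros\<close>)
  have "(B (1 - x) / A (1 - x) * p (1 - x)) * (0 - 1)
        = - b (1 - x) / (a (1 - x) * (1 - x)) / x * p (1 - x)"
  proof -
    have "B (1 - x) / A (1 - x) = b (1 - x) / (a (1 - x) * (1 - x)) / x"
      using B_div_A(2)[of "1 - x"] x by simp
    then show ?thesis by simp
  qed
  with * show "((\<lambda>x. p (1 - x)) has_real_derivative
     - b (1 - x) / (a (1 - x) * (1 - x)) / x * p (1 - x)) (at x)" by (simp only:)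
qed

lemma p_at_0: "(p \<longlongrightarrow> 0) (at_right 0)"
  by (rule vanishes_at_endpoint[OF left_slope(1) _ p_pos left_slope(3)])
     (use left_slope(2) m0 in auto)

lemma p_at_1: "(p \<longlongrightarrow> 0) (at_left 1)"
proof -
  have *: "((\<lambda>x. p (1 - x)) \<longlongrightarrow> 0) (at_right 0)"
    by (rule vanishes_at_endpoint[OF right_slope(1) _ p_pos right_slope(3)])
       (use right_slope(2) m1 in auto)
  have "((\<lambda>x::real. 1 - x) \<longlongrightarrow> 1 - 1) (at_left 1)" by (intro tendsto_intros)
  then have "filterlim (\<lambda>x::real. 1 - x) (at_right 0) (at_left 1)"
    by (auto simp: filterlim_at eventually_at_left_field intro!: exI[of _ 0])
  from filterlim_compose[OF * this] show ?thesis by simp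
qed

lemma left_barrier:
  obtains \<phi> d K where "K \<ge> 0"
    "\<And>x. x \<in> {0<..1/2} \<Longrightarrow> (\<phi> has_real_derivative d x) (at x)"
    "\<And>x. x \<in> {0<..1/2} \<Longrightarrow> w x \<le> d x"
    "\<And>x. x \<in> {0<..1/2} \<Longrightarrow> \<phi> x \<ge> 0"
    "\<And>x. x \<in> {0<..1/2} \<Longrightarrow> (\<phi> x)\<^sup>2 \<le> K * w x * p x"
proof -
  have \<alpha>: "continuous_on {0..1/2} (\<lambda>x. a x * (1 - x) ^ m1)"
    by (intro continuous_intros continuous_on_subset[OF cont_a]) auto
  have \<alpha>': "a x * (1 - x) ^ m1 > 0" if "x \<in> {0..1/2}" for x
    using a_pos[of x] that by simp
  have w: "p x / (a x * (1 - x) ^ m1 * x ^ m0) = w x" for x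
    by (simp add: w_eq a_tilde_def mult_ac)
  show ?thesis
    by (rule endpoint_barrier[OF left_slope(1,2) m0 p_pos left_slope(3) \<alpha> \<alpha>', unfolded w])
       (assumption | rule that)+
qed

text \<open>The reflected barrier is also negated, so that its derivative is again bounded below by \<open>w\<close>.\<close>

lemma right_barrier:
  obtains \<phi> d K where "K \<ge> 0"
    "\<And>x. x \<in> {1/2..<1} \<Longrightarrow> (\<phi> has_real_derivative d x) (at x)"
    "\<And>x. x \<in> {1/2..<1} \<Longrightarrow> w x \<le> d x"
    "\<And>x. x \<in> {1/2..<1} \<Longrightarrow> \<phi> x \<le> 0"
    "\<And>x. x \<in> {1/2..<1} \<Longrightarrow> (\<phi> x)\<^sup>2 \<le> K * w x * p x"
proof -
  have "continuous_on {0..1/2} (\<lambda>x. a (1 - x))"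
    by (rule continuous_on_compose2[OF cont_a]) (auto intro!: continuous_intros)
  then have \<alpha>: "continuous_on {0..1/2} (\<lambda>x. a (1 - x) * (1 - x) ^ m0)"
    by (intro continuous_intros)
  have \<alpha>': "a (1 - x) * (1 - x) ^ m0 > 0" if "x \<in> {0..1/2}" for x
    using a_pos[of "1 - x"] that by simp
  have w: "p (1 - x) / (a (1 - x) * (1 - x) ^ m0 * x ^ m1) = w (1 - x)" for x
    by (simp add: w_eq a_tilde_def mult_ac)
  obtain \<phi> d K where *: "K \<ge> 0"
    "\<And>x. x \<in> {0<..1/2} \<Longrightarrow> (\<phi> has_real_derivative d x) (at x)"
    "\<And>x. x \<in> {0<..1/2} \<Longrightarrow> w (1 - x) \<le> d x"
    "\<And>x. x \<in> {0<..1/2} \<Longrightarrow> \<phi> x \<ge> 0"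
    "\<And>x. x \<in> {0<..1/2} \<Longrightarrow> (\<phi> x)\<^sup>2 \<le> K * w (1 - x) * p (1 - x)"
    by (rule endpoint_barrier[OF right_slope(1,2) m1 p_pos right_slope(3) \<alpha> \<alpha>', unfolded w])
       (assumption | rule that)+
  show ?thesis
  proof (rule that[OF *(1)])
    fix x :: real assume x: "x \<in> {1/2..<1}"
    then have x': "1 - x \<in> {0<..1/2}" by auto
    have "((\<lambda>x. - \<phi> (1 - x)) has_real_derivative - (d (1 - x) * (0 - 1))) (at x)"
      by (intro DERIV_minus DERIV_chain2[where f = \<phi> and g = "\<lambda>x. 1 - x", OF *(2)[OF x']])
         (auto intro!: derivative_eq_intros)
    then show "((\<lambda>x. - \<phi> (1 - x)) has_real_derivative d (1 - x)) (at x)" by simp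
    show "w x \<le> d (1 - x)" "- \<phi> (1 - x) \<le> 0" "(- \<phi> (1 - x))\<^sup>2 \<le> K * w x * p x"
      using *(3-5)[OF x'] by auto
  qed
qed

text \<open>Compact intervals exhausting the open interval. They contain the midpoint, where the barriers for the
  two endpoints meet.\<close>

definition lo :: "nat \<Rightarrow> real" where "lo n = 1 / (real n + 3)"
definition hi :: "nat \<Rightarrow> real" where "hi n = 1 - lo n"

lemma lo_hi: "0 < lo n" "lo n \<le> 1/2" "1/2 \<le> hi n" "hi n < 1" "lo n \<le> hi n"
  by (auto simp: lo_def hi_def field_simps)

lemma lo_hi_sub: "{lo n..hi n} \<subseteq> {0<..<1}"
  using lo_hi[of n] by auto

lemma lo_decseq: "m \<le> n \<Longrightarrow> lo n \<le> lo m"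
  by (simp add: lo_def field_simps)

lemma lo_tendsto: "lo \<longlonglongrightarrow> 0"
proof -
  have "(\<lambda>n. 1 / real (n + 3)) \<longlonglongrightarrow> 0"
    by (rule LIMSEQ_ignore_initial_segment[OF lim_1_over_n])
  then show ?thesis by (simp add: lo_def[abs_def])
qed

lemma lo_at_right: "filterlim lo (at_right 0) sequentially"
  using lo_tendsto lo_hi(1) by (auto simp: filterlim_at intro!: always_eventually) (metis less_irrefl)

lemma hi_at_left: "filterlim hi (at_left 1) sequentially"
proof -
  have "hi \<longlonglongrightarrow> 1 - 0" unfolding hi_def[abs_def] by (intro tendsto_intros lo_tendsto)
  then show ?thesis
    using lo_hi(4) by (auto simp: filterlim_at intro!: always_eventually) (metis less_irrefl)
qed

lemma exhaustion:
  assumes "x \<in> {0<..<1}"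
  shows "\<forall>\<^sub>F n in sequentially. x \<in> {lo n..hi n}"
proof -
  have "\<forall>\<^sub>F n in sequentially. lo n < x" "\<forall>\<^sub>F n in sequentially. lo n < 1 - x"
    using assms order_tendstoD(2)[OF lo_tendsto] by auto
  then show ?thesis by eventually_elim (auto simp: hi_def)
qed

text \<open>Integrating \<open>w \<le> \<phi>'\<close> over the exhausting intervals bounds their masses by the values of the two
  barriers at the midpoint.\<close>

lemma w_integrable: "integrable lborel (\<lambda>x. indicator {0..1} x * w x)"
proof -
  obtain \<phi> d K where l: "K \<ge> 0"
    "\<And>x. x \<in> {0<..1/2} \<Longrightarrow> (\<phi> has_real_derivative d x) (at x)"
    "\<And>x. x \<in> {0<..1/2} \<Longrightarrow> w x \<le> d x"
    "\<And>x. x \<in> {0<..1/2} \<Longrightarrow> \<phi> x \<ge> 0"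
    "\<And>x. x \<in> {0<..1/2} \<Longrightarrow> (\<phi> x)\<^sup>2 \<le> K * w x * p x"
    by (rule left_barrier) (rule that)
  obtain \<psi> e J where r: "J \<ge> 0"
    "\<And>x. x \<in> {1/2..<1} \<Longrightarrow> (\<psi> has_real_derivative e x) (at x)"
    "\<And>x. x \<in> {1/2..<1} \<Longrightarrow> w x \<le> e x"
    "\<And>x. x \<in> {1/2..<1} \<Longrightarrow> \<psi> x \<le> 0"
    "\<And>x. x \<in> {1/2..<1} \<Longrightarrow> (\<psi> x)\<^sup>2 \<le> J * w x * p x"
    by (rule right_barrier) (rule that)
  define f where "f n x = indicator {lo n..hi n} x * w x" for n x
  have cont: "continuous_on {lo n..hi n} w" for n
    by (rule continuous_on_subset[OF cont_w lo_hi_sub])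
  have set: "set_integrable lborel {lo n..hi n} w" for n
    by (rule borel_integrable_atLeastAtMost'[OF cont])
  have int: "integrable lborel (f n)" for n
    using set[of n] by (simp add: set_integrable_def f_def[abs_def])
  have eq: "integral\<^sup>L lborel (f n) = integral {lo n..hi n} w" for n
    using set_borel_integral_eq_integral(2)[OF set[of n]]
    by (simp add: set_lebesgue_integral_def f_def[abs_def])
  have bound: "integral\<^sup>L lborel (f n) \<le> \<phi> (1/2) - \<psi> (1/2)" for n
  proof -
    have io: "w integrable_on {lo n..hi n}" by (rule integrable_continuous_real[OF cont])
    have io1: "w integrable_on {lo n..1/2}" and io2: "w integrable_on {1/2..hi n}"
      using lo_hi[of n] by (auto intro!: integrable_on_subinterval[OF io])
    have "(d has_integral (\<phi> (1/2) - \<phi> (lo n))) {lo n..1/2}"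
      using lo_hi[of n] by (intro has_integral_real_derivative l(2)) auto
    then have 1: "integral {lo n..1/2} w \<le> \<phi> (1/2) - \<phi> (lo n)"
      by (rule has_integral_le[OF integrable_integral[OF io1]]) (use l(3) lo_hi[of n] in auto)
    have "(e has_integral (\<psi> (hi n) - \<psi> (1/2))) {1/2..hi n}"
      using lo_hi[of n] by (intro has_integral_real_derivative r(2)) auto
    then have 2: "integral {1/2..hi n} w \<le> \<psi> (hi n) - \<psi> (1/2)"
      by (rule has_integral_le[OF integrable_integral[OF io2]]) (use r(3) lo_hi[of n] in auto)
    have "integral {lo n..hi n} w = integral {lo n..1/2} w + integral {1/2..hi n} w"
      using lo_hi[of n] io by (intro Henstock_Kurzweil_Integration.integral_combine[symmetric]) auto
    then show ?thesis
      unfolding eq using 1 2 l(4)[of "lo n"] r(4)[of "hi n"] lo_hi[of n] by simp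
  qed
  have mono: "mono (\<lambda>n. f n x)" for x
  proof (rule monoI)
    fix m n :: nat assume "m \<le> n"
    then have "lo n \<le> lo m" "hi m \<le> hi n" using lo_decseq by (auto simp: hi_def)
    then show "f m x \<le> f n x"
      using w_nonneg[of x] lo_hi[of n] by (auto simp: f_def indicator_def)
  qed
  have "incseq (\<lambda>n. integral\<^sup>L lborel (f n))"
    using mono int by (auto intro!: incseq_SucI integral_mono simp: mono_def)
  then obtain I where I: "(\<lambda>n. integral\<^sup>L lborel (f n)) \<longlonglongrightarrow> I"
    using incseq_convergent[of "\<lambda>n. integral\<^sup>L lborel (f n)" "\<phi> (1/2) - \<psi> (1/2)"] bound by blast
  show ?thesis
  proof (rule integrable_monotone_convergence[OF int _ _ I])
    show "AE x in lborel. mono (\<lambda>n. f n x)" using mono by simp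
    have "(\<lambda>n. f n x) \<longlonglongrightarrow> indicator {0..1} x * w x" for x
    proof (cases "x \<in> {0<..<1}")
      case True
      have "\<forall>\<^sub>F n in sequentially. f n x = indicator {0..1} x * w x"
        using exhaustion[OF True] by eventually_elim (use True in \<open>auto simp: f_def\<close>)
      then show ?thesis by (rule tendsto_eventually)
    next
      case False
      have "f n x = 0" for n using False lo_hi_sub[of n] by (auto simp: f_def indicator_def)
      moreover have "indicator {0..1} x * w x = 0"
        using False w_endpoints by (cases "x = 0 \<or> x = 1") (auto simp: indicator_def)
      ultimately show ?thesis by (simp only: tendsto_const)
    qed
    then show "AE x in lborel. (\<lambda>n. f n x) \<longlonglongrightarrow> indicator {0..1} x * w x" by simp
    have "(\<lambda>x. indicator {0<..<1} x *\<^sub>R w x) \<in> borel_measurable borel"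
      by (rule borel_measurable_continuous_on_indicator[OF _ cont_w]) simp
    moreover have "(\<lambda>x. indicator {0<..<1} x *\<^sub>R w x) = (\<lambda>x. indicator {0..1} x * w x)"
      using w_endpoints by (auto simp: fun_eq_iff indicator_def less_le)
    ultimately show "(\<lambda>x. indicator {0..1} x * w x) \<in> borel_measurable lborel" by simp
  qed
qed

lemma w_measurable: "w \<in> borel_measurable (restrict_space lborel {0..1})"
  using borel_measurable_continuous_Ioo[OF cont_w]
  by (subst measurable_cong_sets[OF sets_restrict_space_cong[OF sets_lborel] refl])

lemma w_integrable_restrict: "integrable (restrict_space lborel {0..1}) w"
  using w_integrable by (subst integrable_restrict_space) auto

lemma w_nonneg_AE: "AE x in restrict_space lborel {0..1}. 0 \<le> w x"
  using w_nonneg by (auto intro!: AE_I2 simp: space_restrict_space)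

lemma Z_pos: "Z > 0"
proof -
  have "Z \<ge> 0"
    unfolding Z_def by (rule integral_nonneg_AE[OF w_nonneg_AE])
  moreover have "Z \<noteq> 0"
  proof
    assume "Z = 0"
    then have "AE x in restrict_space lborel {0..1}. w x = 0"
      unfolding Z_def using integral_nonneg_eq_0_iff_AE[OF w_integrable_restrict w_nonneg_AE] by simp
    then have "AE x in lborel. x \<in> {0..1} \<longrightarrow> w x = 0"
      by (subst (asm) AE_restrict_space_iff) auto
    then have "AE x in lborel. x \<notin> {0<..<1::real}"
    proof eventually_elim
      case (elim x)
      then show ?case using w_pos[of x] by auto
    qed
    then have "{0<..<1::real} \<in> null_sets lborel"
      by (subst AE_iff_null_sets) auto
    then show False by (auto simp: null_sets_def)
  qed
  ultimately show ?thesis by simp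
qed

lemma mu_eq: "\<mu> = density (restrict_space lborel {0..1}) (\<lambda>x. ennreal (w x / Z))"
  by (simp add: kimura_measure_def Z_def Let_def)

lemma density_measurable: "(\<lambda>x. w x / Z) \<in> borel_measurable (restrict_space lborel {0..1})"
  using w_measurable by simp

lemma density_nonneg: "AE x in restrict_space lborel {0..1}. 0 \<le> w x / Z"
  using w_nonneg_AE Z_pos by auto

lemma sets_mu: "sets \<mu> = sets (restrict_space borel {0..1})"
  by (simp add: mu_eq cong: sets_restrict_space_cong)

sublocale mu: unit_interval_prob \<mu>
proof (intro unit_interval_prob.intro prob_spaceI unit_interval_prob_axioms.intro)
  let ?R = "restrict_space lborel {0..1::real}"
  have "emeasure \<mu> (space \<mu>) = (\<integral>\<^sup>+ x. ennreal (w x / Z) * indicator (space ?R) x \<partial>?R)"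
    unfolding mu_eq space_density using density_measurable
    by (intro emeasure_density sets.top) auto
  also have "\<dots> = (\<integral>\<^sup>+ x. ennreal (w x / Z) \<partial>?R)"
    by (rule nn_integral_cong) simp
  also have "\<dots> = ennreal (LINT x|restrict_space lborel {0..1}. w x / Z)"
    by (rule nn_integral_eq_integral[OF _ density_nonneg]) (simp add: w_integrable_restrict)
  also have "(LINT x|restrict_space lborel {0..1}. w x / Z) = 1"
    using Z_pos by (simp add: Z_def)
  finally show "emeasure \<mu> (space \<mu>) = 1" by simp
qed (rule sets_mu)

lemma mu_integral:
  assumes "F \<in> borel_measurable \<mu>"
  shows "(LINT x|\<mu>. F x) = (LINT x|lborel. indicator {0..1} x * (w x * F x)) / Z"
    and "integrable \<mu> F \<longleftrightarrow> integrable lborel (\<lambda>x. indicator {0..1} x * (w x * F x))"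
proof -
  have F: "F \<in> borel_measurable (restrict_space lborel {0..1})"
    using assms by (simp add: mu_eq)
  have "(LINT x|\<mu>. F x) = (LINT x|restrict_space lborel {0..1}. w x / Z * F x)"
    unfolding mu_eq using integral_real_density[OF density_measurable density_nonneg F] by simp
  also have "\<dots> = (LINT x|restrict_space lborel {0..1}. w x * F x) / Z" by simp
  also have "(LINT x|restrict_space lborel {0..1}. w x * F x)
      = (LINT x|lborel. indicator {0..1} x * (w x * F x))"
    by (subst integral_restrict_space) auto
  finally show "(LINT x|\<mu>. F x) = (LINT x|lborel. indicator {0..1} x * (w x * F x)) / Z" .
  have "integrable \<mu> F \<longleftrightarrow> integrable (restrict_space lborel {0..1}) (\<lambda>x. (1 / Z) * (w x * F x))"
    unfolding mu_eq using integrable_real_density[OF density_measurable density_nonneg F] by simp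
  also have "\<dots> \<longleftrightarrow> integrable (restrict_space lborel {0..1}) (\<lambda>x. w x * F x)"
    using Z_pos by (subst integrable_mult_left_iff) simp
  also have "\<dots> \<longleftrightarrow> integrable lborel (\<lambda>x. indicator {0..1} x * (w x * F x))"
    by (subst integrable_restrict_space) auto
  finally show "integrable \<mu> F \<longleftrightarrow> integrable lborel (\<lambda>x. indicator {0..1} x * (w x * F x))" .
qed

lemma AE_interior: "AE x in \<mu>. x \<in> {0<..<1}"
proof -
  have "AE x in restrict_space lborel {0..1}. ennreal (w x / Z) > 0 \<longrightarrow> x \<in> {0<..<1}"
    using w_endpoints by (auto intro!: AE_I2 simp: space_restrict_space less_le)
  then show ?thesis
    unfolding mu_eq by (subst AE_density) (use density_measurable in auto)
qed

lemma mu_integral_compact: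
  assumes st: "0 < s" "s \<le> t" "t < 1" and F: "continuous_on {s..t} F"
  shows "(LINT x|\<mu>. indicator {s..t} x * F x) = integral {s..t} (\<lambda>x. w x * F x) / Z"
    and "integrable \<mu> (\<lambda>x. indicator {s..t} x * F x)"
proof -
  have "(\<lambda>x. indicator {s..t} x *\<^sub>R F x) \<in> borel_measurable borel"
    by (rule borel_measurable_continuous_on_indicator[OF _ F]) simp
  then have m: "(\<lambda>x. indicator {s..t} x * F x) \<in> borel_measurable \<mu>"
    by (intro mu.measurable_borel) simp
  have "continuous_on {s..t} (\<lambda>x. w x * F x)"
    using st by (intro continuous_intros F continuous_on_subset[OF cont_w]) auto
  from borel_integrable_atLeastAtMost'[OF this]
  have set: "set_integrable lborel {s..t} (\<lambda>x. w x * F x)" .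
  have eq: "(\<lambda>x. indicator {0..1} x * (w x * (indicator {s..t} x * F x)))
      = (\<lambda>x. indicator {s..t} x *\<^sub>R (w x * F x))"
    using st by (auto simp: fun_eq_iff indicator_def)
  show "integrable \<mu> (\<lambda>x. indicator {s..t} x * F x)"
    using set unfolding mu_integral(2)[OF m] eq by (simp add: set_integrable_def)
  show "(LINT x|\<mu>. indicator {s..t} x * F x) = integral {s..t} (\<lambda>x. w x * F x) / Z"
    unfolding mu_integral(1)[OF m] eq
    using set_borel_integral_eq_integral(2)[OF set] by (simp add: set_lebesgue_integral_def)
qed

lemma mu_integral_exhaust:
  fixes F :: "real \<Rightarrow> real"
  assumes "integrable \<mu> F"
  shows "(\<lambda>n. LINT x|\<mu>. indicator {lo n..hi n} x * F x) \<longlonglongrightarrow> (LINT x|\<mu>. F x)"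
proof (rule integral_dominated_convergence[where w = "\<lambda>x. \<bar>F x\<bar>"])
  show "AE x in \<mu>. (\<lambda>n. indicator {lo n..hi n} x * F x) \<longlonglongrightarrow> F x"
    using AE_interior
  proof eventually_elim
    case (elim x)
    have "\<forall>\<^sub>F n in sequentially. indicator {lo n..hi n} x * F x = F x"
      using exhaustion[OF elim] by eventually_elim simp
    then show ?case by (rule tendsto_eventually)
  qed
  show "(\<lambda>x. indicator {lo n..hi n} x * F x) \<in> borel_measurable \<mu>" for n
  proof (rule borel_measurable_times)
    show "(indicator {lo n..hi n} :: real \<Rightarrow> real) \<in> borel_measurable \<mu>"
      by (rule mu.measurable_borel) simp
  qed (use assms in simp)
qed (use assms in \<open>auto intro!: AE_I2 simp: indicator_def\<close>)

text \<open>The divergence theorem for \<open>\<mu>\<close>: all integrations by parts below apply it with \<open>G\<close> equal to \<open>p\<close> times an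
  expression that stays bounded or vanishes near the endpoints.\<close>

lemma mu_integral_derivative_eq_0:
  assumes G: "\<And>x. x \<in> {0<..<1} \<Longrightarrow> (G has_real_derivative w x * k x) (at x)"
    and k: "continuous_on {0<..<1} k" "integrable \<mu> k"
    and lim: "(G \<longlongrightarrow> 0) (at_right 0)" "(G \<longlongrightarrow> 0) (at_left 1)"
  shows "(LINT x|\<mu>. k x) = 0"
proof -
  have eq: "(LINT x|\<mu>. indicator {lo n..hi n} x * k x) = (G (hi n) - G (lo n)) / Z" for n
  proof -
    have "((\<lambda>x. w x * k x) has_integral G (hi n) - G (lo n)) {lo n..hi n}"
      using lo_hi_sub[of n] lo_hi[of n] by (intro has_integral_real_derivative G) auto
    moreover have "continuous_on {lo n..hi n} k"
      by (rule continuous_on_subset[OF k(1) lo_hi_sub])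
    ultimately show ?thesis
      using mu_integral_compact(1)[of "lo n" "hi n" k] lo_hi[of n] by (simp add: integral_unique)
  qed
  have "(\<lambda>n. (G (hi n) - G (lo n)) / Z) \<longlonglongrightarrow> (0 - 0) / Z"
    using Z_pos
    by (intro tendsto_intros filterlim_compose[OF lim(1) lo_at_right]
        filterlim_compose[OF lim(2) hi_at_left]) auto
  then show ?thesis
    using mu_integral_exhaust[OF k(2)] LIMSEQ_unique unfolding eq by fastforce
qed

section \<open>The Poincare inequality\<close>

text \<open>Hardy's inequality on both sides of the midpoint for \<open>f - f (1/2)\<close>. Replacing \<open>f (1/2)\<close> by the mean only
  decreases the second moment.\<close>

lemma poincare:
  obtains C where "C > 0"
    "\<forall>f f1. continuous_on {0<..<1} f1 \<longrightarrow>
       (\<forall>x\<in>{0<..<1}. (f has_real_derivative f1 x) (at x)) \<longrightarrow>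
       f \<in> L2 \<mu> \<longrightarrow> integrable \<mu> (\<lambda>x. 2 * A x * (f1 x)\<^sup>2) \<longrightarrow> (LINT x|\<mu>. f x) = 0 \<longrightarrow>
       (LINT x|\<mu>. (f x)\<^sup>2) \<le> C * (LINT x|\<mu>. 2 * A x * (f1 x)\<^sup>2)"
proof -
  obtain \<phi> d K where l: "K \<ge> 0"
    "\<And>x. x \<in> {0<..1/2} \<Longrightarrow> (\<phi> has_real_derivative d x) (at x)"
    "\<And>x. x \<in> {0<..1/2} \<Longrightarrow> w x \<le> d x"
    "\<And>x. x \<in> {0<..1/2} \<Longrightarrow> \<phi> x \<ge> 0"
    "\<And>x. x \<in> {0<..1/2} \<Longrightarrow> (\<phi> x)\<^sup>2 \<le> K * w x * p x"
    by (rule left_barrier) (rule that)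
  obtain \<psi> e J where r: "J \<ge> 0"
    "\<And>x. x \<in> {1/2..<1} \<Longrightarrow> (\<psi> has_real_derivative e x) (at x)"
    "\<And>x. x \<in> {1/2..<1} \<Longrightarrow> w x \<le> e x"
    "\<And>x. x \<in> {1/2..<1} \<Longrightarrow> \<psi> x \<le> 0"
    "\<And>x. x \<in> {1/2..<1} \<Longrightarrow> (\<psi> x)\<^sup>2 \<le> J * w x * p x"
    by (rule right_barrier) (rule that)
  (* Hardy gives 4 (K + J); half of it goes into the factor 2 of the squared gradient, and the 1
     makes the constant positive. *)
  define C where "C = 2 * (K + J) + 1"
  show ?thesis
  proof (rule that[of C]; (intro allI impI)?)
    show "C > 0" using l(1) r(1) by (simp add: C_def)
    fix f f1
    assume f1: "continuous_on {0<..<1} f1"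
      and fd: "\<forall>x\<in>{0<..<1}. (f has_real_derivative f1 x) (at x)" and f2: "f \<in> L2 \<mu>"
      and int: "integrable \<mu> (\<lambda>x. 2 * A x * (f1 x)\<^sup>2)" and mean: "(LINT x|\<mu>. f x) = 0"
    define g where "g x = f x - f (1/2)" for x
    have gd: "(g has_real_derivative f1 x) (at x)" if "x \<in> {0<..<1}" for x
      unfolding g_def using fd that by (auto intro!: derivative_eq_intros)
    have g2: "g \<in> L2 \<mu>" unfolding g_def using f2 by (intro L2_diff) auto
    have contg: "continuous_on {0<..<1} g"
      using gd by (meson DERIV_continuous continuous_at_imp_continuous_on)
    have step: "(LINT x|\<mu>. indicator {lo n..hi n} x * (g x)\<^sup>2)
        \<le> (2 * (K + J)) * (LINT x|\<mu>. indicator {lo n..hi n} x * (2 * A x * (f1 x)\<^sup>2))" for n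
    proof -
      note lh = lo_hi[of n] lo_hi_sub[of n]
      let ?P = "\<lambda>x. p x * (f1 x)\<^sup>2" and ?W = "\<lambda>x. w x * (g x)\<^sup>2"
      have contP: "continuous_on {lo n..hi n} ?P" and contW: "continuous_on {lo n..hi n} ?W"
        by (intro continuous_intros continuous_on_subset[OF cont_p lh(6)]
            continuous_on_subset[OF f1 lh(6)] continuous_on_subset[OF cont_w lh(6)]
            continuous_on_subset[OF contg lh(6)])+
      have iP: "?P integrable_on {lo n..hi n}" and iW: "?W integrable_on {lo n..hi n}"
        by (intro integrable_continuous_real contP contW)+
      have sub1: "{lo n..1/2} \<subseteq> {0<..<1}" and sub2: "{1/2..hi n} \<subseteq> {0<..<1}" using lh by auto
      have 1: "integral {lo n..1/2} ?W \<le> 4 * K * integral {lo n..1/2} ?P"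
      proof (rule hardy_interval[where d = d, OF _ l(1)])
        show "(g (1/2))\<^sup>2 * \<phi> (1/2) \<le> (g (lo n))\<^sup>2 * \<phi> (lo n)"
          using l(4)[of "lo n"] lh by (simp add: g_def)
      qed (use lh sub1 l gd w_pos in \<open>auto intro: continuous_on_subset[OF cont_w]
            continuous_on_subset[OF cont_p] continuous_on_subset[OF f1]\<close>)
      have 2: "integral {1/2..hi n} ?W \<le> 4 * J * integral {1/2..hi n} ?P"
      proof (rule hardy_interval[where d = e, OF _ r(1)])
        show "(g (hi n))\<^sup>2 * \<psi> (hi n) \<le> (g (1/2))\<^sup>2 * \<psi> (1/2)"
          using r(4)[of "hi n"] lh by (simp add: g_def mult_nonneg_nonpos)
      qed (use lh sub2 r gd w_pos in \<open>auto intro: continuous_on_subset[OF cont_w]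
            continuous_on_subset[OF cont_p] continuous_on_subset[OF f1]\<close>)
      have split: "integral {lo n..hi n} F = integral {lo n..1/2} F + integral {1/2..hi n} F"
        if "F integrable_on {lo n..hi n}" for F :: "real \<Rightarrow> real"
        using lh that by (intro Henstock_Kurzweil_Integration.integral_combine[symmetric]) auto
      have P0: "integral {lo n..1/2} ?P \<ge> 0" "integral {1/2..hi n} ?P \<ge> 0"
        using p_pos lh
        by (auto intro!: integral_nonneg integrable_on_subinterval[OF iP] mult_nonneg_nonneg
            intro: less_imp_le)
      have "integral {lo n..hi n} ?W \<le> 4 * K * integral {lo n..1/2} ?P + 4 * J * integral {1/2..hi n} ?P"
        using 1 2 split[OF iW] by simp
      also have "\<dots> \<le> 4 * (K + J) * (integral {lo n..1/2} ?P + integral {1/2..hi n} ?P)"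
        using P0 l(1) r(1) by (simp add: algebra_simps add_increasing)
      also have "\<dots> = 2 * (K + J) * integral {lo n..hi n} (\<lambda>x. 2 * ?P x)"
        using split[OF iP] by (simp add: algebra_simps)
      also have "integral {lo n..hi n} (\<lambda>x. 2 * ?P x)
          = integral {lo n..hi n} (\<lambda>x. w x * (2 * A x * (f1 x)\<^sup>2))"
      proof (rule Henstock_Kurzweil_Integration.integral_cong)
        fix x assume "x \<in> {lo n..hi n}"
        then show "2 * ?P x = w x * (2 * A x * (f1 x)\<^sup>2)"
          using w_A[of x] lh(6) by (auto simp: mult_ac simp flip: w_A)
      qed
      finally have "integral {lo n..hi n} ?W / Z
          \<le> 2 * (K + J) * integral {lo n..hi n} (\<lambda>x. w x * (2 * A x * (f1 x)\<^sup>2)) / Z"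
        using Z_pos by (simp add: divide_right_mono)
      moreover have "continuous_on {lo n..hi n} (\<lambda>x. (g x)\<^sup>2)"
        "continuous_on {lo n..hi n} (\<lambda>x. 2 * A x * (f1 x)\<^sup>2)"
        by (intro continuous_intros continuous_on_subset[OF cont_A' lh(6)]
            continuous_on_subset[OF f1 lh(6)] continuous_on_subset[OF contg lh(6)])+
      ultimately show ?thesis
        using mu_integral_compact(1)[of "lo n" "hi n"] lh by simp
    qed
    have "(LINT x|\<mu>. (f x)\<^sup>2) \<le> (LINT x|\<mu>. (g x)\<^sup>2)"
      unfolding g_def mu.integral_variance[OF f2] mean by simp
    also have "\<dots> \<le> (2 * (K + J)) * (LINT x|\<mu>. 2 * A x * (f1 x)\<^sup>2)"
      using step by (intro LIMSEQ_le[OF mu_integral_exhaust[OF L2_D(2)[OF g2]]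
          tendsto_mult_left[OF mu_integral_exhaust[OF int]]]) auto
    also have "\<dots> \<le> C * (LINT x|\<mu>. 2 * A x * (f1 x)\<^sup>2)"
    proof (rule mult_right_mono)
      have "AE x in \<mu>. 0 \<le> 2 * A x * (f1 x)\<^sup>2"
        using A_nonneg by (auto intro!: AE_I2 simp: mu.space_M)
      then show "0 \<le> (LINT x|\<mu>. 2 * A x * (f1 x)\<^sup>2)" by (rule integral_nonneg_AE)
    qed (simp add: C_def)
    finally show "(LINT x|\<mu>. (f x)\<^sup>2) \<le> C * (LINT x|\<mu>. 2 * A x * (f1 x)\<^sup>2)" .
  qed
qed

definition poincare_const :: "real \<Rightarrow> bool" where
  "poincare_const C \<longleftrightarrow> C > 0 \<and>
    (\<forall>f. Ck 1 {0<..<1} f \<longrightarrow> f \<in> L2 \<mu> \<longrightarrow> integrable \<mu> (\<lambda>x. (grad_z a m0 m1 f x)\<^sup>2) \<longrightarrow>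
      (LINT x|\<mu>. f x) = 0 \<longrightarrow> (LINT x|\<mu>. (f x)\<^sup>2) \<le> C * (LINT x|\<mu>. (grad_z a m0 m1 f x)\<^sup>2))"

lemma grad_z_sq:
  assumes "x \<in> {0..1}"
  shows "(grad_z a m0 m1 f x)\<^sup>2 = 2 * A x * (dx f x)\<^sup>2"
  using A_nonneg[OF assms] by (simp add: grad_z_def power_mult_distrib)

lemma ex_poincare_const: "\<exists>C. poincare_const C"
proof -
  obtain C where C: "C > 0"
    "\<forall>f f1. continuous_on {0<..<1} f1 \<longrightarrow>
       (\<forall>x\<in>{0<..<1}. (f has_real_derivative f1 x) (at x)) \<longrightarrow>
       f \<in> L2 \<mu> \<longrightarrow> integrable \<mu> (\<lambda>x. 2 * A x * (f1 x)\<^sup>2) \<longrightarrow> (LINT x|\<mu>. f x) = 0 \<longrightarrow>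
       (LINT x|\<mu>. (f x)\<^sup>2) \<le> C * (LINT x|\<mu>. 2 * A x * (f1 x)\<^sup>2)"
    by (rule poincare) (rule that)
  have "(LINT x|\<mu>. (f x)\<^sup>2) \<le> C * (LINT x|\<mu>. (grad_z a m0 m1 f x)\<^sup>2)"
    if f: "Ck 1 {0<..<1} f" "f \<in> L2 \<mu>" "integrable \<mu> (\<lambda>x. (grad_z a m0 m1 f x)\<^sup>2)"
      "(LINT x|\<mu>. f x) = 0" for f
  proof -
    obtain f1 where f1: "continuous_on {0<..<1} f1"
      "\<And>x. x \<in> {0<..<1} \<Longrightarrow> (f has_real_derivative f1 x) (at x)"
      "\<And>x. x \<in> {0<..<1} \<Longrightarrow> dx f x = f1 x"
      using Ck1_open[OF f(1)] by blast
    have AE: "AE x in \<mu>. (grad_z a m0 m1 f x)\<^sup>2 = 2 * A x * (f1 x)\<^sup>2"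
      using AE_interior by eventually_elim (auto simp: grad_z_sq f1(3))
    have m: "(\<lambda>x. 2 * A x * (f1 x)\<^sup>2) \<in> borel_measurable \<mu>"
      by (intro mu.measurable_continuous_Ioo continuous_intros cont_A' f1(1))
    have "integrable \<mu> (\<lambda>x. 2 * A x * (f1 x)\<^sup>2)"
      using integrable_cong_AE_imp[OF f(3) m] AE by auto
    then show ?thesis
      using C(2)[rule_format, OF f1(1,2) f(2) _ f(4)] integral_cong_AE[OF _ m AE] f(3) by auto
  qed
  with C(1) show ?thesis unfolding poincare_const_def by blast
qed

lemma poincare_const_pos: "poincare_const C \<Longrightarrow> C > 0"
  by (simp add: poincare_const_def)

lemma poincare_inequality_holds: "poincare_inequality a b m0 m1"
  using ex_poincare_const unfolding poincare_inequality_def poincare_const_def Let_def by blast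

end

section \<open>Classical solutions of the Cauchy problem\<close>

context unit_interval_prob
begin

lemma integrable_continuous_Icc: "continuous_on {0..1} f \<Longrightarrow> integrable M f"
  for f :: "real \<Rightarrow> real"
  by (rule L2_integrable[OF L2_continuous])

text \<open>Differentiation under the integral: difference quotients are dominated by the bound on the time
  derivative, through the mean value inequality.\<close>

lemma has_derivative_integral_parameter:
  fixes v r :: "real \<Rightarrow> real \<Rightarrow> real"
  assumes deriv: "\<And>t x. t \<ge> 0 \<Longrightarrow> x \<in> {0..1} \<Longrightarrow>
      ((\<lambda>s. v s x) has_real_derivative r t x) (at t within {0..})"
    and v: "\<And>t. t \<ge> 0 \<Longrightarrow> continuous_on {0..1} (v t)"
    and r: "\<And>t. t \<ge> 0 \<Longrightarrow> continuous_on {0..1} (r t)"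
    and bound: "\<And>T. \<exists>N. \<forall>t\<in>{0..T}. \<forall>x\<in>{0..1}. \<bar>r t x\<bar> \<le> N"
    and t: "t \<ge> 0"
  shows "((\<lambda>t. LINT x|M. v t x) has_real_derivative (LINT x|M. r t x)) (at t within {0..})"
  unfolding has_field_derivative_iff tendsto_at_iff_sequentially
proof (intro allI impI)
  fix X :: "nat \<Rightarrow> real"
  assume X: "\<forall>i. X i \<in> {0..} - {t}" and lim: "X \<longlonglongrightarrow> t"
  obtain T where T: "\<And>i. \<bar>X i\<bar> \<le> T"
    using convergent_imp_Bseq[OF convergentI[OF lim]] unfolding Bseq_def real_norm_def by blast
  define T' where "T' = max T t"
  obtain N where N: "\<And>s x. s \<in> {0..T'} \<Longrightarrow> x \<in> {0..1} \<Longrightarrow> \<bar>r s x\<bar> \<le> N"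
    using bound[of T'] by blast
  have mem: "X i \<in> {0..T'}" "X i \<noteq> t" for i
    using X T[of i] by (auto simp: T'_def le_max_iff_disj)
  have lip: "\<bar>v (X i) x - v t x\<bar> \<le> N * \<bar>X i - t\<bar>" if x: "x \<in> {0..1}" for i x
  proof -
    have "norm (v (X i) x - v t x) \<le> N * norm (X i - t)"
    proof (rule field_differentiable_bound[where S = "{0..T'}" and f' = "\<lambda>s. r s x"])
      fix s assume s: "s \<in> {0..T'}"
      show "((\<lambda>s. v s x) has_field_derivative r s x) (at s within {0..T'})"
        by (rule DERIV_subset[OF deriv[OF _ x]]) (use s in auto)
      show "norm (r s x) \<le> N" using N[OF s x] by simp
    qed (use mem t in \<open>auto simp: T'_def\<close>)
    then show ?thesis by simp
  qed
  have "(\<lambda>i. LINT x|M. (v (X i) x - v t x) / (X i - t)) \<longlonglongrightarrow> (LINT x|M. r t x)"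
  proof (rule integral_dominated_convergence[where w = "\<lambda>_. N"])
    show "AE x in M. (\<lambda>i. (v (X i) x - v t x) / (X i - t)) \<longlonglongrightarrow> r t x"
    proof (rule AE_I2)
      fix x assume "x \<in> space M"
      then have "x \<in> {0..1}" by (simp add: space_M)
      from deriv[OF t this] show "(\<lambda>i. (v (X i) x - v t x) / (X i - t)) \<longlonglongrightarrow> r t x"
        using X lim unfolding has_field_derivative_iff tendsto_at_iff_sequentially comp_def by blast
    qed
    show "AE x in M. norm ((v (X i) x - v t x) / (X i - t)) \<le> N" for i
    proof (rule AE_I2)
      fix x assume "x \<in> space M"
      then have "x \<in> {0..1}" by (simp add: space_M)
      from lip[OF this, of i] mem(2)[of i] show "norm ((v (X i) x - v t x) / (X i - t)) \<le> N"
        by (simp add: pos_divide_le_eq)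
    qed
    show "r t \<in> borel_measurable M" by (rule measurable_continuous_Icc[OF r[OF t]])
    show "(\<lambda>x. (v (X i) x - v t x) / (X i - t)) \<in> borel_measurable M" for i
      using measurable_continuous_Icc[OF v] mem(1)[of i] t by simp
  qed simp
  moreover have "(LINT x|M. (v (X i) x - v t x) / (X i - t))
      = ((LINT x|M. v (X i) x) - (LINT x|M. v t x)) / (X i - t)" for i
    using integrable_continuous_Icc[OF v] mem(1)[of i] t by simp
  ultimately show "((\<lambda>s. ((LINT x|M. v s x) - (LINT x|M. v t x)) / (s - t)) \<circ> X)
      \<longlonglongrightarrow> (LINT x|M. r t x)"
    unfolding comp_def by (simp only:)
qed

end

context transverse_kimura
begin

lemma continuous_dx:
  assumes "Ck 2 {0..1} u"
  shows "continuous_on {0..1} (dx u)"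
proof -
  obtain u1 where "continuous_on {0..1} u1" "\<And>x. x \<in> {0..1} \<Longrightarrow> dx u x = u1 x"
    using Ck2_closed[OF assms] by metis
  then show ?thesis using continuous_on_cong[of "{0..1}" "{0..1}" "dx u" u1] by auto
qed

lemma continuous_Ck2:
  assumes "Ck 2 {0..1} u"
  shows "continuous_on {0..1} u"
  using Ck2_closed[OF assms] by metis

lemma continuous_L:
  assumes "Ck 2 {0..1} u"
  shows "continuous_on {0..1} (L u)"
proof -
  obtain u2 where u2: "continuous_on {0..1} u2" "\<And>x. x \<in> {0..1} \<Longrightarrow> dx (dx u) x = u2 x"
    using Ck2_closed[OF assms] by metis
  have "continuous_on {0..1} (\<lambda>x. A x * u2 x + B x * dx u x)"
    by (intro continuous_intros cont_A cont_B u2(1) continuous_dx[OF assms])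
  then show ?thesis
    by (rule continuous_on_cong[THEN iffD1, rotated 2]) (auto simp: kimura_op_def u2(2))
qed

text \<open>Integration by parts: \<open>w L u = (p u')'\<close>, and the flux \<open>p u'\<close> of a function that is regular up to the
  boundary vanishes at the endpoints because \<open>p\<close> does.\<close>

lemma integral_L_by_parts:
  assumes u: "Ck 2 {0..1} u"
    and h: "\<And>x. x \<in> {0..1} \<Longrightarrow> (h has_real_derivative h1 x) (at x within {0..1})"
    and h1: "continuous_on {0..1} h1"
  shows "(LINT x|\<mu>. h x * L u x) = - (LINT x|\<mu>. A x * (h1 x * dx u x))"
proof -
  obtain u1 u2 where u12: "continuous_on {0..1} u1" "continuous_on {0..1} u2"
    "\<And>x. x \<in> {0..1} \<Longrightarrow> (u1 has_real_derivative u2 x) (at x within {0..1})"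
    "\<And>x. x \<in> {0..1} \<Longrightarrow> dx u x = u1 x" "\<And>x. x \<in> {0..1} \<Longrightarrow> dx (dx u) x = u2 x"
    by (rule Ck2_closed[OF u]) (rule that)
  have conth: "continuous_on {0..1} h" by (rule DERIV_continuous_on) (use h in auto)
  define k where "k x = h x * L u x + A x * (h1 x * dx u x)" for x
  have i1: "continuous_on {0..1} (\<lambda>x. h x * L u x)"
    and i2: "continuous_on {0..1} (\<lambda>x. A x * (h1 x * dx u x))"
    by (intro continuous_intros conth continuous_L[OF u] cont_A h1 continuous_dx[OF u])+
  have contk: "continuous_on {0..1} k" unfolding k_def by (intro continuous_on_add i1 i2)
  define G where "G x = p x * (u1 x * h x)" for x
  have contG: "continuous_on {0..1} (\<lambda>x. u1 x * h x)" by (intro continuous_intros u12 conth)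
  have "(LINT x|\<mu>. k x) = 0"
  proof (rule mu_integral_derivative_eq_0)
    fix x :: real assume x: "x \<in> {0<..<1}"
    have at: "at x within {0..1} = at x" using x by (intro at_within_interior) auto
    have du1: "(u1 has_real_derivative u2 x) (at x)" and dh: "(h has_real_derivative h1 x) (at x)"
      using u12(3)[of x] h[of x] x by (simp_all add: at)
    have "w x * k x = B x / A x * p x * (u1 x * h x) + p x * (u2 x * h x + u1 x * h1 x)"
      using A_pos[OF x] x u12(4,5)[of x]
      by (simp add: k_def w_eq kimura_op_def field_simps)
    moreover have "(G has_real_derivative
        B x / A x * p x * (u1 x * h x) + p x * (u2 x * h x + u1 x * h1 x)) (at x)"
      unfolding G_def
      by (rule derivative_eq_intros p_deriv[OF x] du1 dh refl | simp add: algebra_simps)+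
    ultimately show "(G has_real_derivative w x * k x) (at x)" by simp
  next
    have "((\<lambda>x. u1 x * h x) \<longlongrightarrow> u1 0 * h 0) (at_right 0)"
      using contG[unfolded continuous_on_def, rule_format, of 0] at_within_Icc_at_right[of 0 "1::real"]
      by simp
    from tendsto_mult[OF p_at_0 this] show "(G \<longlongrightarrow> 0) (at_right 0)" by (simp add: G_def[abs_def])
    have "((\<lambda>x. u1 x * h x) \<longlongrightarrow> u1 1 * h 1) (at_left 1)"
      using contG[unfolded continuous_on_def, rule_format, of 1] at_within_Icc_at_left[of 0 "1::real"]
      by simp
    from tendsto_mult[OF p_at_1 this] show "(G \<longlongrightarrow> 0) (at_left 1)" by (simp add: G_def[abs_def])
    show "continuous_on {0<..<1} k" by (rule continuous_on_subset[OF contk]) auto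
    show "integrable \<mu> k" by (rule mu.integrable_continuous_Icc[OF contk])
  qed
  then show ?thesis
    unfolding k_def using mu.integrable_continuous_Icc[OF i1] mu.integrable_continuous_Icc[OF i2]
    by simp
qed

lemma Ck1_interior_shift:
  assumes "Ck 2 {0..1} g"
  shows "Ck 1 {0<..<1} (\<lambda>x. g x - c)" "\<And>x. x \<in> {0..1} \<Longrightarrow> dx (\<lambda>x. g x - c) x = dx g x"
proof -
  have d: "(g has_real_derivative dx g x) (at x within {0..1})" if "x \<in> {0..1}" for x
    using Ck2_closed[OF assms] that by metis
  have d': "((\<lambda>x. g x - c) has_real_derivative dx g x) (at x within {0..1})" if "x \<in> {0..1}" for x
    using d[OF that] by (auto intro!: derivative_eq_intros)
  then show "dx (\<lambda>x. g x - c) x = dx g x" if "x \<in> {0..1}" for x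
    using dx_eq that by blast
  have d'': "((\<lambda>x. g x - c) has_real_derivative dx g x) (at x within {0<..<1})" if "x \<in> {0<..<1}" for x
    by (rule DERIV_subset[OF d']) (use that in auto)
  have "continuous_on {0<..<1} (dx g)"
    by (rule continuous_on_subset[OF continuous_dx[OF assms]]) auto
  then show "Ck 1 {0<..<1} (\<lambda>x. g x - c)"
    unfolding Ck_def using d''
    by (intro exI[of _ "\<lambda>n. if n = 0 then (\<lambda>x. g x - c) else dx g"]) auto
qed

lemma L_symmetric:
  assumes u: "Ck 2 {0..1} u" and v: "Ck 2 {0..1} v"
  shows "(LINT x|\<mu>. v x * L u x) = (LINT x|\<mu>. u x * L v x)"
proof -
  have d: "(f has_real_derivative dx f x) (at x within {0..1})" if "Ck 2 {0..1} f" "x \<in> {0..1}" for f x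
    using Ck2_closed[OF that(1)] that(2) by metis
  show ?thesis
    using integral_L_by_parts[OF u d[OF v] continuous_dx[OF v]]
      integral_L_by_parts[OF v d[OF u] continuous_dx[OF u]] by (simp add: mult_ac)
qed

abbreviation "solves \<equiv> cauchy_solution a b m0 m1"

context
  fixes f u
  assumes u: "solves f u"
begin

lemma solution_Ck2: "t \<ge> 0 \<Longrightarrow> Ck 2 {0..1} (u t)"
  using u by (simp add: cauchy_solution_def)

lemma solution_initial: "x \<in> {0..1} \<Longrightarrow> u 0 x = f x"
  using u by (simp add: cauchy_solution_def)

lemma solution_deriv: "t \<ge> 0 \<Longrightarrow> x \<in> {0..1} \<Longrightarrow>
    ((\<lambda>s. u s x) has_real_derivative L (u t) x) (at t within {0..})"
  using u by (simp add: cauchy_solution_def)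

lemma solution_L_bounded:
  obtains N where "N \<ge> 0" "\<And>t x. t \<in> {0..T} \<Longrightarrow> x \<in> {0..1} \<Longrightarrow> \<bar>L (u t) x\<bar> \<le> N"
proof -
  let ?F = "\<lambda>(t, x). L (u t) x"
  have "continuous_on ({0..T} \<times> {0..1}) ?F"
    using u unfolding cauchy_solution_def by (elim conjE, elim continuous_on_subset) auto
  from compact_imp_bounded[OF compact_continuous_image[OF this compact_Times[OF compact_Icc compact_Icc]]]
  obtain N where N: "\<forall>y\<in>?F ` ({0..T} \<times> {0..1}). norm y \<le> N"
    unfolding bounded_iff by blast
  show ?thesis
  proof (rule that[of "\<bar>N\<bar>"])
    fix t x :: real assume "t \<in> {0..T}" "x \<in> {0..1}"
    then have "\<bar>L (u t) x\<bar> \<le> N" using N by fastforce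
    then show "\<bar>L (u t) x\<bar> \<le> \<bar>N\<bar>" by simp
  qed simp
qed

lemma solution_bounded:
  obtains N where "N \<ge> 0" "\<And>t x. t \<in> {0..T} \<Longrightarrow> x \<in> {0..1} \<Longrightarrow> \<bar>u t x\<bar> \<le> N"
proof -
  obtain N where N: "N \<ge> 0" "\<And>t x. t \<in> {0..T} \<Longrightarrow> x \<in> {0..1} \<Longrightarrow> \<bar>L (u t) x\<bar> \<le> N"
    by (rule solution_L_bounded[of T]) (rule that)
  obtain J where J: "J \<ge> 0" "\<And>x. x \<in> {0..1} \<Longrightarrow> \<bar>u 0 x\<bar> \<le> J"
    by (rule bounded_continuous_Icc[OF continuous_Ck2[OF solution_Ck2[of 0]]]) auto
  show ?thesis
  proof (rule that[of "J + N * \<bar>T\<bar>"])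
    show "J + N * \<bar>T\<bar> \<ge> 0" using J N by simp
    fix t x :: real assume t: "t \<in> {0..T}" and x: "x \<in> {0..1}"
    have "norm (u t x - u 0 x) \<le> N * norm (t - 0)"
    proof (rule field_differentiable_bound[where S = "{0..T}" and f' = "\<lambda>s. L (u s) x"])
      fix s assume s: "s \<in> {0..T}"
      show "((\<lambda>s. u s x) has_field_derivative L (u s) x) (at s within {0..T})"
        by (rule DERIV_subset[OF solution_deriv[OF _ x]]) (use s in auto)
      show "norm (L (u s) x) \<le> N" using N(2)[OF s x] by simp
    qed (use t in auto)
    also have "\<dots> \<le> N * \<bar>T\<bar>" using N t by (intro mult_left_mono) auto
    finally show "\<bar>u t x\<bar> \<le> J + N * \<bar>T\<bar>" using J(2)[OF x] by (simp add: abs_le_iff)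
  qed
qed

text \<open>The chain rule in time followed by integration by parts against \<open>\<psi>' (u)\<close>. For convex \<open>\<psi>\<close> the right-hand side
  is nonpositive.\<close>

lemma solution_entropy:
  fixes \<psi> \<psi>' \<psi>'' :: "real \<Rightarrow> real"
  assumes \<psi>: "\<And>y. (\<psi> has_real_derivative \<psi>' y) (at y)"
    and \<psi>': "\<And>y. (\<psi>' has_real_derivative \<psi>'' y) (at y)" and \<psi>'': "continuous_on UNIV \<psi>''"
    and t: "t \<ge> 0"
  shows "((\<lambda>t. LINT x|\<mu>. \<psi> (u t x)) has_real_derivative
      - (LINT x|\<mu>. A x * (\<psi>'' (u t x) * (dx (u t) x)\<^sup>2))) (at t within {0..})"
proof -
  have cont: "continuous_on UNIV \<psi>" "continuous_on UNIV \<psi>'"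
    using \<psi> \<psi>' by (meson DERIV_continuous continuous_at_imp_continuous_on)+
  have comp: "continuous_on {0..1} (\<lambda>x. g (u s x))" if "s \<ge> 0" "continuous_on UNIV g"
    for g :: "real \<Rightarrow> real" and s
    using continuous_on_compose2[OF that(2) continuous_Ck2[OF solution_Ck2[OF that(1)]]] by simp
  have "((\<lambda>t. LINT x|\<mu>. \<psi> (u t x)) has_real_derivative
      (LINT x|\<mu>. \<psi>' (u t x) * L (u t) x)) (at t within {0..})"
  proof (rule mu.has_derivative_integral_parameter[OF _ _ _ _ t])
    fix s :: real assume s: "s \<ge> 0"
    show "continuous_on {0..1} (\<lambda>x. \<psi> (u s x))" by (rule comp[OF s cont(1)])
    show "continuous_on {0..1} (\<lambda>x. \<psi>' (u s x) * L (u s) x)"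
      by (intro continuous_intros comp[OF s cont(2)] continuous_L[OF solution_Ck2[OF s]])
    fix x :: real assume x: "x \<in> {0..1}"
    show "((\<lambda>s. \<psi> (u s x)) has_real_derivative \<psi>' (u s x) * L (u s) x) (at s within {0..})"
      by (rule DERIV_chain2[OF \<psi> solution_deriv[OF s x]])
  next
    fix T :: real
    obtain N where N: "N \<ge> 0" "\<And>t x. t \<in> {0..T} \<Longrightarrow> x \<in> {0..1} \<Longrightarrow> \<bar>L (u t) x\<bar> \<le> N"
      by (rule solution_L_bounded[of T]) (rule that)
    obtain J where J: "J \<ge> 0" "\<And>t x. t \<in> {0..T} \<Longrightarrow> x \<in> {0..1} \<Longrightarrow> \<bar>u t x\<bar> \<le> J"
      by (rule solution_bounded[of T]) (rule that)
    obtain I where I: "I \<ge> 0" "\<And>y. y \<in> {-J..J} \<Longrightarrow> \<bar>\<psi>' y\<bar> \<le> I"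
      by (rule bounded_continuous_Icc[OF continuous_on_subset[OF cont(2)], of "-J" J]) auto
    have "\<bar>\<psi>' (u t x) * L (u t) x\<bar> \<le> I * N" if "t \<in> {0..T}" "x \<in> {0..1}" for t x
      unfolding abs_mult using N(2)[OF that] J(2)[OF that] I
      by (intro mult_mono) (auto simp: abs_le_iff)
    then show "\<exists>N. \<forall>t\<in>{0..T}. \<forall>x\<in>{0..1}. \<bar>\<psi>' (u t x) * L (u t) x\<bar> \<le> N" by blast
  qed
  also have "(LINT x|\<mu>. \<psi>' (u t x) * L (u t) x)
      = - (LINT x|\<mu>. A x * ((\<psi>'' (u t x) * dx (u t) x) * dx (u t) x))"
  proof (rule integral_L_by_parts[OF solution_Ck2[OF t]])
    show "continuous_on {0..1} (\<lambda>x. \<psi>'' (u t x) * dx (u t) x)"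
      by (intro continuous_intros comp[OF t \<psi>''] continuous_dx[OF solution_Ck2[OF t]])
    fix x :: real assume x: "x \<in> {0..1}"
    have "(u t has_real_derivative dx (u t) x) (at x within {0..1})"
      using Ck2_closed[OF solution_Ck2[OF t]] x by metis
    from DERIV_chain2[OF \<psi>' this]
    show "((\<lambda>x. \<psi>' (u t x)) has_real_derivative \<psi>'' (u t x) * dx (u t) x) (at x within {0..1})" .
  qed
  finally show ?thesis by (simp add: power2_eq_square mult_ac)
qed

lemma solution_entropy_decreasing:
  fixes \<psi> \<psi>' \<psi>'' :: "real \<Rightarrow> real"
  assumes \<psi>: "\<And>y. (\<psi> has_real_derivative \<psi>' y) (at y)"
    "\<And>y. (\<psi>' has_real_derivative \<psi>'' y) (at y)" "continuous_on UNIV \<psi>''"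
    and convex: "\<And>y. \<psi>'' y \<ge> 0" and t: "t \<ge> 0"
  shows "(LINT x|\<mu>. \<psi> (u t x)) \<le> (LINT x|\<mu>. \<psi> (u 0 x))"
proof (rule nonincreasing_from_0[OF solution_entropy[OF \<psi>] _ t])
  fix s :: real
  have "AE x in \<mu>. 0 \<le> A x * (\<psi>'' (u s x) * (dx (u s) x)\<^sup>2)"
    using A_nonneg convex by (auto intro!: AE_I2 simp: mu.space_M)
  from integral_nonneg_AE[OF this]
  show "- (LINT x|\<mu>. A x * (\<psi>'' (u s x) * (dx (u s) x)\<^sup>2)) \<le> 0" by simp
qed

text \<open>Both \<open>y\<close> and \<open>- y\<close> are convex entropies.\<close>

lemma solution_mass: "t \<ge> 0 \<Longrightarrow> (LINT x|\<mu>. u t x) = (LINT x|\<mu>. f x)"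
proof -
  assume t: "t \<ge> 0"
  have "(LINT x|\<mu>. u t x) \<le> (LINT x|\<mu>. u 0 x)"
    by (rule solution_entropy_decreasing[where \<psi> = "\<lambda>y. y" and \<psi>' = "\<lambda>_. 1" and \<psi>'' = "\<lambda>_. 0"])
       (use t in \<open>auto intro!: derivative_eq_intros\<close>)
  moreover have "(LINT x|\<mu>. - u t x) \<le> (LINT x|\<mu>. - u 0 x)"
    by (rule solution_entropy_decreasing[where \<psi> = "\<lambda>y. - y" and \<psi>' = "\<lambda>_. - 1" and \<psi>'' = "\<lambda>_. 0"])
       (use t in \<open>auto intro!: derivative_eq_intros\<close>)
  moreover have "(LINT x|\<mu>. u 0 x) = (LINT x|\<mu>. f x)"
    by (rule Bochner_Integration.integral_cong) (auto simp: mu.space_M solution_initial)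
  ultimately show ?thesis by simp
qed

text \<open>Gronwall: with \<open>E\<close> the variance, \<open>E' = - D\<close> and the Poincare inequality \<open>E \<le> C D\<close> make
  \<open>exp (t / C) * E t\<close> nonincreasing. The square root halves the rate.\<close>

lemma solution_decay:
  assumes C: "poincare_const C" and t: "t \<ge> 0"
  shows "l2norm \<mu> (\<lambda>x. u t x - (LINT y|\<mu>. f y))
      \<le> exp (- t / (2 * C)) * l2norm \<mu> (\<lambda>x. f x - (LINT y|\<mu>. f y))"
proof -
  define m where "m = (LINT y|\<mu>. f y)"
  define E where "E t = (LINT x|\<mu>. (u t x - m)\<^sup>2)" for t
  define D where "D t = (LINT x|\<mu>. A x * (2 * (dx (u t) x)\<^sup>2))" for t
  have C0: "C > 0" by (rule poincare_const_pos[OF C])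
  have E': "(E has_real_derivative - D t) (at t within {0..})" if "t \<ge> 0" for t
    unfolding E_def[abs_def] D_def
    by (rule solution_entropy[where \<psi> = "\<lambda>y. (y - m)\<^sup>2" and \<psi>' = "\<lambda>y. 2 * (y - m)" and \<psi>'' = "\<lambda>_. 2"])
       (use that in \<open>auto intro!: derivative_eq_intros\<close>)
  have PI: "E t \<le> C * D t" if t: "t \<ge> 0" for t
  proof -
    note k = solution_Ck2[OF t]
    let ?g = "\<lambda>x. u t x - m"
    have g: "(grad_z a m0 m1 ?g x)\<^sup>2 = A x * (2 * (dx (u t) x)\<^sup>2)" if "x \<in> {0..1}" for x
      using grad_z_sq[OF that] Ck1_interior_shift(2)[OF k that] by simp
    have contg: "continuous_on {0..1} ?g" by (intro continuous_intros continuous_Ck2[OF k])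
    have cont2: "continuous_on {0..1} (\<lambda>x. A x * (2 * (dx (u t) x)\<^sup>2))"
      by (intro continuous_intros cont_A continuous_dx[OF k])
    have int: "integrable \<mu> (\<lambda>x. (grad_z a m0 m1 ?g x)\<^sup>2)"
      using mu.integrable_continuous_Icc[OF cont2]
      by (subst Bochner_Integration.integrable_cong[OF refl, of _ _ "\<lambda>x. A x * (2 * (dx (u t) x)\<^sup>2)"])
         (auto simp: mu.space_M g)
    have eq: "(LINT x|\<mu>. (grad_z a m0 m1 ?g x)\<^sup>2) = D t"
      unfolding D_def by (rule Bochner_Integration.integral_cong) (auto simp: mu.space_M g)
    have "(LINT x|\<mu>. ?g x) = 0"
      using mu.integrable_continuous_Icc[OF continuous_Ck2[OF k]] solution_mass[OF t]
      by (simp add: m_def mu.prob_space)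
    then have "(LINT x|\<mu>. (?g x)\<^sup>2) \<le> C * (LINT x|\<mu>. (grad_z a m0 m1 ?g x)\<^sup>2)"
      using C Ck1_interior_shift(1)[OF k] mu.L2_continuous[OF contg] int
      unfolding poincare_const_def by blast
    then show ?thesis by (simp add: eq E_def)
  qed
  have "exp (t / C) * E t \<le> exp (0 / C) * E 0"
  proof (rule nonincreasing_from_0[OF _ _ t])
    fix s :: real assume s: "s \<ge> 0"
    show "((\<lambda>s. exp (s / C) * E s) has_real_derivative exp (s / C) * (E s / C - D s)) (at s within {0..})"
      by (rule derivative_eq_intros E'[OF s] refl | use C0 in \<open>simp add: field_simps\<close>)+
    have "E s / C - D s \<le> 0" using PI[OF s] C0 by (simp add: field_simps)
    then show "exp (s / C) * (E s / C - D s) \<le> 0" by (simp add: mult_nonneg_nonpos)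
  qed
  then have "E t \<le> exp (- t / C) * E 0"
    by (simp add: exp_minus field_simps)
  also have "E 0 = (LINT x|\<mu>. (f x - m)\<^sup>2)"
    unfolding E_def
    by (rule Bochner_Integration.integral_cong) (auto simp: mu.space_M solution_initial)
  finally have "sqrt (E t) \<le> sqrt (exp (- t / C) * (LINT x|\<mu>. (f x - m)\<^sup>2))"
    by (rule real_sqrt_le_mono)
  also have "exp (- t / C) = (exp (- t / (2 * C)))\<^sup>2"
    by (simp add: exp_double[symmetric])
  finally show ?thesis
    by (simp add: real_sqrt_mult l2norm_def E_def m_def)
qed

text \<open>The mean value theorem in time, combined with the symmetry of \<open>L\<close>, moves \<open>L\<close> to the test function. What
  remains of \<open>u\<close> is its value at an intermediate time, which is stable under \<open>L\<^sup>2\<close> limits of the data.\<close>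

lemma solution_weak:
  assumes v: "Ck 2 {0..1} v" and t: "t > 0"
  obtains s where "0 < s" "s < t"
    "(LINT x|\<mu>. u t x * v x) - (LINT x|\<mu>. f x * v x) = t * (LINT x|\<mu>. u s x * L v x)"
proof -
  define F where "F t = (LINT x|\<mu>. u t x * v x)" for t
  have F: "(F has_real_derivative (LINT x|\<mu>. L (u s) x * v x)) (at s within {0..})" if "s \<ge> 0" for s
    unfolding F_def[abs_def]
  proof (rule mu.has_derivative_integral_parameter[OF _ _ _ _ that])
    fix s :: real assume s: "s \<ge> 0"
    show "continuous_on {0..1} (\<lambda>x. u s x * v x)" "continuous_on {0..1} (\<lambda>x. L (u s) x * v x)"
      by (intro continuous_intros continuous_Ck2 v solution_Ck2 continuous_L s)+
    fix x :: real assume x: "x \<in> {0..1}"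
    show "((\<lambda>s. u s x * v x) has_real_derivative L (u s) x * v x) (at s within {0..})"
      by (rule DERIV_cmult_right[OF solution_deriv[OF s x]])
  next
    fix T :: real
    obtain N where N: "N \<ge> 0" "\<And>t x. t \<in> {0..T} \<Longrightarrow> x \<in> {0..1} \<Longrightarrow> \<bar>L (u t) x\<bar> \<le> N"
      by (rule solution_L_bounded[of T]) (rule that)
    obtain J where J: "J \<ge> 0" "\<And>x. x \<in> {0..1} \<Longrightarrow> \<bar>v x\<bar> \<le> J"
      by (rule bounded_continuous_Icc[OF continuous_Ck2[OF v]]) (rule that)
    have "\<bar>L (u t) x * v x\<bar> \<le> N * J" if "t \<in> {0..T}" "x \<in> {0..1}" for t x
      unfolding abs_mult using N(2)[OF that] J(2)[OF that(2)] N(1) by (intro mult_mono) auto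
    then show "\<exists>N. \<forall>t\<in>{0..T}. \<forall>x\<in>{0..1}. \<bar>L (u t) x * v x\<bar> \<le> N" by blast
  qed
  have "continuous_on {0..} F" by (rule DERIV_continuous_on) (use F in auto)
  then have "continuous_on {0..t} F" by (rule continuous_on_subset) auto
  moreover have "(F has_derivative (\<lambda>h. (LINT x|\<mu>. L (u s) x * v x) * h)) (at s)" if "0 < s" "s < t" for s
    using F[of s] that at_within_interior[of s "{0..}"]
    by (simp add: has_field_derivative_def)
  ultimately obtain s where s: "0 < s" "s < t" "F t - F 0 = (LINT x|\<mu>. L (u s) x * v x) * (t - 0)"
    using mvt[OF t, of F "\<lambda>s h. (LINT x|\<mu>. L (u s) x * v x) * h"] by blast
  have "(LINT x|\<mu>. L (u s) x * v x) = (LINT x|\<mu>. u s x * L v x)"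
    using L_symmetric[OF solution_Ck2 v, of s] s(1) by (simp add: mult.commute)
  moreover have "F 0 = (LINT x|\<mu>. f x * v x)"
    unfolding F_def
    by (rule Bochner_Integration.integral_cong) (auto simp: mu.space_M solution_initial)
  ultimately show ?thesis
    using that[OF s(1,2)] s(3) by (simp add: F_def mult.commute)
qed

end

end

section \<open>The semigroup on square integrable functions\<close>

locale kimura_semigroup = transverse_kimura +
  fixes Q :: "real \<Rightarrow> (real \<Rightarrow> real) \<Rightarrow> real \<Rightarrow> real"
  assumes semigroup: "solution_semigroup a b m0 m1 Q"
begin

lemma Q_L2: "t \<ge> 0 \<Longrightarrow> f \<in> L2 \<mu> \<Longrightarrow> Q t f \<in> L2 \<mu>"
  using semigroup by (simp add: solution_semigroup_def bounded_linear_L2_def)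

lemma Q_lincomb: "t \<ge> 0 \<Longrightarrow> f \<in> L2 \<mu> \<Longrightarrow> g \<in> L2 \<mu> \<Longrightarrow>
    AE x in \<mu>. Q t (\<lambda>y. c * f y + d * g y) x = c * Q t f x + d * Q t g x"
  using semigroup by (simp add: solution_semigroup_def bounded_linear_L2_def)

lemma Q_diff:
  assumes t: "t \<ge> 0" and f: "f \<in> L2 \<mu>" and g: "g \<in> L2 \<mu>"
  shows "l2norm \<mu> (\<lambda>x. Q t f x - Q t g x) = l2norm \<mu> (Q t (\<lambda>x. f x - g x))"
proof (rule l2norm_cong_AE)
  show "AE x in \<mu>. Q t f x - Q t g x = Q t (\<lambda>x. f x - g x) x"
    using Q_lincomb[OF assms, of 1 "-1"] by eventually_elim simp
qed (use L2_D(1)[OF Q_L2[OF t f]] L2_D(1)[OF Q_L2[OF t g]] L2_D(1)[OF Q_L2[OF t L2_diff[OF f g]]]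
      in auto)

lemma Q_continuous:
  assumes t: "t \<ge> 0"
  obtains K where "K \<ge> 0"
    "\<forall>f\<in>L2 \<mu>. \<forall>g\<in>L2 \<mu>. l2norm \<mu> (\<lambda>x. Q t f x - Q t g x) \<le> K * l2norm \<mu> (\<lambda>x. f x - g x)"
proof -
  obtain K where K: "\<forall>f\<in>L2 \<mu>. l2norm \<mu> (Q t f) \<le> K * l2norm \<mu> f"
    using semigroup t unfolding solution_semigroup_def bounded_linear_L2_def by blast
  show ?thesis
  proof (rule that[of "\<bar>K\<bar>"]; (intro ballI)?)
    fix f g assume fg: "f \<in> L2 \<mu>" "g \<in> L2 \<mu>"
    have "l2norm \<mu> (\<lambda>x. Q t f x - Q t g x) \<le> K * l2norm \<mu> (\<lambda>x. f x - g x)"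
      unfolding Q_diff[OF t fg] using K L2_diff[OF fg] by blast
    also have "\<dots> \<le> \<bar>K\<bar> * l2norm \<mu> (\<lambda>x. f x - g x)" by (intro mult_right_mono) auto
    finally show "l2norm \<mu> (\<lambda>x. Q t f x - Q t g x) \<le> \<bar>K\<bar> * l2norm \<mu> (\<lambda>x. f x - g x)" .
  qed simp
qed

lemma Q_poly:
  obtains u where "solves (poly q) u" "\<forall>t\<ge>0. AE x in \<mu>. Q t (poly q) x = u t x"
  using semigroup Cinf_poly unfolding solution_semigroup_def by blast

lemma integral_diff_le_l2norm:
  assumes "f \<in> L2 \<mu>" "g \<in> L2 \<mu>"
  shows "\<bar>(LINT x|\<mu>. f x) - (LINT x|\<mu>. g x)\<bar> \<le> l2norm \<mu> (\<lambda>x. f x - g x)"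
  using mu.abs_integral_le_l2norm[OF L2_diff[OF assms]]
  by (simp add: mu.L2_integrable[OF assms(1)] mu.L2_integrable[OF assms(2)])

lemma Q_poly_solution:
  assumes t: "t \<ge> 0" and u: "solves (poly q) u" "\<forall>t\<ge>0. AE x in \<mu>. Q t (poly q) x = u t x"
  shows "u t \<in> L2 \<mu>" "AE x in \<mu>. Q t (poly q) x = u t x"
    "Q t (poly q) \<in> borel_measurable \<mu>" "u t \<in> borel_measurable \<mu>"
  using mu.L2_continuous[OF continuous_Ck2[OF solution_Ck2[OF u(1) t]]] u(2) t
    L2_D(1)[OF Q_L2[OF t mu.poly_L2]] L2_D(1) by auto

lemma Q_mass:
  assumes t: "t \<ge> 0" and f: "f \<in> L2 \<mu>"
  shows "(LINT x|\<mu>. Q t f x) = (LINT x|\<mu>. f x)"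
proof -
  obtain K where K: "K \<ge> 0"
    "\<forall>f\<in>L2 \<mu>. \<forall>g\<in>L2 \<mu>. l2norm \<mu> (\<lambda>x. Q t f x - Q t g x) \<le> K * l2norm \<mu> (\<lambda>x. f x - g x)"
    by (rule Q_continuous[OF t]) (rule that)
  have "\<bar>(LINT x|\<mu>. Q t f x) - (LINT x|\<mu>. f x)\<bar> \<le> 0"
  proof (rule le_from_approx)
    fix e :: real assume "e > 0"
    then obtain q where q: "l2norm \<mu> (\<lambda>x. f x - poly q x) < e"
      using mu.L2_polynomial_approximation[OF f] by blast
    obtain u where u: "solves (poly q) u" "\<forall>t\<ge>0. AE x in \<mu>. Q t (poly q) x = u t x"
      by (rule Q_poly) (rule that)
    have "(LINT x|\<mu>. Q t (poly q) x) = (LINT x|\<mu>. u t x)"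
      using Q_poly_solution[OF t u] by (intro integral_cong_AE) auto
    then have "(LINT x|\<mu>. Q t (poly q) x) = (LINT x|\<mu>. poly q x)"
      using solution_mass[OF u(1) t] by simp
    moreover have "\<bar>(LINT x|\<mu>. Q t f x) - (LINT x|\<mu>. Q t (poly q) x)\<bar> \<le> K * e"
    proof -
      have "\<bar>(LINT x|\<mu>. Q t f x) - (LINT x|\<mu>. Q t (poly q) x)\<bar>
          \<le> l2norm \<mu> (\<lambda>x. Q t f x - Q t (poly q) x)"
        by (intro integral_diff_le_l2norm Q_L2 t f mu.poly_L2)
      also have "\<dots> \<le> K * l2norm \<mu> (\<lambda>x. f x - poly q x)" using K(2) f mu.poly_L2 by blast
      also have "\<dots> \<le> K * e" using q K(1) by (intro mult_left_mono) auto
      finally show ?thesis .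
    qed
    moreover have "\<bar>(LINT x|\<mu>. f x) - (LINT x|\<mu>. poly q x)\<bar> \<le> e"
      using integral_diff_le_l2norm[OF f mu.poly_L2, of q] q by simp
    ultimately show "\<bar>(LINT x|\<mu>. Q t f x) - (LINT x|\<mu>. f x)\<bar> \<le> 0 + (K + 1) * e"
      by (simp add: algebra_simps)
  qed (use K in simp)
  then show ?thesis by simp
qed

lemma Q_decay:
  assumes C: "poincare_const C" and t: "t \<ge> 0" and f: "f \<in> L2 \<mu>"
  shows "l2norm \<mu> (\<lambda>x. Q t f x - (LINT y|\<mu>. f y))
      \<le> exp (- t / (2 * C)) * l2norm \<mu> (\<lambda>x. f x - (LINT y|\<mu>. f y))"
proof -
  define r where "r = exp (- t / (2 * C))"
  have r: "r \<ge> 0" "r \<le> 1" using poincare_const_pos[OF C] t by (auto simp: r_def)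
  obtain K where K: "K \<ge> 0"
    "\<forall>f\<in>L2 \<mu>. \<forall>g\<in>L2 \<mu>. l2norm \<mu> (\<lambda>x. Q t f x - Q t g x) \<le> K * l2norm \<mu> (\<lambda>x. f x - g x)"
    by (rule Q_continuous[OF t]) (rule that)
  define m where "m = (LINT y|\<mu>. f y)"
  have "l2norm \<mu> (\<lambda>x. Q t f x - m) \<le> r * l2norm \<mu> (\<lambda>x. f x - m)"
  proof (rule le_from_approx)
    fix e :: real assume "e > 0"
    then obtain q where q: "l2norm \<mu> (\<lambda>x. f x - poly q x) < e"
      using mu.L2_polynomial_approximation[OF f] by blast
    obtain u where u: "solves (poly q) u" "\<forall>t\<ge>0. AE x in \<mu>. Q t (poly q) x = u t x"
      by (rule Q_poly) (rule that)
    define n where "n = (LINT y|\<mu>. poly q y)"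
    have mn: "l2norm \<mu> (\<lambda>_. n - m) \<le> e" "l2norm \<mu> (\<lambda>_. m - n) \<le> e"
      using integral_diff_le_l2norm[OF f mu.poly_L2, of q] q
      by (auto simp: mu.l2norm_const m_def n_def abs_minus_commute)
    note L = Q_L2[OF t f] Q_L2[OF t mu.poly_L2] f mu.poly_L2 mu.L2_const
    have "l2norm \<mu> (\<lambda>x. Q t (poly q) x - n) = l2norm \<mu> (\<lambda>x. u t x - n)"
      using Q_poly_solution[OF t u] by (intro l2norm_cong_AE) auto
    also have "\<dots> \<le> r * l2norm \<mu> (\<lambda>x. poly q x - n)"
      unfolding r_def n_def by (rule solution_decay[OF u(1) C t])
    finally have 1: "l2norm \<mu> (\<lambda>x. Q t (poly q) x - n) \<le> r * l2norm \<mu> (\<lambda>x. poly q x - n)" .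
    have "l2norm \<mu> (\<lambda>x. poly q x - n) \<le> l2norm \<mu> (\<lambda>x. poly q x - f x) + l2norm \<mu> (\<lambda>x. f x - n)"
      by (rule l2norm_triangle3[OF L(4,5,3)])
    also have "l2norm \<mu> (\<lambda>x. f x - n) \<le> l2norm \<mu> (\<lambda>x. f x - m) + l2norm \<mu> (\<lambda>_. m - n)"
      by (rule l2norm_triangle3[OF L(3,5,5)])
    finally have "l2norm \<mu> (\<lambda>x. poly q x - n) \<le> l2norm \<mu> (\<lambda>x. f x - m) + 2 * e"
      using q mn(2) l2norm_minus_commute[of \<mu> f "poly q"] by simp
    then have "r * l2norm \<mu> (\<lambda>x. poly q x - n) \<le> r * (l2norm \<mu> (\<lambda>x. f x - m) + 2 * e)"
      using r by (intro mult_left_mono)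
    also have "\<dots> \<le> r * l2norm \<mu> (\<lambda>x. f x - m) + 2 * e"
      using r \<open>e > 0\<close> by (simp add: algebra_simps)
    finally have 2: "l2norm \<mu> (\<lambda>x. Q t (poly q) x - n) \<le> r * l2norm \<mu> (\<lambda>x. f x - m) + 2 * e"
      using 1 by simp
    have "l2norm \<mu> (\<lambda>x. Q t f x - m) \<le>
        l2norm \<mu> (\<lambda>x. Q t f x - Q t (poly q) x) + l2norm \<mu> (\<lambda>x. Q t (poly q) x - m)"
      by (rule l2norm_triangle3[OF L(1,5,2)])
    also have "l2norm \<mu> (\<lambda>x. Q t (poly q) x - m)
        \<le> l2norm \<mu> (\<lambda>x. Q t (poly q) x - n) + l2norm \<mu> (\<lambda>_. n - m)"
      by (rule l2norm_triangle3[OF L(2,5,5)])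
    also have "l2norm \<mu> (\<lambda>x. Q t f x - Q t (poly q) x) \<le> K * e"
    proof -
      have "l2norm \<mu> (\<lambda>x. Q t f x - Q t (poly q) x) \<le> K * l2norm \<mu> (\<lambda>x. f x - poly q x)"
        using K(2) L by blast
      also have "\<dots> \<le> K * e" using q K(1) by (intro mult_left_mono) auto
      finally show ?thesis .
    qed
    finally show "l2norm \<mu> (\<lambda>x. Q t f x - m) \<le> r * l2norm \<mu> (\<lambda>x. f x - m) + (K + 3) * e"
      using 2 mn(1) by (simp add: algebra_simps)
  qed (use K in simp)
  then show ?thesis by (simp add: m_def r_def)
qed

text \<open>A bound that is uniform in time, which boundedness of each single \<open>Q t\<close> does not give. The crude
  constant \<open>2\<close> comes from treating the mean and the deviation from it separately.\<close>

lemma Q_norm: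
  assumes t: "t \<ge> 0" and f: "f \<in> L2 \<mu>"
  shows "l2norm \<mu> (Q t f) \<le> 2 * l2norm \<mu> f"
proof -
  obtain C where C: "poincare_const C" using ex_poincare_const by blast
  define m where "m = (LINT y|\<mu>. f y)"
  have "l2norm \<mu> (Q t f) \<le> l2norm \<mu> (\<lambda>x. Q t f x - m) + l2norm \<mu> (\<lambda>_. m - 0)"
    using l2norm_triangle3[OF Q_L2[OF t f] mu.L2_const[of 0] mu.L2_const[of m]] by simp
  also have "l2norm \<mu> (\<lambda>_. m - 0) \<le> l2norm \<mu> f"
    using mu.abs_integral_le_l2norm[OF f] by (simp add: mu.l2norm_const m_def)
  also have "l2norm \<mu> (\<lambda>x. Q t f x - m) \<le> exp (- t / (2 * C)) * l2norm \<mu> (\<lambda>x. f x - m)"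
    unfolding m_def by (rule Q_decay[OF C t f])
  also have "\<dots> \<le> 1 * l2norm \<mu> (\<lambda>x. f x - m)"
    using poincare_const_pos[OF C] t by (intro mult_right_mono) auto
  also have "1 * l2norm \<mu> (\<lambda>x. f x - m) \<le> l2norm \<mu> f"
    using mu.l2norm_centered_le[OF f] by (simp add: m_def)
  finally show ?thesis by simp
qed

lemma Q_diff_norm:
  assumes "t \<ge> 0" "f \<in> L2 \<mu>" "g \<in> L2 \<mu>"
  shows "l2norm \<mu> (\<lambda>x. Q t f x - Q t g x) \<le> 2 * l2norm \<mu> (\<lambda>x. f x - g x)"
  unfolding Q_diff[OF assms] by (rule Q_norm[OF assms(1) L2_diff[OF assms(2,3)]])

text \<open>The function \<open>\<psi> y = s - arctan s\<close> with \<open>s = max 0 (- y)\<close> is convex, of class \<open>C\<^sup>2\<close>, and vanishes exactly for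
  \<open>y \<ge> 0\<close>, so that \<open>\<integral> \<psi> (Q t f) d\<mu> = 0\<close> means positivity. It is also Lipschitz, hence the entropy inequality
  passes from polynomials to \<open>f\<close>; the approximating polynomials may take negative values.\<close>

lemma Q_nonneg:
  assumes t: "t \<ge> 0" and f: "f \<in> L2 \<mu>" and pos: "AE x in \<mu>. f x \<ge> 0"
  shows "AE x in \<mu>. Q t f x \<ge> 0"
proof -
  define g g1 g2 :: "real \<Rightarrow> real"
    where "g s = s - arctan s" and "g1 s = 1 - 1 / (1 + s\<^sup>2)" and "g2 s = 2 * s / (1 + s\<^sup>2)\<^sup>2" for s
  have pos1: "1 + s\<^sup>2 > 0" for s :: real by (simp add: add_pos_nonneg)
  have ne: "1 + s\<^sup>2 \<noteq> 0" for s :: real using pos1[of s] by linarith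
  have dg: "(g has_real_derivative g1 s) (at s)" for s
    unfolding g_def g1_def by (auto intro!: derivative_eq_intros simp: inverse_eq_divide)
  have dg1: "(g1 has_real_derivative g2 s) (at s)" for s
    unfolding g1_def g2_def using ne[of s]
    by (auto intro!: derivative_eq_intros simp: power2_eq_square)
  define \<psi> where "\<psi> y = g (max 0 (- y))" for y
  have d\<psi>: "(\<psi> has_real_derivative - g1 (max 0 (- y))) (at y)" for y
  proof -
    have "((\<lambda>y. g (max 0 y)) has_real_derivative g1 (max 0 (- y))) (at (- y))"
      by (rule has_derivative_positive_part[OF dg]) (auto simp: g_def g1_def)
    then have "((\<lambda>y. g (max 0 (- y))) has_real_derivative g1 (max 0 (- y)) * (- 1)) (at y)"
      by (rule DERIV_chain2) (auto intro!: derivative_eq_intros)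
    then show ?thesis by (simp add: \<psi>_def[abs_def])
  qed
  have d\<psi>1: "((\<lambda>y. - g1 (max 0 (- y))) has_real_derivative g2 (max 0 (- y))) (at y)" for y
  proof -
    have "((\<lambda>y. g1 (max 0 y)) has_real_derivative g2 (max 0 (- y))) (at (- y))"
      by (rule has_derivative_positive_part[OF dg1]) (auto simp: g1_def g2_def)
    then have "((\<lambda>y. g1 (max 0 (- y))) has_real_derivative g2 (max 0 (- y)) * (- 1)) (at y)"
      by (rule DERIV_chain2) (auto intro!: derivative_eq_intros)
    from DERIV_minus[OF this] show ?thesis by simp
  qed
  have cont2: "continuous_on UNIV (\<lambda>y. g2 (max 0 (- y)))"
    unfolding g2_def using ne by (intro continuous_intros) auto
  have g1_bound: "0 \<le> g1 s" "g1 s \<le> 1" for s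
    using pos1[of s] by (auto simp: g1_def divide_le_eq_1)
  have lip: "\<bar>\<psi> y - \<psi> z\<bar> \<le> \<bar>y - z\<bar>" for y z
  proof -
    have "norm (\<psi> y - \<psi> z) \<le> 1 * norm (y - z)"
      by (rule field_differentiable_bound[where S = UNIV and f' = "\<lambda>y. - g1 (max 0 (- y))"])
         (use d\<psi> g1_bound in auto)
    then show ?thesis by simp
  qed
  have \<psi>0: "\<psi> y = 0" if "y \<ge> 0" for y using that by (simp add: \<psi>_def g_def)
  have \<psi>pos: "\<psi> y > 0" if "y < 0" for y
  proof -
    have "g 0 < g (- y)"
    proof (rule DERIV_pos_imp_increasing_open[where f = g and a = 0 and b = "- y"])
      show "0 < - y" using that by simp
      fix x :: real assume "0 < x"
      then have "g1 x > 0" using pos1[of x] by (simp add: g1_def)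
      then show "\<exists>D. (g has_real_derivative D) (at x) \<and> 0 < D" using dg by blast
    qed (use dg in \<open>meson DERIV_continuous continuous_at_imp_continuous_on\<close>)
    then show ?thesis using that by (simp add: \<psi>_def g_def)
  qed
  have \<psi>nn: "\<psi> y \<ge> 0" for y using \<psi>0[of y] \<psi>pos[of y] by (cases "y \<ge> 0") auto
  have \<psi>m: "(\<lambda>x. \<psi> (F x)) \<in> borel_measurable \<mu>" if "F \<in> L2 \<mu>" for F
  proof -
    have "\<psi> \<in> borel_measurable borel"
      using d\<psi> by (intro borel_measurable_continuous_onI) (meson DERIV_continuous continuous_at_imp_continuous_on)
    then show ?thesis using L2_D(1)[OF that] by simp
  qed
  have \<psi>int: "integrable \<mu> (\<lambda>x. \<psi> (F x))" if F: "F \<in> L2 \<mu>" for F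
  proof (rule Bochner_Integration.integrable_bound[OF mu.L2_integrable[OF F] \<psi>m[OF F]])
    show "AE x in \<mu>. norm (\<psi> (F x)) \<le> norm (F x)"
      using lip[of _ 0] \<psi>0[of 0] by (auto intro!: AE_I2)
  qed
  have cont: "(LINT x|\<mu>. \<psi> (F x)) \<le> (LINT x|\<mu>. \<psi> (G x)) + l2norm \<mu> (\<lambda>x. F x - G x)"
    if F: "F \<in> L2 \<mu>" and G: "G \<in> L2 \<mu>" for F G
  proof -
    have "(\<lambda>x. \<bar>F x - G x\<bar>) \<in> L2 \<mu>"
      using L2_D[OF L2_diff[OF F G]] by (simp add: L2_def)
    note D = this
    have "(LINT x|\<mu>. \<psi> (F x)) \<le> (LINT x|\<mu>. \<psi> (G x) + \<bar>F x - G x\<bar>)"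
    proof (rule integral_mono)
      fix x show "\<psi> (F x) \<le> \<psi> (G x) + \<bar>F x - G x\<bar>" using lip[of "F x" "G x"] by linarith
    qed (use \<psi>int[OF F] \<psi>int[OF G] mu.L2_integrable[OF D] in auto)
    also have "\<dots> = (LINT x|\<mu>. \<psi> (G x)) + (LINT x|\<mu>. \<bar>F x - G x\<bar>)"
      using \<psi>int[OF G] mu.L2_integrable[OF D] by simp
    also have "(LINT x|\<mu>. \<bar>F x - G x\<bar>) \<le> l2norm \<mu> (\<lambda>x. F x - G x)"
      using mu.abs_integral_le_l2norm[OF D] by (simp add: l2norm_def)
    finally show ?thesis by simp
  qed
  have "(LINT x|\<mu>. \<psi> (Q t f x)) \<le> (LINT x|\<mu>. \<psi> (f x))"
  proof (rule le_from_approx)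
    fix e :: real assume "e > 0"
    then obtain q where q: "l2norm \<mu> (\<lambda>x. f x - poly q x) < e"
      using mu.L2_polynomial_approximation[OF f] by blast
    obtain u where u: "solves (poly q) u" "\<forall>t\<ge>0. AE x in \<mu>. Q t (poly q) x = u t x"
      by (rule Q_poly) (rule that)
    note Qs = Q_poly_solution[OF t u]
    have "(LINT x|\<mu>. \<psi> (Q t f x)) \<le>
        (LINT x|\<mu>. \<psi> (Q t (poly q) x)) + l2norm \<mu> (\<lambda>x. Q t f x - Q t (poly q) x)"
      by (intro cont Q_L2 t f mu.poly_L2)
    also have "l2norm \<mu> (\<lambda>x. Q t f x - Q t (poly q) x) \<le> 2 * e"
      using Q_diff_norm[OF t f mu.poly_L2, of q] q by simp
    also have "(LINT x|\<mu>. \<psi> (Q t (poly q) x)) = (LINT x|\<mu>. \<psi> (u t x))"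
      using Qs(2) by (intro integral_cong_AE \<psi>m Qs(1) Q_L2 t mu.poly_L2) auto
    also have "\<dots> \<le> (LINT x|\<mu>. \<psi> (u 0 x))"
      by (rule solution_entropy_decreasing[OF u(1) d\<psi> d\<psi>1 cont2 _ t]) (simp add: g2_def)
    also have "\<dots> = (LINT x|\<mu>. \<psi> (poly q x))"
      by (rule Bochner_Integration.integral_cong) (auto simp: mu.space_M solution_initial[OF u(1)])
    also have "\<dots> \<le> (LINT x|\<mu>. \<psi> (f x)) + l2norm \<mu> (\<lambda>x. poly q x - f x)"
      by (intro cont f mu.poly_L2)
    also have "l2norm \<mu> (\<lambda>x. poly q x - f x) \<le> e"
      using q l2norm_minus_commute[of \<mu> f "poly q"] by simp
    finally show "(LINT x|\<mu>. \<psi> (Q t f x)) \<le> (LINT x|\<mu>. \<psi> (f x)) + 3 * e" by simp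
  qed simp
  also have "(LINT x|\<mu>. \<psi> (f x)) = (LINT x|\<mu>. 0)"
    using pos \<psi>m[OF f] by (intro integral_cong_AE) (auto simp: \<psi>0)
  finally have "(LINT x|\<mu>. \<psi> (Q t f x)) \<le> 0" by simp
  moreover have "(LINT x|\<mu>. \<psi> (Q t f x)) \<ge> 0" by (rule integral_nonneg_AE) (simp add: \<psi>nn)
  ultimately have "(LINT x|\<mu>. \<psi> (Q t f x)) = 0" by simp
  then have "AE x in \<mu>. \<psi> (Q t f x) = 0"
    using integral_nonneg_eq_0_iff_AE[OF \<psi>int[OF Q_L2[OF t f]]] \<psi>nn by simp
  then show ?thesis
  proof eventually_elim
    case (elim x)
    then show ?case using \<psi>pos[of "Q t f x"] by (cases "Q t f x < 0") auto
  qed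
qed

end

section \<open>The generator\<close>

text \<open>The cube makes the positive part twice continuously differentiable.\<close>

definition bump :: "real \<Rightarrow> real \<Rightarrow> real \<Rightarrow> real" where
  "bump c d x = (max 0 ((x - c) * (d - x))) ^ 3"

lemma bump_outside: "c \<le> d \<Longrightarrow> x \<notin> {c<..<d} \<Longrightarrow> bump c d x = 0"
  by (auto simp: bump_def max_def mult_le_0_iff zero_le_mult_iff not_less)

lemma bump_pos: "x \<in> {c<..<d} \<Longrightarrow> bump c d x > 0"
  by (simp add: bump_def)

lemma continuous_bump: "continuous_on S (bump c d)"
  unfolding bump_def[abs_def] by (intro continuous_intros)

lemma Ck2_poly_bump: "Ck 2 S (\<lambda>x. poly q x * bump c d x)"
proof -
  define r where "r x = (x - c) * (d - x)" for x
  define r1 where "r1 x = c + d - 2 * x" for x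
  have dr: "(r has_real_derivative r1 x) (at x)" for x
    unfolding r_def[abs_def] r1_def by (auto intro!: derivative_eq_intros simp: algebra_simps)
  have dr1: "(r1 has_real_derivative - 2) (at x)" for x
    unfolding r1_def[abs_def] by (auto intro!: derivative_eq_intros)
  have pow: "((\<lambda>y. (max 0 y) ^ Suc (Suc n)) has_real_derivative (real (Suc (Suc n)) * (max 0 y) ^ Suc n)) (at y)"
    for n and y :: real
    by (rule has_derivative_positive_part[where g = "\<lambda>s. s ^ Suc (Suc n)"
          and g' = "\<lambda>s. real (Suc (Suc n)) * s ^ Suc n"])
       (auto intro!: derivative_eq_intros simp del: power_Suc)
  define b0 b1 b2 :: "real \<Rightarrow> real"
    where "b0 y = (max 0 y) ^ 3" and "b1 y = 3 * (max 0 y)\<^sup>2" and "b2 y = 6 * max 0 y" for y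
  have db0: "(b0 has_real_derivative b1 y) (at y)" for y
    using pow[of 1 y] by (simp add: b0_def[abs_def] b1_def numeral_3_eq_3 numeral_2_eq_2)
  have db1: "(b1 has_real_derivative b2 y) (at y)" for y
    using DERIV_cmult[OF pow[of 0 y], of 3]
    by (simp add: b1_def[abs_def] b2_def numeral_2_eq_2)
  have db0r: "((\<lambda>x. b0 (r x)) has_real_derivative b1 (r x) * r1 x) (at x)" for x
    by (rule DERIV_chain2[OF db0 dr])
  have db1r: "((\<lambda>x. b1 (r x)) has_real_derivative b2 (r x) * r1 x) (at x)" for x
    by (rule DERIV_chain2[OF db1 dr])
  let ?q1 = "pderiv q" and ?q2 = "pderiv (pderiv q)"
  define D0 D1 D2 where "D0 x = poly q x * b0 (r x)"
    and "D1 x = poly ?q1 x * b0 (r x) + poly q x * (b1 (r x) * r1 x)"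
    and "D2 x = poly ?q2 x * b0 (r x) + 2 * (poly ?q1 x * (b1 (r x) * r1 x))
      + poly q x * (b2 (r x) * (r1 x)\<^sup>2 - 2 * b1 (r x))" for x
  have 0: "(D0 has_real_derivative D1 x) (at x)" for x
    unfolding D0_def[abs_def] D1_def
    by (rule derivative_eq_intros poly_DERIV db0r refl | simp add: algebra_simps)+
  have 1: "(D1 has_real_derivative D2 x) (at x)" for x
    unfolding D1_def[abs_def] D2_def
    by (rule derivative_eq_intros poly_DERIV db0r db1r dr1 refl
        | simp add: algebra_simps power2_eq_square)+
  have 2: "continuous_on S D2"
    unfolding D2_def[abs_def] b0_def b1_def b2_def r_def r1_def by (intro continuous_intros)
  show ?thesis
    unfolding Ck_def
  proof (intro exI[of _ "\<lambda>n. if n = 0 then D0 else if n = 1 then D1 else D2"] conjI allI impI ballI)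
    fix n x assume "n < (2::nat)"
    then have "n = 0 \<or> n = 1" by auto
    then show "((if n = 0 then D0 else if n = 1 then D1 else D2) has_real_derivative
        (if Suc n = 0 then D0 else if Suc n = 1 then D1 else D2) x) (at x within S)"
      using has_field_derivative_at_within[OF 0] has_field_derivative_at_within[OF 1] by auto
  qed (use 2 in \<open>auto simp: D0_def b0_def r_def bump_def\<close>)
qed

context transverse_kimura
begin

lemma continuous_L_open:
  assumes "Ck 2 {0<..<1} f"
  shows "continuous_on {0<..<1} (L f)"
proof -
  obtain f1 f2 where f: "continuous_on {0<..<1} f1" "continuous_on {0<..<1} f2"
    "\<And>x. x \<in> {0<..<1} \<Longrightarrow> dx f x = f1 x" "\<And>x. x \<in> {0<..<1} \<Longrightarrow> dx (dx f) x = f2 x"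
    using Ck2_open[OF assms] by metis
  have "continuous_on {0<..<1} B" by (rule continuous_on_subset[OF cont_B]) auto
  then have "continuous_on {0<..<1} (\<lambda>x. A x * f2 x + B x * f1 x)"
    by (intro continuous_intros cont_A' f)
  then show ?thesis
    by (rule continuous_on_cong[THEN iffD1, rotated 2]) (auto simp: kimura_op_def f)
qed

text \<open>Integration by parts with a test function supported inside the open interval; \<open>f\<close> is
  arbitrary near the endpoints. Here \<open>G = p (f v' - f' v)\<close> vanishes outside the support.\<close>

lemma integral_L_test_function:
  assumes f: "Ck 2 {0<..<1} f" "f \<in> L2 \<mu>" and v: "Ck 2 {0..1} v"
    and cd: "0 < c" "c \<le> d" "d < 1" and supp: "\<And>x. x \<notin> {c<..<d} \<Longrightarrow> v x = 0"
  shows "(\<lambda>x. v x * L f x) \<in> L2 \<mu>" "(LINT x|\<mu>. f x * L v x) = (LINT x|\<mu>. v x * L f x)"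
proof -
  have contLf: "continuous_on {0<..<1} (L f)" by (rule continuous_L_open[OF f(1)])
  have sub: "{c..d} \<subseteq> {0<..<1}" using cd by auto
  obtain N where N: "N \<ge> 0" "\<And>x. x \<in> {c..d} \<Longrightarrow> \<bar>v x * L f x\<bar> \<le> N"
    by (rule bounded_continuous_Icc[of c d "\<lambda>x. v x * L f x"])
       (use cd in \<open>auto intro!: continuous_intros continuous_on_subset[OF contLf]
          continuous_on_subset[OF continuous_Ck2[OF v]]\<close>)
  have contvLf: "continuous_on {0<..<1} (\<lambda>x. v x * L f x)"
    by (intro continuous_intros contLf continuous_on_subset[OF continuous_Ck2[OF v]]) auto
  show vLf: "(\<lambda>x. v x * L f x) \<in> L2 \<mu>"
  proof (rule mu.L2_bounded[of _ N])
    show "(\<lambda>x. v x * L f x) \<in> borel_measurable \<mu>" by (rule mu.measurable_continuous_Ioo[OF contvLf])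
    show "\<bar>v x * L f x\<bar> \<le> N" for x
      using N supp[of x] by (cases "x \<in> {c<..<d}") auto
  qed
  have fLv: "integrable \<mu> (\<lambda>x. f x * L v x)"
    by (rule L2_mult_integrable[OF f(2) mu.L2_continuous[OF continuous_L[OF v]]])
  obtain f1 f2 where f12: "continuous_on {0<..<1} f"
    "\<And>x. x \<in> {0<..<1} \<Longrightarrow> (f has_real_derivative f1 x) (at x)"
    "\<And>x. x \<in> {0<..<1} \<Longrightarrow> (f1 has_real_derivative f2 x) (at x)"
    "\<And>x. x \<in> {0<..<1} \<Longrightarrow> dx f x = f1 x" "\<And>x. x \<in> {0<..<1} \<Longrightarrow> dx (dx f) x = f2 x"
    by (rule Ck2_open[OF f(1)]) (rule that)
  obtain v1 v2 where v12:
    "\<And>x. x \<in> {0..1} \<Longrightarrow> (v has_real_derivative v1 x) (at x within {0..1})"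
    "\<And>x. x \<in> {0..1} \<Longrightarrow> (v1 has_real_derivative v2 x) (at x within {0..1})"
    "\<And>x. x \<in> {0..1} \<Longrightarrow> dx v x = v1 x" "\<And>x. x \<in> {0..1} \<Longrightarrow> dx (dx v) x = v2 x"
    by (rule Ck2_closed[OF v]) (rule that)
  define k where "k x = f x * L v x - v x * L f x" for x
  define G where "G x = p x * (f x * v1 x - f1 x * v x)" for x
  have G_outside: "G x = 0" if "x \<in> {0<..<c} \<union> {d<..<1}" for x
  proof -
    have x: "x \<in> {0<..<1}" using that cd by auto
    have "(v has_real_derivative v1 x) (at x)"
      using v12(1)[of x] x at_within_interior[of x "{0..1}"] by simp
    moreover have "(v has_real_derivative 0) (at x)"
    proof (rule has_field_derivative_transform_within_open[where f = "\<lambda>_. 0" and S = "{0<..<c} \<union> {d<..<1}"])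
      show "\<And>y. y \<in> {0<..<c} \<union> {d<..<1} \<Longrightarrow> 0 = v y" using supp by auto
    qed (use that in auto)
    ultimately have "v1 x = 0" by (rule DERIV_unique)
    moreover have "v x = 0" using supp[of x] that by auto
    ultimately show ?thesis by (simp add: G_def)
  qed
  have "(LINT x|\<mu>. k x) = 0"
  proof (rule mu_integral_derivative_eq_0)
    fix x :: real assume x: "x \<in> {0<..<1}"
    have at: "at x within {0..1} = at x" using x by (intro at_within_interior) auto
    have dv: "(v has_real_derivative v1 x) (at x)" and dv1: "(v1 has_real_derivative v2 x) (at x)"
      using v12(1,2)[of x] x by (simp_all add: at)
    have "w x * k x = B x / A x * p x * (f x * v1 x - f1 x * v x)
        + p x * ((f1 x * v1 x + f x * v2 x) - (f2 x * v x + f1 x * v1 x))"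
      using A_pos[OF x] x f12(4,5)[of x] v12(3,4)[of x]
      by (simp add: k_def w_eq kimura_op_def field_simps)
    moreover have "(G has_real_derivative B x / A x * p x * (f x * v1 x - f1 x * v x)
        + p x * ((f1 x * v1 x + f x * v2 x) - (f2 x * v x + f1 x * v1 x))) (at x)"
      unfolding G_def[abs_def]
      by (rule derivative_eq_intros p_deriv[OF x] f12(2,3)[OF x] dv dv1 refl | simp add: algebra_simps)+
    ultimately show "(G has_real_derivative w x * k x) (at x)" by simp
  next
    have "\<forall>\<^sub>F x in at_right 0. G x = 0"
      unfolding eventually_at_right_field using cd G_outside by (intro exI[of _ c]) auto
    then show "(G \<longlongrightarrow> 0) (at_right 0)" by (rule tendsto_eventually)
    have "\<forall>\<^sub>F x in at_left 1. G x = 0"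
      unfolding eventually_at_left_field using cd G_outside by (intro exI[of _ d]) auto
    then show "(G \<longlongrightarrow> 0) (at_left 1)" by (rule tendsto_eventually)
    have "continuous_on {0<..<1} (L v)"
      by (rule continuous_on_subset[OF continuous_L[OF v]]) auto
    then show "continuous_on {0<..<1} k"
      unfolding k_def[abs_def] by (intro continuous_intros contvLf f12(1))
    show "integrable \<mu> k"
      unfolding k_def[abs_def] using fLv mu.L2_integrable[OF vLf] by simp
  qed
  then show "(LINT x|\<mu>. f x * L v x) = (LINT x|\<mu>. v x * L f x)"
    unfolding k_def using fLv mu.L2_integrable[OF vLf] by simp
qed

end

context kimura_semigroup
begin

abbreviation has_generator :: "(real \<Rightarrow> real) \<Rightarrow> (real \<Rightarrow> real) \<Rightarrow> bool" where
  "has_generator f g \<equiv> ((\<lambda>t. l2norm \<mu> (\<lambda>x. (Q t f x - f x) / t - g x)) \<longlongrightarrow> 0) (at_right 0)"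

lemma quotient_L2: "t > 0 \<Longrightarrow> f \<in> L2 \<mu> \<Longrightarrow> (\<lambda>x. (Q t f x - f x) / t) \<in> L2 \<mu>"
  using L2_scale[OF L2_diff[OF Q_L2], of t f f "1 / t"] by simp

text \<open>The generator is a restriction of the adjoint of \<open>L\<close> on functions of class \<open>C\<^sup>2\<close>. For polynomial data \<open>q\<close>
  close to \<open>f\<close>, \<open>solution_weak\<close> is an exact identity involving \<open>Q s q\<close> at some time \<open>s < t\<close>. Although \<open>s\<close>
  depends on \<open>q\<close>, the distance of \<open>Q s f\<close> from \<open>f\<close> is of order \<open>t\<close> for all \<open>s \<le> t\<close>, since \<open>f\<close> lies in the
  domain; so \<open>q\<close> can tend to \<open>f\<close> first and \<open>t\<close> to \<open>0\<close> afterwards.\<close>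

lemma generator_weak:
  assumes f: "f \<in> L2 \<mu>" and g: "g \<in> L2 \<mu>" and gen: "has_generator f g" and v: "Ck 2 {0..1} v"
  shows "(LINT x|\<mu>. g x * v x) = (LINT x|\<mu>. f x * L v x)"
proof -
  define e where "e t = l2norm \<mu> (\<lambda>x. (Q t f x - f x) / t - g x)" for t
  have vL2: "v \<in> L2 \<mu>" and LvL2: "L v \<in> L2 \<mu>"
    by (intro mu.L2_continuous continuous_Ck2 continuous_L v)+
  define N where "N = l2norm \<mu> (L v)"
  define V where "V = l2norm \<mu> v"
  define G where "G = l2norm \<mu> g + 1"
  have nn: "N \<ge> 0" "V \<ge> 0" "G \<ge> 0" by (auto simp: N_def V_def G_def)
  have "\<forall>\<^sub>F t in at_right 0. e t < 1"
    using order_tendstoD(2)[OF gen, of 1] by (simp add: e_def)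
  then obtain T where T: "T > 0" "\<And>t. 0 < t \<Longrightarrow> t < T \<Longrightarrow> e t < 1"
    unfolding eventually_at_right_field by auto
  have close: "l2norm \<mu> (\<lambda>x. Q s f x - f x) \<le> s * G" if s: "0 < s" "s < T" for s
  proof -
    have "l2norm \<mu> (\<lambda>x. (Q s f x - f x) / s) \<le> e s + l2norm \<mu> g"
      using l2norm_triangle[OF L2_diff[OF quotient_L2[OF s(1) f] g] g] by (simp add: e_def)
    also have "\<dots> \<le> G" using T(2)[OF s] by (simp add: G_def)
    finally have "s * l2norm \<mu> (\<lambda>x. (1 / s) * (Q s f x - f x)) \<le> s * G"
      using s by (intro mult_left_mono) auto
    then show ?thesis using s by (simp only: l2norm_scale) (simp add: field_simps)
  qed
  have pair: "\<bar>(LINT x|\<mu>. F x * h x) - (LINT x|\<mu>. F' x * h x)\<bar> \<le> l2norm \<mu> (\<lambda>x. F x - F' x) * l2norm \<mu> h"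
    if "F \<in> L2 \<mu>" "F' \<in> L2 \<mu>" "h \<in> L2 \<mu>" for F F' h
  proof -
    have "(LINT x|\<mu>. F x * h x) - (LINT x|\<mu>. F' x * h x) = (LINT x|\<mu>. (F x - F' x) * h x)"
      using L2_mult_integrable[OF that(1,3)] L2_mult_integrable[OF that(2,3)]
      by (simp add: left_diff_distrib)
    then show ?thesis using l2norm_Cauchy_Schwarz[OF L2_diff[OF that(1,2)] that(3)] by simp
  qed
  define I where "I = (LINT x|\<mu>. f x * L v x)"
  have main: "\<bar>(LINT x|\<mu>. Q t f x * v x) - (LINT x|\<mu>. f x * v x) - t * I\<bar> \<le> t * (t * G * N)"
    if t: "0 < t" "t < T" for t
  proof (rule le_from_approx)
    fix \<epsilon> :: real assume "\<epsilon> > 0"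
    then obtain q where q: "l2norm \<mu> (\<lambda>x. f x - poly q x) < \<epsilon>"
      using mu.L2_polynomial_approximation[OF f] by blast
    obtain u where u: "solves (poly q) u" "\<forall>t\<ge>0. AE x in \<mu>. Q t (poly q) x = u t x"
      by (rule Q_poly) (rule that)
    obtain s where s: "0 < s" "s < t"
      "(LINT x|\<mu>. u t x * v x) - (LINT x|\<mu>. poly q x * v x) = t * (LINT x|\<mu>. u s x * L v x)"
      by (rule solution_weak[OF u(1) v t(1)]) (rule that)
    have uQ: "(LINT x|\<mu>. u r x * h x) = (LINT x|\<mu>. Q r (poly q) x * h x)"
      if "r \<ge> 0" "h \<in> L2 \<mu>" for r h
      using Q_poly_solution[OF that(1) u] L2_D(1)[OF that(2)] by (intro integral_cong_AE) auto
    have "l2norm \<mu> (\<lambda>x. Q s (poly q) x - f x)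
        \<le> l2norm \<mu> (\<lambda>x. Q s (poly q) x - Q s f x) + l2norm \<mu> (\<lambda>x. Q s f x - f x)"
      using s by (intro l2norm_triangle3 Q_L2 mu.poly_L2 f) auto
    also have "l2norm \<mu> (\<lambda>x. Q s (poly q) x - Q s f x) \<le> 2 * \<epsilon>"
      using Q_diff_norm[OF _ mu.poly_L2 f, of s q] s q l2norm_minus_commute[of \<mu> f "poly q"] by simp
    also have "l2norm \<mu> (\<lambda>x. Q s f x - f x) \<le> t * G"
      using close[of s] s t nn mult_right_mono[of s t G] by simp
    finally have c1: "l2norm \<mu> (\<lambda>x. Q s (poly q) x - f x) \<le> 2 * \<epsilon> + t * G" by simp
    have "\<bar>(LINT x|\<mu>. Q s (poly q) x * L v x) - I\<bar> \<le> l2norm \<mu> (\<lambda>x. Q s (poly q) x - f x) * N"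
      unfolding I_def N_def using s by (intro pair Q_L2 mu.poly_L2 f LvL2) auto
    also have "\<dots> \<le> (2 * \<epsilon> + t * G) * N" using c1 nn by (intro mult_right_mono)
    finally have c2: "\<bar>(LINT x|\<mu>. Q s (poly q) x * L v x) - I\<bar> \<le> (2 * \<epsilon> + t * G) * N" .
    have "\<bar>(LINT x|\<mu>. Q t f x * v x) - (LINT x|\<mu>. Q t (poly q) x * v x)\<bar>
        \<le> l2norm \<mu> (\<lambda>x. Q t f x - Q t (poly q) x) * V"
      unfolding V_def using t by (intro pair Q_L2 mu.poly_L2 f vL2) auto
    also have "\<dots> \<le> (2 * \<epsilon>) * V"
      using Q_diff_norm[OF _ f mu.poly_L2, of t q] t q nn by (intro mult_right_mono) auto
    finally have c3: "\<bar>(LINT x|\<mu>. Q t f x * v x) - (LINT x|\<mu>. Q t (poly q) x * v x)\<bar> \<le> 2 * \<epsilon> * V" .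
    have "\<bar>(LINT x|\<mu>. f x * v x) - (LINT x|\<mu>. poly q x * v x)\<bar>
        \<le> l2norm \<mu> (\<lambda>x. f x - poly q x) * V"
      unfolding V_def by (intro pair mu.poly_L2 f vL2)
    also have "\<dots> \<le> \<epsilon> * V" using q nn by (intro mult_right_mono) auto
    finally have c4: "\<bar>(LINT x|\<mu>. f x * v x) - (LINT x|\<mu>. poly q x * v x)\<bar> \<le> \<epsilon> * V" .
    have s3: "(LINT x|\<mu>. Q t (poly q) x * v x) - (LINT x|\<mu>. poly q x * v x)
        = t * (LINT x|\<mu>. Q s (poly q) x * L v x)"
      using s(3) uQ[OF _ vL2, of t] uQ[OF _ LvL2, of s] s t by simp
    have "t * \<bar>(LINT x|\<mu>. Q s (poly q) x * L v x) - I\<bar> \<le> t * ((2 * \<epsilon> + t * G) * N)"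
      using c2 t by (intro mult_left_mono) auto
    then have c5: "\<bar>t * (LINT x|\<mu>. Q s (poly q) x * L v x) - t * I\<bar> \<le> t * ((2 * \<epsilon> + t * G) * N)"
      using t by (simp add: abs_mult flip: right_diff_distrib)
    have "\<bar>(LINT x|\<mu>. Q t f x * v x) - (LINT x|\<mu>. f x * v x) - t * I\<bar>
        \<le> 2 * \<epsilon> * V + \<epsilon> * V + t * ((2 * \<epsilon> + t * G) * N)"
      using c3 c4 c5 s3 by linarith
    also have "\<dots> = t * (t * G * N) + (3 * V + 2 * t * N) * \<epsilon>" by (simp add: algebra_simps)
    finally show "\<bar>(LINT x|\<mu>. Q t f x * v x) - (LINT x|\<mu>. f x * v x) - t * I\<bar>
        \<le> t * (t * G * N) + (3 * V + 2 * t * N) * \<epsilon>" .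
  qed (use nn t in simp)
  have bound: "\<bar>(LINT x|\<mu>. g x * v x) - I\<bar> \<le> e t * V + t * G * N" if t: "0 < t" "t < T" for t
  proof -
    have eq: "(LINT x|\<mu>. (Q t f x - f x) / t * v x)
        = ((LINT x|\<mu>. Q t f x * v x) - (LINT x|\<mu>. f x * v x)) / t"
    proof -
      have "(LINT x|\<mu>. (Q t f x - f x) / t * v x) = (LINT x|\<mu>. (Q t f x * v x - f x * v x) / t)"
        by (intro Bochner_Integration.integral_cong) (auto simp: left_diff_distrib)
      then show ?thesis
        using L2_mult_integrable[OF Q_L2 vL2, of t f] L2_mult_integrable[OF f vL2] t f by simp
    qed
    have "\<bar>(LINT x|\<mu>. (Q t f x - f x) / t * v x) - (LINT x|\<mu>. g x * v x)\<bar> \<le> e t * V"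
      unfolding e_def V_def by (intro pair quotient_L2 t f g vL2)
    moreover have "\<bar>(LINT x|\<mu>. (Q t f x - f x) / t * v x) - I\<bar> \<le> t * G * N"
    proof -
      have "(LINT x|\<mu>. (Q t f x - f x) / t * v x) - I
          = ((LINT x|\<mu>. Q t f x * v x) - (LINT x|\<mu>. f x * v x) - t * I) / t"
        unfolding eq using t by (simp add: field_simps)
      then show ?thesis using main[OF t] t by (simp add: pos_divide_le_eq mult.commute)
    qed
    ultimately show ?thesis by linarith
  qed
  have lim: "((\<lambda>t. e t * V + t * G * N) \<longlongrightarrow> 0 * V + 0 * G * N) (at_right 0)"
    using gen unfolding e_def[symmetric] by (intro tendsto_intros) (simp_all add: e_def[abs_def])
  have "\<bar>(LINT x|\<mu>. g x * v x) - I\<bar> \<le> 0 * V + 0 * G * N"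
  proof (rule tendsto_lowerbound[OF lim])
    show "\<forall>\<^sub>F t in at_right 0. \<bar>(LINT x|\<mu>. g x * v x) - I\<bar> \<le> e t * V + t * G * N"
      unfolding eventually_at_right_field using T(1) bound by auto
  qed simp
  then show ?thesis by (simp add: I_def)
qed

text \<open>The weak identity with \<open>v\<close> a polynomial times a bump says that \<open>(g - L f) bump\<close> is orthogonal to all
  polynomials, hence zero almost everywhere. The bump is positive on its interval.\<close>

lemma generator_eq_L:
  assumes f: "f \<in> L2 \<mu>" "Ck 2 {0<..<1} f" and g: "g \<in> L2 \<mu>" and gen: "has_generator f g"
  shows "AE x in \<mu>. g x = L f x"
proof -
  have local: "AE x in \<mu>. x \<in> {c<..<d} \<longrightarrow> g x = L f x" if cd: "0 < c" "c \<le> d" "d < 1" for c d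
  proof -
    have v: "Ck 2 {0..1} (\<lambda>x. poly q x * bump c d x)" for q by (rule Ck2_poly_bump)
    have supp: "poly q x * bump c d x = 0" if "x \<notin> {c<..<d}" for q x
      using bump_outside[OF cd(2) that] by simp
    define F where "F x = bump c d x * g x - bump c d x * L f x" for x
    obtain N where N: "N \<ge> 0" "\<And>x. x \<in> {0..1} \<Longrightarrow> \<bar>bump c d x\<bar> \<le> N"
      by (rule bounded_continuous_Icc[OF continuous_bump]) (rule that)
    have bg: "(\<lambda>x. bump c d x * g x) \<in> L2 \<mu>"
      using mu.measurable_continuous_Icc[OF continuous_bump] N
      by (intro L2_bounded_mult[OF g]) (auto simp: mu.space_M)
    have bL: "(\<lambda>x. bump c d x * L f x) \<in> L2 \<mu>"
      using integral_L_test_function(1)[OF f(2,1) v cd supp, of 1] by simp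
    have F: "F \<in> L2 \<mu>" unfolding F_def[abs_def] by (rule L2_diff[OF bg bL])
    have orth: "(LINT x|\<mu>. F x * poly q x) = 0" for q
    proof -
      have "(LINT x|\<mu>. g x * (poly q x * bump c d x)) = (LINT x|\<mu>. poly q x * bump c d x * L f x)"
        using generator_weak[OF f(1) g gen v, of q]
          integral_L_test_function(2)[OF f(2,1) v cd supp, of q] by simp
      moreover have "(LINT x|\<mu>. F x * poly q x)
          = (LINT x|\<mu>. bump c d x * g x * poly q x) - (LINT x|\<mu>. bump c d x * L f x * poly q x)"
        unfolding F_def left_diff_distrib
        by (intro Bochner_Integration.integral_diff L2_mult_integrable bg bL mu.poly_L2)
      ultimately show ?thesis by (simp add: mult_ac)
    qed
    have "(l2norm \<mu> F)\<^sup>2 \<le> 0"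
    proof (rule le_from_approx)
      fix e :: real assume "e > 0"
      then obtain q where q: "l2norm \<mu> (\<lambda>x. F x - poly q x) < e"
        using mu.L2_polynomial_approximation[OF F] by blast
      have "(l2norm \<mu> F)\<^sup>2 = (LINT x|\<mu>. F x * (F x - poly q x))"
        using L2_mult_integrable[OF F F] L2_mult_integrable[OF F mu.poly_L2, of q] orth[of q]
        unfolding l2norm_sq by (simp add: power2_eq_square right_diff_distrib)
      also have "\<dots> \<le> l2norm \<mu> F * l2norm \<mu> (\<lambda>x. F x - poly q x)"
        using l2norm_Cauchy_Schwarz[OF F L2_diff[OF F mu.poly_L2], of q] by simp
      also have "\<dots> \<le> l2norm \<mu> F * e" using q by (intro mult_left_mono) auto
      finally show "(l2norm \<mu> F)\<^sup>2 \<le> 0 + l2norm \<mu> F * e" by simp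
    qed simp
    then have "(LINT x|\<mu>. (F x)\<^sup>2) = 0" unfolding l2norm_sq by (simp add: order_antisym)
    then have "AE x in \<mu>. (F x)\<^sup>2 = 0"
      using integral_nonneg_eq_0_iff_AE[OF L2_D(2)[OF F]] by simp
    then show ?thesis
    proof eventually_elim
      case (elim x)
      then show ?case using bump_pos[of x c d] by (auto simp: F_def)
    qed
  qed
  (* Halving makes the open intervals cover the closed intervals of the exhaustion. *)
  have "AE x in \<mu>. \<forall>n. x \<in> {lo n / 2<..<1 - lo n / 2} \<longrightarrow> g x = L f x"
    unfolding AE_all_countable
  proof
    fix n
    show "AE x in \<mu>. x \<in> {lo n / 2<..<1 - lo n / 2} \<longrightarrow> g x = L f x"
      by (rule local) (use lo_hi[of n] in auto)
  qed
  then show ?thesis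
    using AE_interior
  proof eventually_elim
    case (elim x)
    obtain n where "x \<in> {lo n..hi n}"
      using exhaustion[OF elim(2)] by (auto simp: eventually_sequentially)
    then have "x \<in> {lo n / 2<..<1 - lo n / 2}" using lo_hi(1)[of n] by (auto simp: hi_def)
    then show ?case using elim(1) by blast
  qed
qed

text \<open>The derivative at \<open>t = 0\<close> of the decay estimate: by Cauchy-Schwarz
  \<open>\<integral> Q t f * f d\<mu> \<le> exp (- t / (2 C)) \<integral> f\<^sup>2 d\<mu>\<close>, with equality at \<open>t = 0\<close>.\<close>

lemma generator_dissipative:
  assumes C: "poincare_const C" and f: "f \<in> L2 \<mu>" "(LINT x|\<mu>. f x) = 0"
    and g: "g \<in> L2 \<mu>" and gen: "has_generator f g"
  shows "(LINT x|\<mu>. (f x)\<^sup>2) \<le> C * (- 2 * (LINT x|\<mu>. g x * f x))"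
proof -
  have C0: "C > 0" by (rule poincare_const_pos[OF C])
  define E where "E = (LINT x|\<mu>. (f x)\<^sup>2)"
  define n where "n = l2norm \<mu> f"
  define e where "e t = l2norm \<mu> (\<lambda>x. (Q t f x - f x) / t - g x)" for t
  have En: "E = n\<^sup>2" by (simp add: E_def n_def l2norm_sq)
  have bound: "(LINT x|\<mu>. g x * f x) \<le> (exp (- t / (2 * C)) - 1) / t * E + e t * n" if t: "t > 0" for t
  proof -
    have t0: "t \<ge> 0" using t by simp
    have "(LINT x|\<mu>. Q t f x * f x) \<le> l2norm \<mu> (Q t f) * n"
      using l2norm_Cauchy_Schwarz[OF Q_L2[OF t0 f(1)] f(1)] by (simp add: n_def)
    also have "\<dots> \<le> (exp (- t / (2 * C)) * n) * n"
      using Q_decay[OF C t0 f(1)] f(2) by (intro mult_right_mono) (auto simp: n_def)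
    finally have "(LINT x|\<mu>. Q t f x * f x) - E \<le> (exp (- t / (2 * C)) - 1) * E"
      by (simp add: En power2_eq_square algebra_simps)
    then have "((LINT x|\<mu>. Q t f x * f x) - E) / t \<le> ((exp (- t / (2 * C)) - 1) * E) / t"
      using t by (intro divide_right_mono) auto
    then have "((LINT x|\<mu>. Q t f x * f x) - E) / t \<le> (exp (- t / (2 * C)) - 1) / t * E"
      by (simp only: times_divide_eq_left)
    moreover have "(LINT x|\<mu>. (Q t f x - f x) / t * f x) = ((LINT x|\<mu>. Q t f x * f x) - E) / t"
    proof -
      have "(LINT x|\<mu>. (Q t f x - f x) / t * f x) = (LINT x|\<mu>. (Q t f x * f x - (f x)\<^sup>2) / t)"
        by (intro Bochner_Integration.integral_cong) (auto simp: left_diff_distrib power2_eq_square)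
      then show ?thesis
        using L2_mult_integrable[OF Q_L2[OF t0 f(1)] f(1)] L2_D(2)[OF f(1)] by (simp add: E_def)
    qed
    moreover have "(LINT x|\<mu>. g x * f x) \<le> (LINT x|\<mu>. (Q t f x - f x) / t * f x) + e t * n"
    proof -
      have "(LINT x|\<mu>. (Q t f x - f x) / t * f x) - (LINT x|\<mu>. g x * f x)
          = (LINT x|\<mu>. ((Q t f x - f x) / t - g x) * f x)"
        using L2_mult_integrable[OF quotient_L2[OF t f(1)] f(1)] L2_mult_integrable[OF g f(1)]
        by (subst left_diff_distrib[of _ "g _"]) simp
      then show ?thesis
        using l2norm_Cauchy_Schwarz[OF L2_diff[OF quotient_L2[OF t f(1)] g] f(1)]
        by (simp add: e_def n_def)
    qed
    ultimately show ?thesis by linarith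
  qed
  have "((\<lambda>t. exp (- t / (2 * C))) has_real_derivative - 1 / (2 * C)) (at 0)"
    using C0 by (auto intro!: derivative_eq_intros)
  then have "((\<lambda>t. (exp (- t / (2 * C)) - 1) / t) \<longlongrightarrow> - 1 / (2 * C)) (at 0)"
    unfolding has_field_derivative_iff by simp
  then have "((\<lambda>t. (exp (- t / (2 * C)) - 1) / t) \<longlongrightarrow> - 1 / (2 * C)) (at_right 0)"
    by (rule filterlim_at_split[THEN iffD1, THEN conjunct2])
  then have lim: "((\<lambda>t. (exp (- t / (2 * C)) - 1) / t * E + e t * n)
      \<longlongrightarrow> - 1 / (2 * C) * E + 0 * n) (at_right 0)"
    using gen unfolding e_def[symmetric] by (intro tendsto_add tendsto_mult_right)
  have "(LINT x|\<mu>. g x * f x) \<le> - 1 / (2 * C) * E + 0 * n"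
  proof (rule tendsto_lowerbound[OF lim])
    show "\<forall>\<^sub>F t in at_right 0. (LINT x|\<mu>. g x * f x) \<le> (exp (- t / (2 * C)) - 1) / t * E + e t * n"
      unfolding eventually_at_right_field using bound by (intro exI[of _ 1]) auto
  qed simp
  then show ?thesis using C0 by (simp add: E_def field_simps)
qed

lemma one_in_generator_domain: "(\<lambda>_. 1) \<in> generator_domain \<mu> Q"
proof -
  have "l2norm \<mu> (\<lambda>x. (Q t (\<lambda>_. 1) x - 1) / t - 0) = 0" if t: "t > 0" for t
  proof -
    obtain C where C: "poincare_const C" using ex_poincare_const by blast
    have "l2norm \<mu> (\<lambda>x. Q t (\<lambda>_. 1) x - 1) \<le> exp (- t / (2 * C)) * l2norm \<mu> (\<lambda>x. 1 - 1)"
      using Q_decay[OF C, of t "\<lambda>_. 1"] t by (simp add: mu.prob_space)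
    then have "l2norm \<mu> (\<lambda>x. Q t (\<lambda>_. 1) x - 1) = 0"
      by (simp add: mu.l2norm_const order_antisym)
    then show ?thesis using l2norm_scale[of \<mu> "1 / t" "\<lambda>x. Q t (\<lambda>_. 1) x - 1"] by simp
  qed
  then have "((\<lambda>t. l2norm \<mu> (\<lambda>x. (Q t (\<lambda>_. 1) x - 1) / t - 0)) \<longlongrightarrow> 0) (at_right 0)"
    by (intro tendsto_eventually) (auto simp: eventually_at_right_field intro!: exI[of _ 1])
  then show ?thesis unfolding generator_domain_def by (auto intro!: bexI[of _ "\<lambda>_. 0"])
qed

text \<open>The carre du champ identity \<open>L (f\<^sup>2) = 2 f L f + |\<nabla>f|\<^sup>2\<close>.\<close>

lemma L_square:
  assumes f: "Ck 2 {0<..<1} f" and x: "x \<in> {0<..<1}"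
  shows "(grad_z a m0 m1 f x)\<^sup>2 - L (\<lambda>y. (f y)\<^sup>2) x = - 2 * (L f x * f x)"
proof -
  obtain f1 f2 where f12:
    "\<And>x. x \<in> {0<..<1} \<Longrightarrow> (f has_real_derivative f1 x) (at x)"
    "\<And>x. x \<in> {0<..<1} \<Longrightarrow> (f1 has_real_derivative f2 x) (at x)"
    "\<And>x. x \<in> {0<..<1} \<Longrightarrow> dx f x = f1 x" "\<And>x. x \<in> {0<..<1} \<Longrightarrow> dx (dx f) x = f2 x"
    using Ck2_open[OF f] by metis
  have d1: "dx (\<lambda>y. (f y)\<^sup>2) y = 2 * (f y * f1 y)" if "y \<in> {0<..<1}" for y
  proof (rule dx_eq)
    have "((\<lambda>y. (f y)\<^sup>2) has_real_derivative 2 * (f y * f1 y)) (at y)"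
      by (rule derivative_eq_intros f12(1)[OF that] refl | simp)+
    then show "((\<lambda>y. (f y)\<^sup>2) has_real_derivative 2 * (f y * f1 y)) (at y within {0..1})"
      by (rule has_field_derivative_at_within)
  qed (use that in auto)
  have "((\<lambda>y. 2 * (f y * f1 y)) has_real_derivative 2 * (f1 x * f1 x + f x * f2 x)) (at x)"
    by (rule derivative_eq_intros f12(1,2)[OF x] refl | simp)+
  then have "(dx (\<lambda>y. (f y)\<^sup>2) has_real_derivative 2 * (f1 x * f1 x + f x * f2 x)) (at x)"
    by (rule has_field_derivative_transform_within_open[where S = "{0<..<1}"]) (use x d1 in auto)
  then have d2: "dx (dx (\<lambda>y. (f y)\<^sup>2)) x = 2 * (f1 x * f1 x + f x * f2 x)"
    using x by (intro dx_eq) (auto intro: has_field_derivative_at_within)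
  show ?thesis
    using x grad_z_sq[of x f] f12(3,4)[OF x] d1[OF x] d2
    by (simp add: kimura_op_def algebra_simps power2_eq_square)
qed

lemma lyapunov_poincare_one:
  assumes C: "poincare_const C"
  shows "lyapunov_poincare a b m0 m1 Q (\<lambda>_. 1) C"
  unfolding lyapunov_poincare_def Let_def
proof (intro conjI ballI impI one_in_generator_domain)
  fix f assume f: "f \<in> generator_domain \<mu> Q" "Ck 2 {0<..<1} f" "(LINT x|\<mu>. f x) = 0"
    and int: "integrable \<mu> (\<lambda>x. 1 * (grad_z a m0 m1 f x)\<^sup>2)" "integrable \<mu> (\<lambda>x. 1 * L (\<lambda>y. (f y)\<^sup>2) x)"
  obtain g where fL2: "f \<in> L2 \<mu>" and g: "g \<in> L2 \<mu>" "has_generator f g"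
    using f(1) by (auto simp: generator_domain_def)
  have "(LINT x|\<mu>. (f x)\<^sup>2) \<le> C * (- 2 * (LINT x|\<mu>. g x * f x))"
    by (rule generator_dissipative[OF C fL2 f(3) g])
  also have "- 2 * (LINT x|\<mu>. g x * f x) = (LINT x|\<mu>. - 2 * (g x * f x))" by simp
  also have "\<dots> = (LINT x|\<mu>. 1 * (grad_z a m0 m1 f x)\<^sup>2 - 1 * L (\<lambda>y. (f y)\<^sup>2) x)"
  proof (rule integral_cong_AE)
    show "AE x in \<mu>. - 2 * (g x * f x) = 1 * (grad_z a m0 m1 f x)\<^sup>2 - 1 * L (\<lambda>y. (f y)\<^sup>2) x"
      using generator_eq_L[OF fL2 f(2) g] AE_interior
      by eventually_elim (simp add: L_square[OF f(2)])
    show "(\<lambda>x. - 2 * (g x * f x)) \<in> borel_measurable \<mu>"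
      using L2_D(1)[OF fL2] L2_D(1)[OF g(1)] by simp
    show "(\<lambda>x. 1 * (grad_z a m0 m1 f x)\<^sup>2 - 1 * L (\<lambda>y. (f y)\<^sup>2) x) \<in> borel_measurable \<mu>"
      by (rule borel_measurable_integrable[OF Bochner_Integration.integrable_diff[OF int]])
  qed
  finally show "(LINT x|\<mu>. (f x)\<^sup>2 * 1)
      \<le> C * (LINT x|\<mu>. 1 * (grad_z a m0 m1 f x)\<^sup>2 - 1 * L (\<lambda>y. (f y)\<^sup>2) x)" by simp
qed simp

end

section \<open>The dual action on measures\<close>

context kimura_semigroup
begin

text \<open>The dual action on the measure \<open>v\<close> with density \<open>h\<close>, with \<open>v\<close> eliminated so that \<open>L\<^sup>2\<close> estimates
  for \<open>\<mu>\<close> apply.\<close>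

definition dual_mass :: "real \<Rightarrow> (real \<Rightarrow> real) \<Rightarrow> real set \<Rightarrow> real" where
  "dual_mass t h S = (LINT x|\<mu>. h x * Q t (indicator S) x)"

lemma dual_mass_nonneg:
  assumes "t \<ge> 0" "AE x in \<mu>. h x \<ge> 0" "S \<in> sets \<mu>"
  shows "dual_mass t h S \<ge> 0"
  unfolding dual_mass_def
proof (rule integral_nonneg_AE)
  have "AE x in \<mu>. Q t (indicator S) x \<ge> 0"
    using assms by (intro Q_nonneg mu.L2_indicator) auto
  with assms(2) show "AE x in \<mu>. 0 \<le> h x * Q t (indicator S) x"
    by eventually_elim simp
qed

lemma dual_mass_diff_bound:
  assumes "t \<ge> 0" "h \<in> L2 \<mu>" "S \<in> sets \<mu>" "S' \<in> sets \<mu>"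
  shows "\<bar>dual_mass t h S - dual_mass t h S'\<bar>
    \<le> l2norm \<mu> h * (2 * l2norm \<mu> (\<lambda>x. indicator S x - indicator S' x))"
proof -
  have L: "(indicator S :: real \<Rightarrow> real) \<in> L2 \<mu>" "(indicator S' :: real \<Rightarrow> real) \<in> L2 \<mu>"
    using assms by (auto intro: mu.L2_indicator)
  note QL = Q_L2[OF assms(1) L(1)] Q_L2[OF assms(1) L(2)]
  have "dual_mass t h S - dual_mass t h S'
      = (LINT x|\<mu>. h x * (Q t (indicator S) x - Q t (indicator S') x))"
    unfolding dual_mass_def
    using L2_mult_integrable[OF assms(2) QL(1)] L2_mult_integrable[OF assms(2) QL(2)]
    by (simp add: right_diff_distrib)
  then have "\<bar>dual_mass t h S - dual_mass t h S'\<bar>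
      \<le> l2norm \<mu> h * l2norm \<mu> (\<lambda>x. Q t (indicator S) x - Q t (indicator S') x)"
    using l2norm_Cauchy_Schwarz[OF assms(2) L2_diff[OF QL]] by simp
  also have "\<dots> \<le> l2norm \<mu> h * (2 * l2norm \<mu> (\<lambda>x. indicator S x - indicator S' x))"
    by (intro mult_left_mono Q_diff_norm assms L) simp
  finally show ?thesis .
qed

lemma dual_mass_Un:
  assumes t: "t \<ge> 0" and h: "h \<in> L2 \<mu>" and S: "S \<in> sets \<mu>" "S' \<in> sets \<mu>" "S \<inter> S' = {}"
  shows "dual_mass t h (S \<union> S') = dual_mass t h S + dual_mass t h S'"
proof -
  have L: "(indicator S :: real \<Rightarrow> real) \<in> L2 \<mu>" "(indicator S' :: real \<Rightarrow> real) \<in> L2 \<mu>"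
    "(indicator (S \<union> S') :: real \<Rightarrow> real) \<in> L2 \<mu>"
    using S by (auto intro: mu.L2_indicator)
  note QL = Q_L2[OF t L(1)] Q_L2[OF t L(2)] Q_L2[OF t L(3)]
  have "indicator (S \<union> S') = (\<lambda>x. 1 * indicator S x + 1 * indicator S' x :: real)"
    using S(3) by (auto simp: indicator_def fun_eq_iff)
  with Q_lincomb[OF t L(1,2), of 1 1]
  have AE: "AE x in \<mu>. Q t (indicator (S \<union> S')) x = Q t (indicator S) x + Q t (indicator S') x"
    by simp
  have "dual_mass t h (S \<union> S') = (LINT x|\<mu>. h x * Q t (indicator S) x + h x * Q t (indicator S') x)"
    unfolding dual_mass_def
  proof (rule integral_cong_AE)
    show "AE x in \<mu>. h x * Q t (indicator (S \<union> S')) x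
        = h x * Q t (indicator S) x + h x * Q t (indicator S') x"
      using AE by eventually_elim (simp add: distrib_left)
  qed (use L2_D(1)[OF h] L2_D(1)[OF QL(1)] L2_D(1)[OF QL(2)] L2_D(1)[OF QL(3)] in auto)
  also have "\<dots> = dual_mass t h S + dual_mass t h S'"
    unfolding dual_mass_def
    using L2_mult_integrable[OF h QL(1)] L2_mult_integrable[OF h QL(2)] by simp
  finally show ?thesis .
qed

text \<open>Finite additivity is linearity of \<open>Q t\<close>; the limit uses that indicators of increasing unions converge
  in \<open>L\<^sup>2\<close>.\<close>

lemma dual_mass_sums:
  assumes t: "t \<ge> 0" and h: "h \<in> L2 \<mu>" and S: "range S \<subseteq> sets \<mu>" "disjoint_family S"
  shows "(\<lambda>i. dual_mass t h (S i)) sums dual_mass t h (\<Union>i. S i)"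
proof -
  define U where "U n = (\<Union>i<n. S i)" for n :: nat
  have Sm: "S i \<in> sets \<mu>" for i using S by auto
  then have Um: "U n \<in> sets \<mu>" "(\<Union>i. S i) \<in> sets \<mu>" for n by (auto simp: U_def)
  have partial: "(\<Sum>i<n. dual_mass t h (S i)) = dual_mass t h (U n)" for n
  proof (induction n)
    case 0
    have "dual_mass t h ({} \<union> {}) = dual_mass t h {} + dual_mass t h {}"
      by (rule dual_mass_Un[OF t h]) auto
    then show ?case by (simp add: U_def)
  next
    case (Suc n)
    have "S n \<inter> S i = {}" if "i < n" for i
      using that by (intro disjoint_family_onD[OF S(2)]) auto
    then have "U n \<inter> S n = {}" by (auto simp: U_def)
    moreover have "U (Suc n) = U n \<union> S n" by (auto simp: U_def lessThan_Suc)
    ultimately show ?case using Suc dual_mass_Un[OF t h Um(1) Sm] by simp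
  qed
  have "(\<lambda>n. l2norm \<mu> (\<lambda>x. indicator (\<Union>i. S i) x - indicator (U n) x)) \<longlonglongrightarrow> 0"
  proof (rule l2norm_dominated_tendsto)
    show "(\<lambda>_. 1) \<in> L2 \<mu>" by simp
    show "(\<lambda>n. indicator (U n) x :: real) \<longlonglongrightarrow> indicator (\<Union>i. S i) x" for x
    proof -
      have "(\<Union>n. U n) = (\<Union>i. S i)" by (auto simp: U_def)
      moreover have "incseq U" by (force simp: incseq_def U_def intro: order.strict_trans2)
      ultimately show ?thesis using LIMSEQ_indicator_incseq[of U x] by metis
    qed
    show "\<bar>indicator (\<Union>i. S i) x - indicator (U n) x\<bar> \<le> \<bar>1::real\<bar>" for n x
      by (auto simp: indicator_def)
  qed (use Um in auto)
  then have lim: "(\<lambda>n. l2norm \<mu> h * (2 * l2norm \<mu> (\<lambda>x. indicator (\<Union>i. S i) x - indicator (U n) x)))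
      \<longlonglongrightarrow> l2norm \<mu> h * (2 * 0)"
    by (intro tendsto_intros)
  have "(\<lambda>n. dual_mass t h (\<Union>i. S i) - dual_mass t h (U n)) \<longlonglongrightarrow> 0"
  proof (rule Lim_null_comparison)
    show "\<forall>\<^sub>F n in sequentially. norm (dual_mass t h (\<Union>i. S i) - dual_mass t h (U n))
        \<le> l2norm \<mu> h * (2 * l2norm \<mu> (\<lambda>x. indicator (\<Union>i. S i) x - indicator (U n) x))"
      using dual_mass_diff_bound[OF t h Um(2) Um(1)] by simp
  qed (use lim in simp)
  from tendsto_diff[OF tendsto_const this, of "dual_mass t h (\<Union>i. S i)"]
  show ?thesis by (simp add: sums_def partial)
qed

text \<open>The dual action is defined through \<open>measure_of\<close>, whose value is the given set function only if that
  is a measure. Nonnegativity matters here too, as \<open>ennreal\<close> truncates negative numbers.\<close>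

lemma measure_dual_action:
  assumes t: "t \<ge> 0" and h: "h \<in> L2 \<mu>" "AE x in \<mu>. h x \<ge> 0"
    and v: "v = density \<mu> (\<lambda>x. ennreal (h x))" and S: "S \<in> sets \<mu>"
  shows "measure (dual_action (Q t) v) S = dual_mass t h S"
proof -
  let ?N = "dual_action (Q t) v"
  have sv: "sets v = sets \<mu>" "space v = space \<mu>" by (simp_all add: v)
  have val: "(LINT x|v. Q t (indicator T) x) = dual_mass t h T" if "T \<in> sets \<mu>" for T
    unfolding v dual_mass_def
    using L2_D(1)[OF h(1)] h(2) L2_D(1)[OF Q_L2[OF t mu.L2_indicator[OF that]]]
    by (rule integral_real_density)
  have setsN: "sets ?N = sets \<mu>"
    by (simp add: dual_action_def sv)
  have "emeasure ?N S = ennreal (LINT x|v. Q t (indicator S) x)"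
  proof (rule emeasure_measure_of[of ?N "space v" "sets v" "\<lambda>A. ennreal (LINT x|v. Q t (indicator A) x)"])
    show "?N = measure_of (space v) (sets v) (\<lambda>A. ennreal (LINT x|v. Q t (indicator A) x))"
      by (simp add: dual_action_def)
    show "sets v \<subseteq> Pow (space v)" by (rule sets.space_closed)
    show "S \<in> sets ?N" using S setsN by simp
    have "dual_mass t h ({} \<union> {}) = dual_mass t h {} + dual_mass t h {}"
      by (rule dual_mass_Un[OF t h(1)]) auto
    then show "positive (sets ?N) (\<lambda>A. ennreal (LINT x|v. Q t (indicator A) x))"
      using val[of "{}"] by (simp add: positive_def)
    show "countably_additive (sets ?N) (\<lambda>A. ennreal (LINT x|v. Q t (indicator A) x))"
    proof (rule countably_additiveI)
      fix F :: "nat \<Rightarrow> real set"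
      assume F: "range F \<subseteq> sets ?N" "disjoint_family F" "(\<Union>i. F i) \<in> sets ?N"
      then have Fm: "F i \<in> sets \<mu>" "(\<Union>i. F i) \<in> sets \<mu>" for i by (auto simp: setsN)
      have "(\<Sum>i. ennreal (dual_mass t h (F i))) = ennreal (dual_mass t h (\<Union>i. F i))"
        using F by (intro suminf_ennreal_eq dual_mass_nonneg dual_mass_sums t h Fm) (auto simp: setsN)
      then show "(\<Sum>i. ennreal (LINT x|v. Q t (indicator (F i)) x))
          = ennreal (LINT x|v. Q t (indicator (\<Union>i. F i)) x)"
        by (simp add: val Fm)
    qed
  qed
  then show ?thesis
    using dual_mass_nonneg[OF t h(2) S] by (simp add: measure_def val[OF S])
qed

text \<open>Since \<open>Q t\<close> preserves means and \<open>h\<close> has mean one, the deviation is the pairing of the centred functions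
  \<open>Q\<^sub>t 1\<^sub>S - \<mu> S\<close> and \<open>h - 1\<close>. The factor one half is the bound for the standard deviation of an indicator; it
  compensates the two terms in the total variation.\<close>

lemma dual_mass_deviation:
  assumes C: "poincare_const C" and t: "t \<ge> 0" and h: "h \<in> L2 \<mu>" "(LINT x|\<mu>. h x) = 1"
    and S: "S \<in> sets \<mu>"
  shows "\<bar>dual_mass t h S - measure \<mu> S\<bar>
    \<le> exp (- t / (2 * C)) / 2 * l2norm \<mu> (\<lambda>x. h x - 1)"
proof -
  define m where "m = measure \<mu> S"
  have L: "(indicator S :: real \<Rightarrow> real) \<in> L2 \<mu>" by (rule mu.L2_indicator[OF S])
  have m: "(LINT x|\<mu>. indicator S x) = m" using S by (simp add: m_def)
  note QL = Q_L2[OF t L]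
  have QLm: "(\<lambda>x. Q t (indicator S) x - m) \<in> L2 \<mu>" and hm: "(\<lambda>x. h x - 1) \<in> L2 \<mu>"
    using QL h by (auto intro: L2_diff)
  have "(LINT x|\<mu>. (Q t (indicator S) x - m) * (h x - 1))
      = (LINT x|\<mu>. h x * Q t (indicator S) x - Q t (indicator S) x - m * h x + m)"
    by (intro Bochner_Integration.integral_cong) (auto simp: algebra_simps)
  also have "\<dots> = dual_mass t h S - (LINT x|\<mu>. Q t (indicator S) x) - m * (LINT x|\<mu>. h x) + m"
    unfolding dual_mass_def
    using L2_mult_integrable[OF h(1) QL] mu.L2_integrable[OF QL] mu.L2_integrable[OF h(1)]
    by (simp add: mu.prob_space)
  also have "\<dots> = dual_mass t h S - m" using Q_mass[OF t L] m h(2) by simp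
  finally have "\<bar>dual_mass t h S - m\<bar>
      \<le> l2norm \<mu> (\<lambda>x. Q t (indicator S) x - m) * l2norm \<mu> (\<lambda>x. h x - 1)"
    using l2norm_Cauchy_Schwarz[OF QLm hm] by simp
  also have "\<dots> \<le> (exp (- t / (2 * C)) / 2) * l2norm \<mu> (\<lambda>x. h x - 1)"
  proof (rule mult_right_mono)
    have "(LINT x|\<mu>. (indicator S x - m)\<^sup>2) = (LINT x|\<mu>. (indicator S x)\<^sup>2) - 2 * m * m + m\<^sup>2"
      using mu.integral_variance[OF L, of m] m by simp
    also have "(LINT x|\<mu>. (indicator S x)\<^sup>2) = m"
      using m by (simp add: power2_eq_square flip: indicator_inter_arith)
    also have "m - 2 * m * m + m\<^sup>2 \<le> (1 / 2)\<^sup>2"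
      using zero_le_power2[of "m - 1 / 2"] by (simp add: power2_eq_square algebra_simps)
    finally have "l2norm \<mu> (\<lambda>x. indicator S x - m) \<le> 1 / 2"
      unfolding l2norm_def by (intro real_le_lsqrt) auto
    then have "exp (- t / (2 * C)) * l2norm \<mu> (\<lambda>x. indicator S x - m) \<le> exp (- t / (2 * C)) * (1 / 2)"
      by (intro mult_left_mono) auto
    then show "l2norm \<mu> (\<lambda>x. Q t (indicator S) x - m) \<le> exp (- t / (2 * C)) / 2"
      using Q_decay[OF C t L, unfolded m] by linarith
  qed simp
  finally show ?thesis by (simp add: m_def)
qed

lemma tv_dist_dual_action:
  assumes C: "poincare_const C" and t: "t \<ge> 0" and h: "h \<in> L2 \<mu>" "AE x in \<mu>. h x \<ge> 0"
    and v: "v = density \<mu> (\<lambda>x. ennreal (h x))" "prob_space v"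
  shows "tv_dist (dual_action (Q t) v) \<mu> \<le> exp (- t / (2 * C)) * l2norm \<mu> (\<lambda>x. h x - 1)"
proof -
  interpret v: prob_space v by (rule v(2))
  have "(LINT x|v. 1) = (LINT x|\<mu>. h x * 1)"
    unfolding v(1) by (rule integral_real_density) (use L2_D(1)[OF h(1)] h(2) in auto)
  then have h1: "(LINT x|\<mu>. h x) = 1" by (simp add: v.prob_space)
  show ?thesis
    unfolding tv_dist_def
  proof (rule cSUP_least)
    show "sets \<mu> \<noteq> {}" by auto
    fix S assume S: "S \<in> sets \<mu>"
    then have Sc: "space \<mu> - S \<in> sets \<mu>" by auto
    show "\<bar>measure (dual_action (Q t) v) S - measure \<mu> S\<bar>
        + \<bar>measure (dual_action (Q t) v) (space \<mu> - S) - measure \<mu> (space \<mu> - S)\<bar>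
        \<le> exp (- t / (2 * C)) * l2norm \<mu> (\<lambda>x. h x - 1)"
      using dual_mass_deviation[OF C t h(1) h1 S] dual_mass_deviation[OF C t h(1) h1 Sc]
      unfolding measure_dual_action[OF t h v(1) S] measure_dual_action[OF t h v(1) Sc]
      by simp
  qed
qed

end

section \<open>Exponential convergence to equilibrium\<close>

theorem theorem4p2:
  fixes a b :: "real \<Rightarrow> real" and m0 m1 :: nat
    and Q :: "real \<Rightarrow> (real \<Rightarrow> real) \<Rightarrow> real \<Rightarrow> real" and \<mu> :: "real measure"
  assumes "mixed_kimura a b m0 m1"
    and "transverse0 a b m0" and "transverse1 a b m1"
    and "solution_semigroup a b m0 m1 Q"
    and "\<mu> = kimura_measure a b m0 m1"
  shows "poincare_inequality a b m0 m1 \<and>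
    (\<exists>C_LP>0. (\<exists>W. lyapunov_poincare a b m0 m1 Q W C_LP) \<and>
      (\<forall>f\<in>L2 \<mu>. \<forall>t\<ge>0.
         l2norm \<mu> (\<lambda>x. Q t f x - (LINT y|\<mu>. f y))
           \<le> exp (- t / (2 * C_LP)) * l2norm \<mu> (\<lambda>x. f x - (LINT y|\<mu>. f y))) \<and>
      (\<forall>h\<in>L2 \<mu>. \<forall>v. \<forall>t\<ge>0.
         (AE x in \<mu>. h x \<ge> 0) \<longrightarrow> v = density \<mu> (\<lambda>x. ennreal (h x)) \<longrightarrow> prob_space v \<longrightarrow>
         tv_dist (dual_action (Q t) v) \<mu>
           \<le> exp (- t / (2 * C_LP)) * l2norm \<mu> (\<lambda>x. h x - 1)))"
proof -
  interpret kimura_semigroup a b m0 m1 Q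
    using assms(1-4) by unfold_locales
  obtain C where C: "poincare_const C" using ex_poincare_const by blast
  show ?thesis
    unfolding assms(5)
    using poincare_inequality_holds poincare_const_pos[OF C] lyapunov_poincare_one[OF C]
      Q_decay[OF C] tv_dist_dual_action[OF C]
    by (intro conjI exI[of _ C] ballI allI impI) (assumption | blast)+
qed

end
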